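(* Let $1\le p<q$, let $A$ and $f$ satisfy the structure conditions (S1), (S2), (S3) of the context, and let $u\ge0$ be a weak entire solution of the differential inequality $\sum_{i=1}^m X_i^*A_i(x,u,\mathbf{X}u)\ge f(x,u)$, $x\in\mathbb{R}^n$ (in the weak sense defined in the context). Then $u\equiv0$ (a.e. in $\mathbb{R}^n$).
   Context: Vector fields and metric. $\mathbf{X}=(X_1,\dots,X_m)$ is a system of vector fields $X_j=\sum_{k=1}^n b_{jk}(x)\,\partial/\partial x_k$ on $\mathbb{R}^n$ with real-valued locally Lipschitz coefficients $b_{jk}$. For a function $u$, $X_ju$ is taken in the distributional sense, $\mathbf{X}u=(X_1u,\dots,X_mu)$, and $|\mathbf{X}u|=\big(\sum_j (X_ju)^2\big)^{1/2}$. An absolutely continuous curve $\gamma:[0,T]\to\mathbb{R}^n$ is subunit if $\langle\gamma'(t),\xi\rangle^2\le\sum_j\langle X_j(\gamma(t)),\xi\rangle^2$ for all $\xi\in\mathbb{R}^n$ and a.e. $t$. The Carnot–Carathéodory distance $d(x,y)$ is the infimum of those $T$ for which there is a subunit curve on $[0,T]$ joining $x$ to $y$; $B(x,r)$ are the $d$-balls and $|E|$ is Lebesgue measure. $\mathbb{R}^n$ is assumed to be a Carnot–Carathéodory metric space of homogeneous dimension $Q$ generated by $\mathbf{X}$ (in the sense of Garofalo–Nhieu): $d$ is finite, the identity map $(\mathbb{R}^n,|\cdot|)\to(\mathbb{R}^n,d)$ is continuous, closed $d$-balls are compact, there is a doubling constant $C_d$ with $|B(x,2r)|\le C_d|B(x,r)|$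 for all $x$ and $r>0$, with $Q=\log_2 C_d$, and there are $C_P>0$, $\alpha\ge1$ such that for all balls and all $v\in C^1$, $\sup_{\lambda>0}\lambda\,|\{y\in B(x,r):|v(y)-v_{B(x,r)}|>\lambda\}|\le C_P\,r\int_{B(x,\alpha r)}|\mathbf{X}v|\,dy$, where $v_B$ is the mean of $v$ on $B$. Structure conditions. $A=(A_1,\dots,A_m):\mathbb{R}^n\times\mathbb{R}\times\mathbb{R}^m\to\mathbb{R}^m$ and $f:\mathbb{R}^n\times\mathbb{R}\to\mathbb{R}$ are Carathéodory functions (measurable in $x$, continuous in the remaining variables), and there are constants $\nu_1,\nu_2,\nu_3>0$ such that for all $x\in\mathbb{R}^n$, $u\in\mathbb{R}$, $\xi\in\mathbb{R}^m$: (S1) $A(x,u,\xi)\cdot\xi\ge\nu_1|\xi|^p$; (S2) $|A(x,u,\xi)|\le\nu_2|\xi|^{p-1}$; (S3) $f(x,u)\ge\nu_3|u|^{q-2}u$. Function spaces. For a bounded open $\Omega\subset\mathbb{R}^n$ and $1\le p<\infty$, $\mathfrak{L}_{1,p}(\Omega)$ is the closure of $C^\infty(\overline\Omega)$ in the norm $\big(\int_\Omega(|\mathbf{X}g|^p+|g|^p)\,dx\big)^{1/p}$, and $\overset{\circ}{\mathfrak{L}}_{1,p}(\Omega)$ is the closure of $C_0^\infty(\Omega)$ in the same norm. $\mathfrak{L}_{1,p,loc}(\mathbb{R}^n)$ consists of functions whose restriction to each bounded open $\Omega$ lies in $\mathfrak{L}_{1,p}(\Omega)$. Weak solution. A weak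 (generalized) entire solution of $\sum_i X_i^*A_i(x,u,\mathbf{X}u)\ge f(x,u)$ is a function $u\in\mathfrak{L}_{1,p,loc}(\mathbb{R}^n)$ such that for every bounded open $\Omega\subset\mathbb{R}^n$ and every non-negative $\varphi\in\overset{\circ}{\mathfrak{L}}_{1,p}(\Omega)$, $$\int_\Omega\Big(\sum_{i=1}^m A_i(x,u,\mathbf{X}u)\,X_i\varphi+f(x,u)\,\varphi\Big)dx\le 0.$$ This integral inequality (rather than any sign convention for the adjoint $X_i^*$) fixes the meaning of the differential inequality. *)

theory Defs
  imports "HOL-Analysis.Analysis"
begin

section \<open>Smooth functions\<close>

definition partial :: "'n \<Rightarrow> (real^'n \<Rightarrow> real) \<Rightarrow> real^'n \<Rightarrow> real" where
  "partial k g x = deriv (\<lambda>t. g (x + t *\<^sub>R axis k 1)) 0"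

primrec Ck :: "nat \<Rightarrow> (real^'n \<Rightarrow> real) \<Rightarrow> bool" where
  "Ck 0 g \<longleftrightarrow> continuous_on UNIV g"
| "Ck (Suc N) g \<longleftrightarrow> (\<forall>x. g differentiable at x) \<and> (\<forall>k. Ck N (partial k g))"

text \<open>\<open>C_infty\<close> is the space of smooth functions on the whole space. The space
  \<open>C\<^sup>\<infinity>\<close> of the closure of a bounded open set is read as the space of restrictions
  of its members. \<open>C0_infty \<Omega>\<close> consists of the smooth functions
  with compact support in \<open>\<Omega>\<close>, extended by zero.\<close>

definition C_infty :: "(real^'n \<Rightarrow> real) set" where
  "C_infty = {g. \<forall>N. Ck N g}"

definition C0_infty :: "(real^'n) set \<Rightarrow> (real^'n \<Rightarrow> real) set" where
  "C0_infty \<Omega> = {g \<in> C_infty. \<exists>K. compact K \<and> K \<subseteq> \<Omega> \<and> (\<forall>x. x \<notin> K \<longrightarrow> g x = 0)}"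


section \<open>Systems of vector fields\<close>

text \<open>A system of \<open>m\<close> vector fields on the \<open>n\<close>-dimensional space is given by its coefficient
  matrix: \<open>b x $ j $ k\<close> is the \<open>k\<close>-th coefficient of the \<open>j\<close>-th field at \<open>x\<close>.\<close>

definition locally_lipschitz_fields :: "(real^'n \<Rightarrow> real^'n^'m) \<Rightarrow> bool" where
  "locally_lipschitz_fields b \<longleftrightarrow>
     (\<forall>j k x. \<exists>\<epsilon>>0. \<exists>L. L-lipschitz_on (ball x \<epsilon>) (\<lambda>y. b y $ j $ k))"

definition X_classical ::
    "(real^'n \<Rightarrow> real^'n^'m) \<Rightarrow> (real^'n \<Rightarrow> real) \<Rightarrow> real^'n \<Rightarrow> real^'m" where
  "X_classical b g x = (\<chi> j. \<Sum>k\<in>UNIV. b x $ j $ k * partial k g x)"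

text \<open>The formal adjoint of the \<open>j\<close>-th field. For locally Lipschitz coefficients and smooth
  \<open>\<phi>\<close> the partial derivatives exist almost everywhere.\<close>

definition X_adjoint ::
    "(real^'n \<Rightarrow> real^'n^'m) \<Rightarrow> 'm \<Rightarrow> (real^'n \<Rightarrow> real) \<Rightarrow> real^'n \<Rightarrow> real" where
  "X_adjoint b j \<phi> x = - (\<Sum>k\<in>UNIV. partial k (\<lambda>y. b y $ j $ k * \<phi> y) x)"

text \<open>\<open>X_distr b \<Omega> u G\<close>: the locally integrable field \<open>G\<close> is the distributional
  gradient of \<open>u\<close> along the fields \<open>b\<close> in \<open>\<Omega>\<close>. It is unique up to null sets.\<close>

definition X_distr ::
    "(real^'n \<Rightarrow> real^'n^'m) \<Rightarrow> (real^'n) set \<Rightarrow> (real^'n \<Rightarrow> real) \<Rightarrow> (real^'n \<Rightarrow> real^'m) \<Rightarrow> bool"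
  where
  "X_distr b \<Omega> u G \<longleftrightarrow>
     (\<forall>K. compact K \<and> K \<subseteq> \<Omega> \<longrightarrow> u absolutely_integrable_on K \<and> G absolutely_integrable_on K) \<and>
     (\<forall>\<phi>\<in>C0_infty \<Omega>. \<forall>j.
        (LINT x:\<Omega>|lebesgue. G x $ j * \<phi> x) = (LINT x:\<Omega>|lebesgue. u x * X_adjoint b j \<phi> x))"


section \<open>Carnot-Caratheodory spaces\<close>

definition absolutely_continuous_curve :: "real \<Rightarrow> real \<Rightarrow> (real \<Rightarrow> 'a::real_normed_vector) \<Rightarrow> bool"
  where
  "absolutely_continuous_curve a c \<gamma> \<longleftrightarrow>
     (\<forall>\<epsilon>>0. \<exists>\<delta>>0. \<forall>D. finite D \<and> (\<forall>(s, t)\<in>D. a \<le> s \<and> s \<le> t \<and> t \<le> c) \<and>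
        pairwise (\<lambda>(s, t) (s', t'). disjnt {s<..<t} {s'<..<t'}) D \<and> (\<Sum>(s, t)\<in>D. t - s) < \<delta>
        \<longrightarrow> (\<Sum>(s, t)\<in>D. norm (\<gamma> t - \<gamma> s)) < \<epsilon>)"

definition subunit :: "(real^'n \<Rightarrow> real^'n^'m) \<Rightarrow> real \<Rightarrow> (real \<Rightarrow> real^'n) \<Rightarrow> bool" where
  "subunit b T \<gamma> \<longleftrightarrow> absolutely_continuous_curve 0 T \<gamma> \<and>
     (AE t in lebesgue. t \<in> {0..T} \<longrightarrow>
        (\<exists>v. (\<gamma> has_vector_derivative v) (at t within {0..T}) \<and>
             (\<forall>\<xi>. (v \<bullet> \<xi>)\<^sup>2 \<le> (\<Sum>j\<in>UNIV. (b (\<gamma> t) $ j \<bullet> \<xi>)\<^sup>2))))"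

definition subunit_times :: "(real^'n \<Rightarrow> real^'n^'m) \<Rightarrow> real^'n \<Rightarrow> real^'n \<Rightarrow> real set" where
  "subunit_times b x y = {T. 0 \<le> T \<and> (\<exists>\<gamma>. subunit b T \<gamma> \<and> \<gamma> 0 = x \<and> \<gamma> T = y)}"

text \<open>The infimum is only meaningful if \<open>subunit_times b x y\<close> is nonempty, which is how finiteness
  of the distance is expressed below.\<close>

definition cc_dist :: "(real^'n \<Rightarrow> real^'n^'m) \<Rightarrow> real^'n \<Rightarrow> real^'n \<Rightarrow> real" where
  "cc_dist b x y = Inf (subunit_times b x y)"

definition cc_ball :: "(real^'n \<Rightarrow> real^'n^'m) \<Rightarrow> real^'n \<Rightarrow> real \<Rightarrow> (real^'n) set" where
  "cc_ball b x r = {y. cc_dist b x y < r}"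

definition cc_cball :: "(real^'n \<Rightarrow> real^'n^'m) \<Rightarrow> real^'n \<Rightarrow> real \<Rightarrow> (real^'n) set" where
  "cc_cball b x r = {y. cc_dist b x y \<le> r}"

definition mean :: "(real^'n) set \<Rightarrow> (real^'n \<Rightarrow> real) \<Rightarrow> real" where
  "mean B v = (LINT y:B|lebesgue. v y) / measure lebesgue B"

definition cc_doubling :: "(real^'n \<Rightarrow> real^'n^'m) \<Rightarrow> real \<Rightarrow> bool" where
  "cc_doubling b C \<longleftrightarrow>
     (\<forall>x. \<forall>r>0. emeasure lebesgue (cc_ball b x (2 * r)) \<le> ennreal C * emeasure lebesgue (cc_ball b x r))"

definition cc_weak_poincare :: "(real^'n \<Rightarrow> real^'n^'m) \<Rightarrow> real \<Rightarrow> real \<Rightarrow> bool" where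
  "cc_weak_poincare b C \<alpha> \<longleftrightarrow>
     (\<forall>x. \<forall>r>0. \<forall>v. Ck 1 v \<longrightarrow>
        (SUP \<tau>\<in>{0<..}. ennreal \<tau> *
           emeasure lebesgue {y \<in> cc_ball b x r. \<bar>v y - mean (cc_ball b x r) v\<bar> > \<tau>})
        \<le> ennreal (C * r) * (\<integral>\<^sup>+y\<in>cc_ball b x (\<alpha> * r). ennreal (norm (X_classical b v y)) \<partial>lebesgue))"

text \<open>Continuity of the identity and compactness of closed balls refer to the topology of the
  metric \<open>cc_dist b\<close>.\<close>

definition cc_space :: "(real^'n \<Rightarrow> real^'n^'m) \<Rightarrow> real \<Rightarrow> bool" where
  "cc_space b Q \<longleftrightarrow>
     (\<forall>x y. subunit_times b x y \<noteq> {}) \<and>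
     Metric_space UNIV (cc_dist b) \<and>
     continuous_map euclidean (Metric_space.mtopology UNIV (cc_dist b)) id \<and>
     (\<forall>x r. compactin (Metric_space.mtopology UNIV (cc_dist b)) (cc_cball b x r)) \<and>
     (\<exists>C\<^sub>d. cc_doubling b C\<^sub>d \<and> Q = log 2 C\<^sub>d) \<and>
     (\<exists>C\<^sub>P \<alpha>. C\<^sub>P > 0 \<and> \<alpha> \<ge> 1 \<and> cc_weak_poincare b C\<^sub>P \<alpha>)"


section \<open>Function spaces\<close>

definition X_energy ::
    "real \<Rightarrow> (real^'n \<Rightarrow> real) \<Rightarrow> (real^'n \<Rightarrow> real^'m) \<Rightarrow> real^'n \<Rightarrow> real" where
  "X_energy p g G x = norm (G x) powr p + \<bar>g x\<bar> powr p"

definition X_norm ::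
    "real \<Rightarrow> (real^'n) set \<Rightarrow> (real^'n \<Rightarrow> real) \<Rightarrow> (real^'n \<Rightarrow> real^'m) \<Rightarrow> real" where
  "X_norm p \<Omega> g G = (LINT x:\<Omega>|lebesgue. X_energy p g G x) powr (1 / p)"

text \<open>The closure of a class \<open>D\<close> of smooth functions, taken among the functions on \<open>\<Omega>\<close> that have
  a distributional gradient and finite norm. For smooth functions the distributional and
  the classical gradient coincide almost everywhere. Elements are functions on the whole space
  of which only the restriction to \<open>\<Omega>\<close> matters.\<close>

definition X_closure ::
    "(real^'n \<Rightarrow> real^'n^'m) \<Rightarrow> real \<Rightarrow> (real^'n) set \<Rightarrow> (real^'n \<Rightarrow> real) set \<Rightarrow> (real^'n \<Rightarrow> real) set"
  where
  "X_closure b p \<Omega> D = {g. \<exists>G. X_distr b \<Omega> g G \<and>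
      set_borel_measurable lebesgue \<Omega> g \<and> set_borel_measurable lebesgue \<Omega> G \<and>
      set_integrable lebesgue \<Omega> (X_energy p g G) \<and>
      (\<forall>\<epsilon>>0. \<exists>h\<in>D. X_norm p \<Omega> (\<lambda>x. h x - g x) (\<lambda>x. X_classical b h x - G x) < \<epsilon>)}"

definition L1p :: "(real^'n \<Rightarrow> real^'n^'m) \<Rightarrow> real \<Rightarrow> (real^'n) set \<Rightarrow> (real^'n \<Rightarrow> real) set" where
  "L1p b p \<Omega> = X_closure b p \<Omega> C_infty"

definition L1p_0 :: "(real^'n \<Rightarrow> real^'n^'m) \<Rightarrow> real \<Rightarrow> (real^'n) set \<Rightarrow> (real^'n \<Rightarrow> real) set" where
  "L1p_0 b p \<Omega> = X_closure b p \<Omega> (C0_infty \<Omega>)"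

definition L1p_loc :: "(real^'n \<Rightarrow> real^'n^'m) \<Rightarrow> real \<Rightarrow> (real^'n \<Rightarrow> real) set" where
  "L1p_loc b p = {u. \<forall>\<Omega>. open \<Omega> \<and> bounded \<Omega> \<longrightarrow> u \<in> L1p b p \<Omega>}"


section \<open>The differential inequality\<close>

definition caratheodory ::
    "(real^'n \<Rightarrow> 'a::topological_space \<Rightarrow> 'b::topological_space) \<Rightarrow> bool" where
  "caratheodory F \<longleftrightarrow>
     (\<forall>z. (\<lambda>x. F x z) \<in> borel_measurable lebesgue) \<and> (\<forall>x. continuous_on UNIV (F x))"

text \<open>For \<open>p = 1\<close> the bound in \<open>S2\<close> is \<open>\<nu>\<close>, also at \<open>\<xi> = 0\<close>, whereas \<open>0 powr 0 = 0\<close>.\<close>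

definition S1 :: "real \<Rightarrow> (real^'n \<Rightarrow> real \<Rightarrow> real^'m \<Rightarrow> real^'m) \<Rightarrow> bool" where
  "S1 p A \<longleftrightarrow> (\<exists>\<nu>>0. \<forall>x s \<xi>. A x s \<xi> \<bullet> \<xi> \<ge> \<nu> * norm \<xi> powr p)"

definition S2 :: "real \<Rightarrow> (real^'n \<Rightarrow> real \<Rightarrow> real^'m \<Rightarrow> real^'m) \<Rightarrow> bool" where
  "S2 p A \<longleftrightarrow>
     (\<exists>\<nu>>0. \<forall>x s \<xi>. norm (A x s \<xi>) \<le> \<nu> * (if p = 1 then 1 else norm \<xi> powr (p - 1)))"

definition S3 :: "real \<Rightarrow> (real^'n \<Rightarrow> real \<Rightarrow> real) \<Rightarrow> bool" where
  "S3 q f \<longleftrightarrow> (\<exists>\<nu>>0. \<forall>x s. f x s \<ge> \<nu> * (\<bar>s\<bar> powr (q - 2) * s))"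

text \<open>Integrability is demanded explicitly because the Bochner integral of a non-integrable function
  is \<open>0\<close>. Under the structure conditions and for \<open>u \<ge> 0\<close> it is
  no restriction: the first summand of the integrand is integrable by Hoelder's inequality and the
  second one is non-negative, so the integral always exists in \<open>(-\<infinity>, \<infinity>]\<close>, and it
  is finite if it is at most \<open>0\<close>.\<close>

definition weak_entire_solution ::
    "(real^'n \<Rightarrow> real^'n^'m) \<Rightarrow> real \<Rightarrow> (real^'n \<Rightarrow> real \<Rightarrow> real^'m \<Rightarrow> real^'m) \<Rightarrow>
     (real^'n \<Rightarrow> real \<Rightarrow> real) \<Rightarrow> (real^'n \<Rightarrow> real) \<Rightarrow> bool" where
  "weak_entire_solution b p A f u \<longleftrightarrow> u \<in> L1p_loc b p \<and>
     (\<forall>\<Omega> \<phi> U \<Phi>. open \<Omega> \<and> bounded \<Omega> \<and> \<phi> \<in> L1p_0 b p \<Omega> \<and> (AE x in lebesgue. x \<in> \<Omega> \<longrightarrow> 0 \<le> \<phi> x) \<and>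
        X_distr b \<Omega> u U \<and> X_distr b \<Omega> \<phi> \<Phi> \<longrightarrow>
        set_integrable lebesgue \<Omega>
          (\<lambda>x. (\<Sum>i\<in>UNIV. A x (u x) (U x) $ i * \<Phi> x $ i) + f x (u x) * \<phi> x) \<and>
        (LINT x:\<Omega>|lebesgue.
           (\<Sum>i\<in>UNIV. A x (u x) (U x) $ i * \<Phi> x $ i) + f x (u x) * \<phi> x) \<le> 0)"

end

theory Submission
  imports Defs "HOL-Computational_Algebra.Polynomial"
begin

text \<open>Fix a large \<open>N\<close>, put \<open>w(t) = (t\<^sup>2 / (1 + t\<^sup>2))\<^sup>N\<close> and test the inequality with
  \<open>\<phi> = u w(u) \<psi>\<close>, where \<open>\<psi>\<close> is a cut-off function for the ball \<open>B(x0, R)\<close>. Since the derivative of \<open>t w(t)\<close>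
  is at least \<open>w(t)\<close>, the gradient terms are absorbed by Young's inequality.
  The bound \<open>w \<le> 1\<close> spares all integrability assumptions on powers of \<open>u\<close>, whereas
  \<open>w(t) \<le> t\<^sup>2\<^sup>N\<close> gives the remaining term the decay of a large power of \<open>u\<close>; hence
  \<open>\<integral>\<^bsub>B(x0, R)\<^esub> u\<^sup>q w(u) \<le> D R\<^bsup>-\<sigma>\<^esup> \<bar>B(x0, 4 R)\<bar>\<close> with \<open>\<sigma> = p (2 N + q) / (q - p)\<close>. By doubling the right-hand side
  tends to \<open>0\<close> along \<open>R = 2\<^sup>k\<close> once \<open>2\<^sup>\<sigma>\<close> exceeds the doubling constant.

  The cut-off function has the form \<open>\<psi> = e(V / R - 1)\<close> with \<open>e(s) = exp(- 1 / s)\<close> for \<open>s > 0\<close>. Here \<open>V\<close> is a smooth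
  function close to \<open>max 0 (3 R - d(x0, x))\<close> with \<open>\<bar>X\<^sub>j V\<bar> \<le> 2\<close>, obtained from a supremal convolution
  followed by a mollification. That \<open>\<phi>\<close> is admissible follows by approximating \<open>u\<close>; the
  integration by parts against the merely Lipschitz coefficients rests on the almost everywhere
  differentiability of Lipschitz functions along lines.\<close>

section \<open>Smooth functions\<close>

text \<open>The estimate competes with a volume growth of which only doubling is known, and without
  damping (\<open>N = 0\<close>) the exponent \<open>p * q / (q - p)\<close> may be too small;
  increasing \<open>N\<close> is what makes \<open>\<sigma>\<close> as large as desired. This shapes
  the cut-off. The argument produces \<open>\<psi>\<close> times the power \<open>\<sigma>\<close>
  of the ratio |X \<psi>| / \<psi>. For e the ratio of derivative to value is s^(-2), and e decays
  faster than any power at 0, so the product stays bounded for every \<open>\<sigma>\<close> while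
  \<open>\<psi>\<close> remains smooth. The second obstacle is the distance. It is 1-Lipschitz with
  respect to itself but known only to be continuous in the Euclidean sense. Mollifying it directly
  gives no control along the fields: averaging does not commute with a field of variable
  coefficients, and the commutator calls for a Euclidean Lipschitz bound. The supremal convolution
  supplies that bound and keeps the rate along the fields up to a factor. The rates obtained are
  one-sided, which is enough because each field is treated with both signs.\<close>

lemma partial_eqI:
  assumes "(g has_derivative D) (at x)"
  shows "partial k g x = D (axis k 1)"
proof -
  interpret D: bounded_linear D using assms by (rule has_derivative_bounded_linear)
  have "((\<lambda>t. x + t *\<^sub>R axis k 1) has_derivative (\<lambda>t. t *\<^sub>R axis k 1)) (at (0::real))"
    by (auto intro!: derivative_eq_intros)
  from diff_chain_at[OF this, of g D] assms
  have "((\<lambda>t. g (x + t *\<^sub>R axis k 1)) has_derivative (\<lambda>t. D (t *\<^sub>R axis k 1))) (at 0)"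
    by (simp add: o_def)
  then have "((\<lambda>t. g (x + t *\<^sub>R axis k 1)) has_field_derivative D (axis k 1)) (at 0)"
    unfolding has_field_derivative_def by (simp add: D.scaleR mult_commute_abs)
  then show ?thesis unfolding partial_def by (rule DERIV_imp_deriv)
qed

definition grad :: "(real^'n \<Rightarrow> real) \<Rightarrow> real^'n \<Rightarrow> real^'n" where
  "grad g x = (\<chi> k. partial k g x)"

lemma grad_nth [simp]: "grad g x $ k = partial k g x"
  by (simp add: grad_def)

lemma has_derivative_grad:
  assumes "g differentiable at x"
  shows "(g has_derivative (\<lambda>h. grad g x \<bullet> h)) (at x)"
proof -
  obtain D where D: "(g has_derivative D) (at x)"
    using assms unfolding differentiable_def by blast
  interpret D: bounded_linear D using D by (rule has_derivative_bounded_linear)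
  have "D h = grad g x \<bullet> h" for h
  proof -
    have "D h = D (\<Sum>k\<in>UNIV. h $ k *\<^sub>R axis k 1)"
      by (simp add: scalar_mult_eq_scaleR[symmetric] basis_expansion)
    also have "\<dots> = (\<Sum>k\<in>UNIV. h $ k * D (axis k 1))"
      by (simp add: D.sum D.scaleR)
    also have "\<dots> = grad g x \<bullet> h"
      by (simp add: inner_vec_def partial_eqI[OF D] mult.commute)
    finally show ?thesis .
  qed
  then have "D = (\<lambda>h. grad g x \<bullet> h)" by (rule ext)
  with D show ?thesis by simp
qed

lemma X_classical_eq_inner: "X_classical b g x $ j = grad g x \<bullet> (b x $ j)"
  by (simp add: X_classical_def inner_vec_def mult.commute)

lemma Ck_Suc_imp_Ck: "Ck (Suc N) g \<Longrightarrow> Ck N g"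
proof (induction N arbitrary: g)
  case 0
  then show ?case
    by (auto intro!: differentiable_imp_continuous_on simp: differentiable_on_def
        intro: differentiable_at_withinI)
next
  case (Suc N)
  then show ?case by (metis Ck.simps(2))
qed

lemma Ck_add: "Ck N g \<Longrightarrow> Ck N h \<Longrightarrow> Ck N (\<lambda>x. g x + h x)"
proof (induction N arbitrary: g h)
  case 0
  then show ?case by (auto intro: continuous_intros)
next
  case (Suc N)
  have "partial k (\<lambda>x. g x + h x) = (\<lambda>x. partial k g x + partial k h x)" for k
  proof
    fix x
    have "((\<lambda>x. g x + h x) has_derivative (\<lambda>v. grad g x \<bullet> v + grad h x \<bullet> v)) (at x)"
      using Suc.prems by (intro has_derivative_add has_derivative_grad) auto
    from partial_eqI[OF this] show "partial k (\<lambda>x. g x + h x) x = partial k g x + partial k h x"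
      by (simp add: inner_axis)
  qed
  then show ?case using Suc by auto
qed

lemma partial_mult:
  assumes "g differentiable at x" "h differentiable at x"
  shows "partial k (\<lambda>x. g x * h x) x = g x * partial k h x + partial k g x * h x"
proof -
  have "((\<lambda>x. g x * h x) has_derivative (\<lambda>v. g x * (grad h x \<bullet> v) + (grad g x \<bullet> v) * h x)) (at x)"
    using assms by (intro has_derivative_mult has_derivative_grad) auto
  from partial_eqI[OF this] show ?thesis by (simp add: inner_axis)
qed

lemma Ck_mult: "Ck N g \<Longrightarrow> Ck N h \<Longrightarrow> Ck N (\<lambda>x. g x * h x)"
proof (induction N arbitrary: g h)
  case 0
  then show ?case by (auto intro: continuous_intros)
next
  case (Suc N)
  have "partial k (\<lambda>x. g x * h x) = (\<lambda>x. g x * partial k h x + partial k g x * h x)" for k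
    using Suc.prems by (intro ext partial_mult) auto
  moreover have "Ck N (\<lambda>x. g x * partial k h x + partial k g x * h x)" for k
    using Suc.prems by (intro Ck_add Suc.IH) (auto intro: Ck_Suc_imp_Ck)
  ultimately show ?case using Suc.prems by auto
qed

lemma Ck_const: "Ck N (\<lambda>x::real^'n. c)"
proof (induction N arbitrary: c)
  case (Suc N)
  have "partial k (\<lambda>x::real^'n. c) = (\<lambda>x. 0)" for k
    by (rule ext) (simp add: partial_def)
  then have "Ck N (partial k (\<lambda>x::real^'n. c))" for k
    using Suc by simp
  then show ?case by auto
qed auto

text \<open>Coinductive, so that smoothness of a whole family closed under differentiation, such as
  \<open>flat_poly\<close> or \<open>rat_fun\<close>, follows in one step from the formula for the
  derivative.\<close>

coinductive smooth1 :: "(real \<Rightarrow> real) \<Rightarrow> bool" where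
  smooth1I: "(\<And>t. (h has_real_derivative h' t) (at t)) \<Longrightarrow> smooth1 h' \<Longrightarrow> smooth1 h"

lemma partial_compose:
  assumes "(h has_real_derivative h') (at (g x))" "g differentiable at x"
  shows "partial k (\<lambda>x. h (g x)) x = h' * partial k g x"
proof -
  have "((\<lambda>x. h (g x)) has_derivative (\<lambda>v. h' * (grad g x \<bullet> v))) (at x)"
    using diff_chain_at[OF has_derivative_grad[OF assms(2)], of h "\<lambda>v. h' * v"] assms(1)
    by (simp add: o_def has_field_derivative_def)
  from partial_eqI[OF this] show ?thesis by (simp add: inner_axis)
qed

lemma Ck_compose: "smooth1 h \<Longrightarrow> Ck N g \<Longrightarrow> Ck N (\<lambda>x. h (g x))"
proof (induction N arbitrary: g h)
  case 0
  from 0(1) obtain h' where "\<And>t. (h has_real_derivative h' t) (at t)"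
    by cases blast
  then have "continuous_on UNIV h"
    by (meson DERIV_isCont continuous_at_imp_continuous_on)
  with 0 show ?case
    by (metis Ck.simps(1) continuous_on_compose2 subset_UNIV)
next
  case (Suc N)
  from Suc.prems(1) obtain h' where h': "\<And>t. (h has_real_derivative h' t) (at t)" "smooth1 h'"
    by cases blast
  have d: "g differentiable at x" for x using Suc.prems by simp
  have "partial k (\<lambda>x. h (g x)) = (\<lambda>x. h' (g x) * partial k g x)" for k
    using h'(1) d by (intro ext partial_compose) auto
  moreover have "Ck N (\<lambda>x. h' (g x) * partial k g x)" for k
    using Suc.prems Suc.IH[OF h'(2) Ck_Suc_imp_Ck[OF Suc.prems(2)]] by (intro Ck_mult) auto
  moreover have "(\<lambda>x. h (g x)) differentiable at x" for x
    using differentiable_chain_at[OF d, of h x] h'(1)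
    by (auto simp: o_def real_differentiable_def)
  ultimately show ?case by auto
qed

lemma C_infty_mult: "g \<in> C_infty \<Longrightarrow> h \<in> C_infty \<Longrightarrow> (\<lambda>x. g x * h x) \<in> C_infty"
  and C_infty_add: "g \<in> C_infty \<Longrightarrow> h \<in> C_infty \<Longrightarrow> (\<lambda>x. g x + h x) \<in> C_infty"
  and C_infty_const: "(\<lambda>x. c) \<in> C_infty"
  and C_infty_compose: "smooth1 F \<Longrightarrow> g \<in> C_infty \<Longrightarrow> (\<lambda>x. F (g x)) \<in> C_infty"
  by (auto simp: C_infty_def Ck_mult Ck_add Ck_const Ck_compose)

lemma C_infty_iff: "g \<in> C_infty \<longleftrightarrow> (\<forall>x. g differentiable at x) \<and> (\<forall>k. partial k g \<in> C_infty)"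
  unfolding C_infty_def by (auto simp: Ck_Suc_imp_Ck) (metis Ck.simps(2))+

text \<open>The counterpart in several variables of coinduction for \<open>smooth1\<close>. It is
  applied to all convolutions of a fixed function, where each partial derivative is a convolution
  with another kernel.\<close>

lemma C_infty_coinduct:
  assumes "g \<in> S"
    and "\<And>h x. h \<in> S \<Longrightarrow> h differentiable at x"
    and "\<And>h k. h \<in> S \<Longrightarrow> partial k h \<in> S"
  shows "g \<in> C_infty"
proof -
  have "Ck N h" if "h \<in> S" for N h
    using that
  proof (induction N arbitrary: h)
    case 0
    then show ?case
      using assms(2)
      by (auto intro!: differentiable_imp_continuous_on simp: differentiable_on_def
          intro: differentiable_at_withinI)
  qed (use assms in auto)
  then show ?thesis using assms(1) by (auto simp: C_infty_def)
qed

lemma C_infty_differentiable: "g \<in> C_infty \<Longrightarrow> g differentiable at x"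
  and C_infty_partial: "g \<in> C_infty \<Longrightarrow> partial k g \<in> C_infty"
  using C_infty_iff by blast+

lemma C_infty_continuous_on: "g \<in> C_infty \<Longrightarrow> continuous_on A g"
  by (rule continuous_on_subset[OF _ subset_UNIV]) (metis (mono_tags) C_infty_def Ck.simps(1) mem_Collect_eq)

lemma continuous_on_grad: "g \<in> C_infty \<Longrightarrow> continuous_on A (grad g)"
  unfolding grad_def by (intro continuous_on_vec_lambda C_infty_continuous_on C_infty_partial)

lemma C_infty_nth: "(\<lambda>x::real^'n. x $ i) \<in> C_infty"
proof -
  have "(\<lambda>x::real^'n. x $ i) differentiable at x" for x
    by (intro bounded_linear_imp_differentiable bounded_linear_vec_nth)
  moreover have "partial k (\<lambda>x::real^'n. x $ i) = (\<lambda>x. axis k 1 $ i)" for k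
  proof
    fix x
    show "partial k (\<lambda>x::real^'n. x $ i) x = axis k 1 $ i"
      by (rule partial_eqI) (intro bounded_linear_imp_has_derivative bounded_linear_vec_nth)
  qed
  ultimately show ?thesis
    by (subst C_infty_iff) (simp add: C_infty_const)
qed

lemma C_infty_sum: "finite I \<Longrightarrow> (\<And>i. i \<in> I \<Longrightarrow> G i \<in> C_infty) \<Longrightarrow> (\<lambda>x. \<Sum>i\<in>I. G i x) \<in> C_infty"
  by (induction I rule: finite_induct) (auto simp: C_infty_const intro: C_infty_add)

lemma C_infty_inner_self: "(\<lambda>x::real^'n. x \<bullet> x) \<in> C_infty"
  unfolding inner_vec_def by (auto intro!: C_infty_sum C_infty_mult C_infty_nth)

subsection \<open>A flat function\<close>

text \<open>The derivatives of exp(- 1 / t) are polynomials in 1 / t times the same exponential;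
  carrying the polynomial along makes the family closed under differentiation.\<close>

definition flat_poly :: "real poly \<Rightarrow> real \<Rightarrow> real" where
  "flat_poly P t = (if t > 0 then poly P (1 / t) * exp (- 1 / t) else 0)"

abbreviation flat :: "real \<Rightarrow> real" where
  "flat \<equiv> flat_poly 1"

lemma flat_poly_tendsto_0: "(flat_poly P \<longlongrightarrow> 0) (at_right 0)"
proof -
  have "((\<lambda>y. \<Sum>i\<le>degree P. coeff P i * (y ^ i / exp y)) \<longlongrightarrow> (\<Sum>i\<le>degree P. coeff P i * 0)) at_top"
    by (intro tendsto_sum tendsto_mult_left tendsto_power_div_exp_0)
  then have "((\<lambda>y. poly P y * exp (- y)) \<longlongrightarrow> 0) at_top"
    by (simp add: poly_altdef sum_distrib_right exp_minus divide_inverse mult.assoc)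
  then have "((\<lambda>t. poly P (1 / t) * exp (- (1 / t))) \<longlongrightarrow> 0) (at_right 0)"
    using filterlim_compose[OF _ filterlim_inverse_at_top_right] by (auto simp: inverse_eq_divide)
  then show ?thesis
    by (rule Lim_transform_eventually)
      (auto simp: flat_poly_def eventually_at_filter)
qed

text \<open>With y = 1 / t one has d/dt = - y^2 d/dy, which sends P(y) exp(- y) to y^2 (P - P')(y)
  exp(- y); the factor \<open>[:0, 0, 1:]\<close> is y^2.\<close>

lemma flat_poly_deriv:
  "(flat_poly P has_real_derivative flat_poly ((P - pderiv P) * [:0, 0, 1:]) t) (at t)"
proof -
  consider "t > 0" | "t < 0" | "t = 0" by linarith
  then show ?thesis
  proof cases
    case 1
    have "((\<lambda>t. poly P (1 / t) * exp (- 1 / t)) has_real_derivative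
        flat_poly ((P - pderiv P) * [:0, 0, 1:]) t) (at t)"
    proof -
      have i: "((\<lambda>t. 1 / t) has_real_derivative - (1 / t\<^sup>2)) (at t)"
        using 1 by (auto intro!: derivative_eq_intros simp: power2_eq_square)
      have "((\<lambda>t. poly P (1 / t) * exp (- (1 / t))) has_real_derivative
          poly P (1 / t) * (exp (- (1 / t)) * - (- (1 / t\<^sup>2))) + poly (pderiv P) (1 / t) * - (1 / t\<^sup>2) * exp (- (1 / t))) (at t)"
        by (intro DERIV_mult' DERIV_chain2[OF poly_DERIV i] DERIV_chain2[OF DERIV_exp] DERIV_minus i)
      moreover have "poly P (1 / t) * (exp (- (1 / t)) * - (- (1 / t\<^sup>2))) + poly (pderiv P) (1 / t) * - (1 / t\<^sup>2) * exp (- (1 / t))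
          = flat_poly ((P - pderiv P) * [:0, 0, 1:]) t"
        using 1 by (simp add: flat_poly_def power2_eq_square algebra_simps)
      ultimately show ?thesis by simp
    qed
    then show ?thesis
      by (rule has_field_derivative_transform_within_open[where S = "{0<..}"])
        (use 1 in \<open>auto simp: flat_poly_def\<close>)
  next
    case 2
    have "((\<lambda>t. 0) has_real_derivative flat_poly ((P - pderiv P) * [:0, 0, 1:]) t) (at t)"
      using 2 by (auto simp: flat_poly_def)
    then show ?thesis
      by (rule has_field_derivative_transform_within_open[where S = "{..<0}"])
        (use 2 in \<open>auto simp: flat_poly_def\<close>)
  next
    case 3
    have "((\<lambda>h. flat_poly P h / h) \<longlongrightarrow> 0) (at 0)"
    proof (rule filterlim_split_at)
      show "((\<lambda>h. flat_poly P h / h) \<longlongrightarrow> 0) (at_left 0)"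
        by (rule Lim_transform_eventually[OF tendsto_const])
          (auto simp: flat_poly_def eventually_at_filter)
      show "((\<lambda>h. flat_poly P h / h) \<longlongrightarrow> 0) (at_right 0)"
        \<comment> \<open>Division by h multiplies the polynomial in 1 / h by its variable, so the
          right difference quotient is itself a \<open>flat_poly\<close>.\<close>
        by (rule Lim_transform_eventually[OF flat_poly_tendsto_0[of "pCons 0 P"]])
          (auto simp: flat_poly_def eventually_at_filter)
    qed
    then show ?thesis
      using 3 by (simp add: DERIV_def flat_poly_def)
  qed
qed

lemma smooth1_flat_poly: "smooth1 (flat_poly P)"
proof (coinduction arbitrary: P)
  case smooth1
  show ?case using flat_poly_deriv by blast
qed

lemma flat_nonneg: "0 \<le> flat t"
  by (auto simp: flat_poly_def)

lemma flat_pos_iff: "0 < flat t \<longleftrightarrow> 0 < t"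
  by (auto simp: flat_poly_def)

subsection \<open>Convolution\<close>

text \<open>All derivatives fall on the kernel, so continuity of \<open>S\<close> is enough;
  integrating over a fixed compact box makes the Leibniz rule applicable without any decay.\<close>

lemma leibniz_convolution:
  fixes S \<rho> :: "real^'n \<Rightarrow> real" and a c :: "real^'n"
  assumes S: "continuous_on UNIV S" and \<rho>: "\<rho> \<in> C_infty"
  defines "V \<equiv> \<lambda>\<rho> x. integral (cbox a c) (\<lambda>y. S y * \<rho> (x - y))"
  shows "V \<rho> differentiable at x" "partial k (V \<rho>) x = V (partial k \<rho>) x"
proof -
  have cont: "continuous_on A (\<lambda>y. S y * \<sigma> (x - y))" if "\<sigma> \<in> C_infty" for A x \<sigma>
    by (intro continuous_intros continuous_on_subset[OF S]
        continuous_on_compose2[OF C_infty_continuous_on[OF that, of UNIV]]) auto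
  let ?f = "\<lambda>x y. blinfun_inner_right (S y *\<^sub>R grad \<rho> (x - y))"
  have der: "(V \<rho> has_derivative blinfun_apply (integral (cbox a c) (?f x))) (at x within UNIV)"
    unfolding V_def
  proof (rule leibniz_rule)
    show "((\<lambda>x. S y * \<rho> (x - y)) has_derivative blinfun_apply (?f x y)) (at x)" for x y
    proof -
      have "((\<lambda>x. \<rho> (x - y)) has_derivative (\<lambda>h. grad \<rho> (x - y) \<bullet> h)) (at x)"
      proof (rule has_derivative_compose[of "\<lambda>x. x - y" "\<lambda>h. h" x UNIV \<rho> "\<lambda>h. grad \<rho> (x - y) \<bullet> h"])
        show "((\<lambda>x. x - y) has_derivative (\<lambda>h. h)) (at x)"
          by (auto intro!: derivative_eq_intros)
        show "(\<rho> has_derivative (\<lambda>h. grad \<rho> (x - y) \<bullet> h)) (at (x - y))"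
          by (intro has_derivative_grad C_infty_differentiable \<rho>)
      qed
      then show ?thesis
        by (auto intro!: derivative_eq_intros simp: inner_scaleR_left)
    qed
    show "(\<lambda>y. S y * \<rho> (x - y)) integrable_on cbox a c" for x
      by (intro integrable_continuous cont \<rho>)
    show "continuous_on (UNIV \<times> cbox a c) (\<lambda>(x, y). ?f x y)"
      unfolding split_beta
      by (intro bounded_linear.continuous_on[OF bounded_linear_blinfun_inner_right] continuous_intros
          continuous_on_compose2[OF S] continuous_on_compose2[OF continuous_on_grad[OF \<rho>, of UNIV]]) auto
  qed auto
  then show "V \<rho> differentiable at x" unfolding differentiable_def by auto
  have int: "?f x integrable_on cbox a c"
    by (intro integrable_continuous bounded_linear.continuous_on[OF bounded_linear_blinfun_inner_right]
        continuous_intros continuous_on_subset[OF S]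
        continuous_on_compose2[OF continuous_on_grad[OF \<rho>, of UNIV]]) auto
  have "partial k (V \<rho>) x = blinfun_apply (integral (cbox a c) (?f x)) (axis k 1)"
    using partial_eqI[OF der[simplified]] by simp
  also have "\<dots> = integral (cbox a c) (\<lambda>y. blinfun_apply (?f x y) (axis k 1))"
    using integral_linear[OF int, of "\<lambda>f. blinfun_apply f (axis k 1)"]
    by (simp add: o_def bounded_linear_intros)
  also have "\<dots> = V (partial k \<rho>) x"
    by (simp add: V_def inner_scaleR_left inner_axis)
  finally show "partial k (V \<rho>) x = V (partial k \<rho>) x" .
qed

lemma C_infty_convolution:
  assumes S: "continuous_on UNIV S" and \<rho>: "\<rho> \<in> C_infty"
  shows "(\<lambda>x. integral (cbox a c) (\<lambda>y. S y * \<rho> (x - y))) \<in> C_infty"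
proof (rule C_infty_coinduct)
  let ?V = "\<lambda>\<rho> x. integral (cbox a c) (\<lambda>y. S y * \<rho> (x - y))"
  show "?V \<rho> \<in> ?V ` C_infty" using \<rho> by blast
  show "h differentiable at x" if "h \<in> ?V ` C_infty" for h x
    using that leibniz_convolution(1)[OF S] by blast
  show "partial k h \<in> ?V ` C_infty" if h: "h \<in> ?V ` C_infty" for h k
  proof -
    obtain \<sigma> where \<sigma>: "\<sigma> \<in> C_infty" "h = ?V \<sigma>" using h by blast
    then have "partial k h = ?V (partial k \<sigma>)"
      using leibniz_convolution(2)[OF S \<sigma>(1)] by blast
    then show ?thesis using C_infty_partial[OF \<sigma>(1)] by blast
  qed
qed

text \<open>\<open>flat\<close> applied to \<eta>^2 - |z|^2 is smooth, even, and positive exactly on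
  the open ball of radius \<eta>. That ball is not negligible, so the integral is positive and can
  be normalised.\<close>

lemma mollifier_exists:
  assumes "\<eta> > 0"
  obtains \<rho> :: "real^'n \<Rightarrow> real" where "\<rho> \<in> C_infty" "\<And>z. 0 \<le> \<rho> z" "\<And>z. \<rho> (- z) = \<rho> z"
    "\<And>z. \<eta> \<le> norm z \<Longrightarrow> \<rho> z = 0" "integrable lborel \<rho>" "(LINT z|lborel. \<rho> z) = 1"
proof -
  define \<rho> :: "real^'n \<Rightarrow> real" where "\<rho> z = flat (\<eta>\<^sup>2 + (- 1) * (z \<bullet> z))" for z
  have sm: "\<rho> \<in> C_infty"
    unfolding \<rho>_def
    by (intro C_infty_compose[OF smooth1_flat_poly] C_infty_add C_infty_mult C_infty_const C_infty_inner_self)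
  have supp: "\<rho> z \<noteq> 0 \<longleftrightarrow> norm z < \<eta>" for z
  proof -
    have "\<rho> z \<noteq> 0 \<longleftrightarrow> 0 < flat (\<eta>\<^sup>2 + (- 1) * (z \<bullet> z))"
      using flat_nonneg[of "\<eta>\<^sup>2 + (- 1) * (z \<bullet> z)"] by (auto simp: \<rho>_def less_le)
    also have "\<dots> \<longleftrightarrow> (norm z)\<^sup>2 < \<eta>\<^sup>2"
      by (simp add: flat_pos_iff power2_norm_eq_inner)
    also have "\<dots> \<longleftrightarrow> norm z < \<eta>"
      using assms by (meson norm_ge_zero less_eq_real_def pos2 power_less_imp_less_base power_strict_mono)
    finally show ?thesis .
  qed
  have int: "integrable lborel \<rho>"
  proof -
    have "set_integrable lborel (cball 0 \<eta>) \<rho>"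
      unfolding set_integrable_def by (intro borel_integrable_compact C_infty_continuous_on sm) auto
    moreover have "(\<lambda>x. indicator (cball 0 \<eta>) x *\<^sub>R \<rho> x) = \<rho>"
      using supp by (force simp: indicator_def fun_eq_iff)
    ultimately show ?thesis by (simp add: set_integrable_def)
  qed
  have nn: "0 \<le> \<rho> z" for z by (simp add: \<rho>_def flat_nonneg)
  have pos: "0 < (LINT z|lborel. \<rho> z)"
  proof (rule ccontr)
    assume "\<not> 0 < (LINT z|lborel. \<rho> z)"
    then have "(LINT z|lborel. \<rho> z) = 0"
      using Bochner_Integration.integral_nonneg[of lborel \<rho>] nn by (simp add: order_antisym)
    then have "AE z in lborel. \<rho> z = 0"
      using integral_nonneg_eq_0_iff_AE[OF int] nn by simp
    then have "AE z in lborel. z \<notin> ball (0::real^'n) \<eta>"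
    proof eventually_elim
      case (elim z)
      then show ?case using supp[of z] by (auto simp: dist_norm)
    qed
    then have "ball (0::real^'n) \<eta> \<in> null_sets lborel"
      by (subst (asm) AE_iff_null_sets[symmetric]) auto
    then have "negligible (ball (0::real^'n) \<eta>)"
      by (simp add: negligible_iff_null_sets null_sets_completionI)
    then show False using assms open_not_negligible[of "ball (0::real^'n) \<eta>"] by auto
  qed
  define \<rho>' where "\<rho>' = (\<lambda>z. inverse (LINT z|lborel. \<rho> z) * \<rho> z)"
  show ?thesis
  proof (rule that[of \<rho>'])
    show "\<rho>' \<in> C_infty"
      unfolding \<rho>'_def by (intro C_infty_mult C_infty_const sm)
    show "\<rho>' z = 0" if "\<eta> \<le> norm z" for z
      using supp[of z] that by (simp add: \<rho>'_def)
    show "\<rho>' (- z) = \<rho>' z" for z by (simp add: \<rho>'_def \<rho>_def)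
    show "0 \<le> \<rho>' z" for z using pos nn by (simp add: \<rho>'_def)
    show "integrable lborel \<rho>'" "(LINT z|lborel. \<rho>' z) = 1"
      using int pos by (simp_all add: \<rho>'_def)
  qed
qed

section \<open>Lipschitz functions are differentiable almost everywhere\<close>

text \<open>Lebesgue measure is characterised by its values on open boxes. Continuity leaves no mass
  on end points, so both interval measures give the increments there, and these add up to the
  length.\<close>

lemma interval_measure_add:
  fixes F G :: "real \<Rightarrow> real"
  assumes mono: "mono F" "mono G" and cont: "continuous_on UNIV F" "continuous_on UNIV G"
    and sum: "\<And>x. F x + G x = x"
    and A: "A \<in> sets borel"
  shows "emeasure lborel A = emeasure (interval_measure F) A + emeasure (interval_measure G) A"
proof -
  let ?\<mu> = "\<lambda>A. emeasure (interval_measure F) A + emeasure (interval_measure G) A"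
  define M where "M = measure_of UNIV (sets borel) ?\<mu>"
  have sets_M: "sets M = sets borel"
    using sets.sets_measure_of_eq[of "borel :: real measure"] by (simp add: M_def)
  have em: "emeasure M A = ?\<mu> A" if "A \<in> sets borel" for A
    unfolding M_def
  proof (rule emeasure_measure_of_sigma)
    show "sigma_algebra UNIV (sets borel :: real set set)"
      using sets.sigma_algebra_axioms[of "borel :: real measure"] by simp
    show "positive (sets borel) ?\<mu>" by (simp add: positive_def)
    show "countably_additive (sets borel) ?\<mu>"
    proof (rule countably_additiveI)
      fix B :: "nat \<Rightarrow> real set"
      assume B: "range B \<subseteq> sets borel" "disjoint_family B"
      have "(\<Sum>i. ?\<mu> (B i)) = (\<Sum>i. emeasure (interval_measure F) (B i)) + (\<Sum>i. emeasure (interval_measure G) (B i))"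
        by (intro suminf_add[symmetric]) auto
      then show "(\<Sum>i. ?\<mu> (B i)) = ?\<mu> (\<Union> (range B))"
        using B by (simp add: suminf_emeasure)
    qed
  qed (fact that)
  have box: "emeasure (interval_measure H) {l<..<u} = ennreal (H u - H l)"
    if "mono H" "continuous_on UNIV H" "l \<le> u" for H :: "real \<Rightarrow> real" and l u
  proof -
    have ioc: "emeasure (interval_measure H) {c<..d} = ennreal (H d - H c)" if "c \<le> d" for c d
      using \<open>mono H\<close> \<open>continuous_on UNIV H\<close> that
      by (intro emeasure_interval_measure_Ioc)
        (auto simp: mono_def continuous_on_eq_continuous_within intro: continuous_within_subset)
    have icc: "emeasure (interval_measure H) {c..d} = ennreal (H d - H c)" if "c \<le> d" for c d
      using \<open>mono H\<close> \<open>continuous_on UNIV H\<close> that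
      by (intro emeasure_interval_measure_Icc) (auto simp: mono_def)
    have pt: "emeasure (interval_measure H) {u} = 0" using icc[of u u] by simp
    have "emeasure (interval_measure H) {l<..u} = emeasure (interval_measure H) {l<..<u}" if "l < u"
    proof -
      have "{l<..u} = {l<..<u} \<union> {u}" using that by auto
      show ?thesis
        unfolding \<open>{l<..u} = {l<..<u} \<union> {u}\<close>
        by (rule emeasure_Un_null_set) (use pt in \<open>auto simp: null_sets_def\<close>)
    qed
    then show ?thesis using ioc[OF that(3)] that(3) by (cases "l = u") auto
  qed
  have "lborel = M"
  proof (rule lborel_eqI)
    fix l u :: real
    assume "\<And>b. b \<in> Basis \<Longrightarrow> l \<bullet> b \<le> u \<bullet> b"
    then have "l \<le> u" by simp
    have "ennreal (F u - F l) + ennreal (G u - G l) = ennreal (F u - F l + (G u - G l))"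
      using mono \<open>l \<le> u\<close> by (intro ennreal_plus[symmetric]) (auto simp: mono_def)
    also have "F u - F l + (G u - G l) = u - l"
      using sum[of u] sum[of l] by linarith
    finally show "emeasure M (box l u) = ennreal (\<Prod>b\<in>Basis. (u - l) \<bullet> b)"
      using \<open>l \<le> u\<close> box mono cont by (simp add: em box_real)
  qed (fact sets_M)
  then show ?thesis using em[OF A] by simp
qed

text \<open>For \<open>c > L\<close> the functions \<open>x / 2 + f x / (2 c)\<close> and \<open>x / 2 - f x / (2 c)\<close> are increasing and add
  up to the identity, so the interval measure of the first one is dominated by Lebesgue measure
  and has a Radon-Nikodym density.\<close>

lemma lipschitz_indefinite_integral:
  fixes f :: "real \<Rightarrow> real"
  assumes "L-lipschitz_on UNIV f"
  obtains g where "\<And>a b. a \<le> b \<Longrightarrow> (g has_integral f b - f a) {a..b}"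
proof -
  \<comment> \<open>Adding 1 keeps the divisor \<open>2 * c\<close> positive when
    \<open>L = 0\<close>.\<close>
  define c where "c = L + 1"
  have L: "0 \<le> L" using assms by (rule lipschitz_on_nonneg)
  have c: "0 < c" "L < c" using L by (auto simp: c_def)
  define F where "F x = x / 2 + f x / (2 * c)" for x
  define G where "G x = x / 2 - f x / (2 * c)" for x
  have lip: "\<bar>f y - f x\<bar> \<le> c * (y - x)" if "x \<le> y" for x y
    using lipschitz_onD[OF assms, of y x] that c mult_right_mono[of L c "y - x"]
    by (auto simp: dist_real_def)
  have mono: "mono F" "mono G"
  proof -
    show "mono F"
    proof (rule monoI)
      fix x y :: real assume "x \<le> y"
      have "\<bar>f y - f x\<bar> / (2 * c) \<le> (y - x) / 2"
        using lip[OF \<open>x \<le> y\<close>] c by (simp add: field_simps)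
      then have "\<bar>(f y - f x) / (2 * c)\<bar> \<le> (y - x) / 2" using c by (simp add: abs_divide)
      then show "F x \<le> F y" unfolding F_def diff_divide_distrib by linarith
    qed
    show "mono G"
    proof (rule monoI)
      fix x y :: real assume "x \<le> y"
      have "\<bar>f y - f x\<bar> / (2 * c) \<le> (y - x) / 2"
        using lip[OF \<open>x \<le> y\<close>] c by (simp add: field_simps)
      then have "\<bar>(f y - f x) / (2 * c)\<bar> \<le> (y - x) / 2" using c by (simp add: abs_divide)
      then show "G x \<le> G y" unfolding G_def diff_divide_distrib by linarith
    qed
  qed
  have "continuous_on UNIV f" using assms by (rule lipschitz_on_continuous_on)
  then have cont: "continuous_on UNIV F" "continuous_on UNIV G"
    unfolding F_def G_def using c by (auto intro!: continuous_intros)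
  define M where "M = interval_measure F"
  have le: "emeasure M A \<le> emeasure lborel A" if "A \<in> sets borel" for A
    using interval_measure_add[OF mono cont _ that] by (simp add: F_def G_def M_def)
  have "absolutely_continuous lborel M"
    unfolding absolutely_continuous_def
    using le by (force simp: null_sets_def M_def)
  then obtain h where h: "h \<in> borel_measurable lborel" "density lborel h = M"
    using sigma_finite_measure.Radon_Nikodym[OF sigma_finite_lborel, of M] by (auto simp: M_def)
  have Icc: "(\<integral>\<^sup>+x. h x * indicator {a..b} x \<partial>lborel) = ennreal (F b - F a)" if "a \<le> b" for a b
  proof -
    have "(\<integral>\<^sup>+x. h x * indicator {a..b} x \<partial>lborel) = emeasure M {a..b}"
      using emeasure_density[OF h(1), of "{a..b}"] by (simp add: h(2))
    also have "\<dots> = ennreal (F b - F a)"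
      unfolding M_def using mono(1) cont(1) that
      by (intro emeasure_interval_measure_Icc) (auto simp: mono_def)
    finally show ?thesis .
  qed
  \<comment> \<open>The density takes extended values. Its integrals over the intervals
    \<open>{- real n..real n}\<close> are finite, hence it is finite almost everywhere and can be
    read as a real function.\<close>
  have hfin: "AE x in lborel. h x \<noteq> \<infinity>"
  proof -
    have "AE x in lborel. h x * indicator {- real n..real n} x \<noteq> \<infinity>" for n
      using h Icc[of "- real n" "real n"] by (intro nn_integral_PInf_AE) auto
    then have "AE x in lborel. \<forall>n. h x * indicator {- real n..real n} x \<noteq> \<infinity>"
      by (simp add: AE_all_countable)
    then show ?thesis
    proof eventually_elim
      case (elim x)
      obtain n where "\<bar>x\<bar> \<le> real n" using real_arch_simple by blast
      then have "x \<in> {- real n..real n}" by auto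
      then show ?case using elim[rule_format, of n] by simp
    qed
  qed
  \<comment> \<open>This is the definition of \<open>F\<close> solved for \<open>f\<close>: f = 2 c
    (F - x / 2).\<close>
  have "((\<lambda>x. 2 * c * (enn2real (h x) - 1 / 2)) has_integral f b - f a) {a..b}" if "a \<le> b" for a b
  proof -
    have "(\<integral>\<^sup>+x. ennreal (enn2real (h x) * indicator {a..b} x) \<partial>lborel)
        = (\<integral>\<^sup>+x. h x * indicator {a..b} x \<partial>lborel)"
      by (rule nn_integral_cong_AE, use hfin in eventually_elim)
        (auto simp: indicator_def less_top)
    then have "has_bochner_integral lborel (\<lambda>x. enn2real (h x) * indicator {a..b} x) (F b - F a)"
      using h Icc[OF that] mono that
      by (intro has_bochner_integral_nn_integral) (auto simp: mono_def)
    then have bi: "integrable lborel (\<lambda>x. enn2real (h x) * indicator {a..b} x)"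
      "(LINT x|lborel. enn2real (h x) * indicator {a..b} x) = F b - F a"
      by (simp_all add: has_bochner_integral_iff)
    have eq: "(\<lambda>x. enn2real (h x) * indicator {a..b} x) = (\<lambda>x. if x \<in> {a..b} then enn2real (h x) else 0)"
      by (auto simp: indicator_def)
    have "((\<lambda>x. if x \<in> {a..b} then enn2real (h x) else 0) has_integral F b - F a) UNIV"
      using has_integral_integral_lborel[OF bi(1)] unfolding bi(2) unfolding eq .
    then have "((\<lambda>x. enn2real (h x)) has_integral F b - F a) {a..b}"
      unfolding has_integral_restrict_UNIV .
    then have "((\<lambda>x. 2 * c * (enn2real (h x) - 1 / 2)) has_integral
        2 * c * ((F b - F a) - (b - a) *\<^sub>R (1 / 2))) {a..b}"
      using that has_integral_const_real[of "1/2::real" a b]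
      by (intro has_integral_mult_right has_integral_diff) auto
    moreover have "2 * c * ((F b - F a) - (b - a) *\<^sub>R (1 / 2)) = f b - f a"
    proof -
      have "F b - F a = (b - a) / 2 + (f b - f a) / (2 * c)"
        by (simp add: F_def diff_divide_distrib)
      then have "(F b - F a) - (b - a) *\<^sub>R (1 / 2) = (f b - f a) / (2 * c)" by simp
      then show ?thesis using c by simp
    qed
    ultimately show ?thesis by simp
  qed
  then show ?thesis using that by blast
qed

text \<open>A Lipschitz function is an indefinite integral, so Lebesgue's differentiation theorem
  applies. The form used here averages only over intervals to the right of a point; left quotients
  come from the reflected density, at the price of a second, reflected null set.\<close>

lemma lipschitz_AE_differentiable:
  fixes f :: "real \<Rightarrow> real"
  assumes "L-lipschitz_on UNIV f"
  shows "negligible {x. \<not> f differentiable (at x)}"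
proof -
  obtain g where g: "\<And>a b. a \<le> b \<Longrightarrow> (g has_integral f b - f a) {a..b}"
    using lipschitz_indefinite_integral[OF assms] by blast
  have gi: "g integrable_on cbox a b" for a b
    using g[of a b] by (cases "a \<le> b") (auto simp: integrable_on_def)
  obtain N1 where N1: "negligible N1"
    "\<And>x e. x \<notin> N1 \<Longrightarrow> 0 < e \<Longrightarrow> \<exists>d>0. \<forall>h. 0 < h \<and> h < d \<longrightarrow>
       norm (integral (cbox x (x + h *\<^sub>R One)) g /\<^sub>R h ^ DIM(real) - g x) < e"
    using integrable_ccontinuous_explicit[OF gi] by blast
  have gi': "(\<lambda>y. g (- y)) integrable_on cbox a b" for a b
    using Henstock_Kurzweil_Integration.integrable_reflect_real[where a="-b" and b="-a" and f=g] gi[of "-b" "-a"] by (simp add: box_real)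
  obtain N2 where N2: "negligible N2"
    "\<And>x e. x \<notin> N2 \<Longrightarrow> 0 < e \<Longrightarrow> \<exists>d>0. \<forall>h. 0 < h \<and> h < d \<longrightarrow>
       norm (integral (cbox x (x + h *\<^sub>R One)) (\<lambda>y. g (- y)) /\<^sub>R h ^ DIM(real) - g (- x)) < e"
    using integrable_ccontinuous_explicit[OF gi'] by blast
  have "negligible (uminus ` N2)"
    using N2(1) by (intro negligible_differentiable_image_negligible) (auto intro: derivative_intros)
  moreover have "f differentiable (at x)" if x: "x \<notin> N1" "- x \<notin> N2" for x
  proof -
    have "((\<lambda>h. (f (x + h) - f x) / h) \<longlongrightarrow> g x) (at 0)"
    proof (rule LIM_I)
      fix e :: real assume "0 < e"
      obtain d1 where d1: "d1 > 0" "\<And>h. 0 < h \<Longrightarrow> h < d1 \<Longrightarrow> norm (integral (cbox x (x + h)) g / h - g x) < e"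
        using N1(2)[OF x(1) \<open>0 < e\<close>] by (auto simp: divide_inverse_commute)
      obtain d2 where d2: "d2 > 0" "\<And>h. 0 < h \<Longrightarrow> h < d2 \<Longrightarrow>
          norm (integral (cbox (- x) (- x + h)) (\<lambda>y. g (- y)) / h - g x) < e"
        using N2(2)[OF x(2) \<open>0 < e\<close>] by (auto simp: divide_inverse_commute)
      have "norm ((f (x + h) - f x) / h - g x) < e" if "h \<noteq> 0" "norm (h - 0) < min d1 d2" for h
      proof (cases "h > 0")
        case True
        then have "integral (cbox x (x + h)) g = f (x + h) - f x"
          using g[of x "x + h"] by (simp add: box_real integral_unique)
        then show ?thesis using d1(2)[of h] True that by simp
      next
        case False
        with that have h: "h < 0" by simp
        have "integral (cbox (- x) (- x + - h)) (\<lambda>y. g (- y)) = integral {x + h..x} g"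
          using Henstock_Kurzweil_Integration.integral_reflect_real[where a="x + h" and b=x and f=g] by (simp add: box_real)
        also have "\<dots> = f x - f (x + h)"
          using g[of "x + h" x] h by (simp add: integral_unique)
        finally have I: "integral (cbox (- x) (- x + - h)) (\<lambda>y. g (- y)) = f x - f (x + h)" .
        have "integral (cbox (- x) (- x + - h)) (\<lambda>y. g (- y)) / - h = (f (x + h) - f x) / h"
          unfolding I using h by (simp add: field_simps)
        then show ?thesis using d2(2)[of "- h"] h that by simp
      qed
      then show "\<exists>s>0. \<forall>h. h \<noteq> 0 \<and> norm (h - 0) < s \<longrightarrow> norm ((f (x + h) - f x) / h - g x) < e"
        using d1(1) d2(1) by (intro exI[of _ "min d1 d2"]) auto
    qed
    then have "(f has_real_derivative g x) (at x)" by (simp add: DERIV_def)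
    then show ?thesis by (auto simp: real_differentiable_def)
  qed
  then have "{x. \<not> f differentiable (at x)} \<subseteq> N1 \<union> uminus ` N2"
    by (metis (mono_tags, lifting) Un_iff add.inverse_inverse image_eqI mem_Collect_eq subsetI)
  ultimately show ?thesis
    using N1(1) by (meson negligible_Un negligible_subset)
qed

text \<open>Existence of the derivative restated with countable quantifiers, so that the exceptional
  set in \<open>lipschitz_AE_directional\<close> is seen to be Borel. Cauchy's criterion removes the
  unknown limit, and continuity lets rational increments stand for all.\<close>

lemma differentiable_iff_rational_Cauchy:
  fixes f :: "real \<Rightarrow> real"
  assumes cont: "continuous_on UNIV f"
  shows "f differentiable (at 0) \<longleftrightarrow> (\<forall>m::nat. \<exists>n::nat. \<forall>s t::rat.
     0 < \<bar>real_of_rat s\<bar> \<and> \<bar>real_of_rat s\<bar> < 1 / Suc n \<and> 0 < \<bar>real_of_rat t\<bar> \<and> \<bar>real_of_rat t\<bar> < 1 / Suc n \<longrightarrow>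
     \<bar>(f (real_of_rat s) - f 0) / real_of_rat s - (f (real_of_rat t) - f 0) / real_of_rat t\<bar> \<le> 1 / Suc m)"
    (is "_ \<longleftrightarrow> (\<forall>m. \<exists>n. ?C m n)")
proof
  define q where "q h = (f h - f 0) / h" for h
  show "\<forall>m. \<exists>n. ?C m n" if diff: "f differentiable (at 0)"
  proof
    fix m :: nat
    obtain D where "(f has_real_derivative D) (at 0)"
      using diff by (auto simp: real_differentiable_def)
    then have "(q \<longlongrightarrow> D) (at 0)" by (simp add: DERIV_def q_def[abs_def])
    moreover define e where "e = 1 / real (Suc m)"
    ultimately have "(q \<longlongrightarrow> D) (at 0)" "0 < e / 2" by auto
    from LIM_D[OF this]
    obtain d where d: "d > 0" "\<And>h. h \<noteq> 0 \<Longrightarrow> \<bar>h\<bar> < d \<Longrightarrow> \<bar>q h - D\<bar> < e / 2"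
      by auto
    obtain n where n: "1 / Suc n < d" using nat_approx_posE[OF d(1)] by auto
    have "?C m n"
    proof (intro allI impI, elim conjE)
      fix s t :: rat
      let ?s = "real_of_rat s" and ?t = "real_of_rat t"
      assume "0 < \<bar>?s\<bar>" "\<bar>?s\<bar> < 1 / Suc n" "0 < \<bar>?t\<bar>" "\<bar>?t\<bar> < 1 / Suc n"
      then have "\<bar>q ?s - D\<bar> < e / 2" "\<bar>q ?t - D\<bar> < e / 2"
        using n by (intro d(2); force)+
      then have "\<bar>q ?s - q ?t\<bar> \<le> e" by linarith
      then show "\<bar>(f ?s - f 0) / ?s - (f ?t - f 0) / ?t\<bar> \<le> 1 / Suc m" by (simp add: q_def e_def)
    qed
    then show "\<exists>n. ?C m n" by blast
  qed
  show "f differentiable (at 0)" if C: "\<forall>m. \<exists>n. ?C m n"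
  proof -
    have cq: "isCont q h" if "h \<noteq> 0" for h
      unfolding q_def using that cont
      by (intro continuous_intros) (auto simp: continuous_on_eq_continuous_within)
    have cauchy: "\<exists>d>0. \<forall>s t. 0 < \<bar>s\<bar> \<and> \<bar>s\<bar> < d \<and> 0 < \<bar>t\<bar> \<and> \<bar>t\<bar> < d \<longrightarrow> \<bar>q s - q t\<bar> \<le> e"
      if e: "e > 0" for e
    proof -
      obtain m where m: "1 / Suc m < e" using nat_approx_posE[OF e] by auto
      obtain n where n: "?C m n" using C by blast
      let ?d = "1 / real (Suc n)"
      have dense: "\<exists>r. (\<lambda>i. real_of_rat (r i)) \<longlonglongrightarrow> h \<and> (\<forall>\<^sub>F i in sequentially. 0 < \<bar>real_of_rat (r i)\<bar> \<and> \<bar>real_of_rat (r i)\<bar> < ?d)"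
        if h: "0 < \<bar>h\<bar>" "\<bar>h\<bar> < ?d" for h
      proof -
        have "\<exists>r. h < real_of_rat r \<and> real_of_rat r < h + 1 / Suc i" for i
          using of_rat_dense[of h "h + 1 / Suc i"] by auto
        then obtain r where r: "\<And>i. h < real_of_rat (r i)" "\<And>i. real_of_rat (r i) < h + 1 / Suc i" by metis
        have lim: "(\<lambda>i. real_of_rat (r i)) \<longlonglongrightarrow> h"
        proof (rule tendsto_sandwich[of "\<lambda>_. h" _ _ "\<lambda>i. h + 1 / real (Suc i)"])
          show "(\<lambda>i. h + 1 / real (Suc i)) \<longlonglongrightarrow> h"
            using tendsto_add[OF tendsto_const LIMSEQ_inverse_real_of_nat, of h] by (simp add: divide_inverse)
        qed (use r in \<open>auto intro!: always_eventually less_imp_le\<close>)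
        then have "(\<lambda>i. \<bar>real_of_rat (r i)\<bar>) \<longlonglongrightarrow> \<bar>h\<bar>" by (intro tendsto_intros)
        from order_tendstoD(1)[OF this h(1)] order_tendstoD(2)[OF this h(2)]
        have "\<forall>\<^sub>F i in sequentially. 0 < \<bar>real_of_rat (r i)\<bar>" "\<forall>\<^sub>F i in sequentially. \<bar>real_of_rat (r i)\<bar> < ?d" .
        then show ?thesis using lim by (intro exI[of _ r] conjI eventually_conj)
      qed
      have "\<bar>q s - q t\<bar> \<le> e" if st: "0 < \<bar>s\<bar>" "\<bar>s\<bar> < ?d" "0 < \<bar>t\<bar>" "\<bar>t\<bar> < ?d" for s t
      proof -
        obtain r1 where r1: "(\<lambda>i. real_of_rat (r1 i)) \<longlonglongrightarrow> s" "\<forall>\<^sub>F i in sequentially. 0 < \<bar>real_of_rat (r1 i)\<bar> \<and> \<bar>real_of_rat (r1 i)\<bar> < ?d"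
          using dense[OF st(1,2)] by blast
        obtain r2 where r2: "(\<lambda>i. real_of_rat (r2 i)) \<longlonglongrightarrow> t" "\<forall>\<^sub>F i in sequentially. 0 < \<bar>real_of_rat (r2 i)\<bar> \<and> \<bar>real_of_rat (r2 i)\<bar> < ?d"
          using dense[OF st(3,4)] by blast
        have "(\<lambda>i. \<bar>q (real_of_rat (r1 i)) - q (real_of_rat (r2 i))\<bar>) \<longlonglongrightarrow> \<bar>q s - q t\<bar>"
          using st by (intro tendsto_intros isCont_tendsto_compose[OF cq] r1(1) r2(1)) auto
        moreover have "\<forall>\<^sub>F i in sequentially. \<bar>q (real_of_rat (r1 i)) - q (real_of_rat (r2 i))\<bar> \<le> e"
          using r1(2) r2(2)
        proof eventually_elim
          case (elim i)
          then have "\<bar>q (real_of_rat (r1 i)) - q (real_of_rat (r2 i))\<bar> \<le> 1 / Suc m"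
            using n[rule_format, of "r1 i" "r2 i"] unfolding q_def by blast
          then show ?case using m by linarith
        qed
        ultimately show ?thesis by (rule tendsto_upperbound) simp
      qed
      then show ?thesis by (intro exI[of _ ?d]) auto
    qed
    have "\<exists>D. (q \<longlongrightarrow> D) (at 0)"
    proof -
      have "cauchy_filter (filtermap q (at 0))"
        unfolding cauchy_filter_metric_filtermap
      proof (intro allI impI)
        fix e :: real assume "e > 0"
        then obtain d where "d > 0" and d: "\<forall>s t. 0 < \<bar>s\<bar> \<and> \<bar>s\<bar> < d \<and> 0 < \<bar>t\<bar> \<and> \<bar>t\<bar> < d \<longrightarrow> \<bar>q s - q t\<bar> \<le> e / 2"
          using cauchy[of "e / 2"] by auto
        show "\<exists>P. eventually P (at 0) \<and> (\<forall>x y. P x \<and> P y \<longrightarrow> dist (q x) (q y) < e)"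
        proof (intro exI[of _ "\<lambda>h. 0 < \<bar>h\<bar> \<and> \<bar>h\<bar> < d"] conjI allI impI)
          show "\<forall>\<^sub>F h in at 0. 0 < \<bar>h\<bar> \<and> \<bar>h\<bar> < d"
            using \<open>d > 0\<close> by (auto simp: eventually_at dist_real_def intro!: exI[of _ d])
          show "dist (q x) (q y) < e" if "(0 < \<bar>x\<bar> \<and> \<bar>x\<bar> < d) \<and> (0 < \<bar>y\<bar> \<and> \<bar>y\<bar> < d)" for x y
            using d that \<open>e > 0\<close> by (force simp: dist_real_def)
        qed
      qed
      moreover have "complete (UNIV :: real set)"
        by (meson Cauchy_convergent UNIV_I complete_def convergent_def)
      ultimately show ?thesis
        using complete_uniform[where S="UNIV :: real set"] by (force simp: filterlim_def)
    qed
    then show ?thesis by (auto simp: real_differentiable_def DERIV_def q_def[abs_def])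
  qed
qed

lemma lipschitz_on_line:
  fixes w :: "'a::real_normed_vector \<Rightarrow> real"
  assumes "L-lipschitz_on UNIV w"
  shows "(L * norm e)-lipschitz_on UNIV (\<lambda>t::real. w (x + t *\<^sub>R e))"
proof (rule lipschitz_onI)
  fix s t :: real
  have "dist (x + s *\<^sub>R e) (x + t *\<^sub>R e) = norm e * dist s t"
    by (simp add: dist_norm scaleR_diff_left[symmetric] mult.commute)
  then show "dist (w (x + s *\<^sub>R e)) (w (x + t *\<^sub>R e)) \<le> L * norm e * dist s t"
    using lipschitz_onD[OF assms, of "x + s *\<^sub>R e" "x + t *\<^sub>R e"] by (simp add: dist_real_def mult_ac)
qed (use lipschitz_on_nonneg[OF assms] in simp)

text \<open>The exceptional set is Borel and meets every line in direction \<open>e\<close> in a null set, so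
  averaging its measure over the translates in direction \<open>e\<close> gives \<open>0\<close>.\<close>

lemma lipschitz_AE_directional:
  fixes w :: "'a::euclidean_space \<Rightarrow> real"
  assumes lip: "L-lipschitz_on UNIV w"
  shows "AE x in lborel. (\<lambda>t. w (x + t *\<^sub>R e)) differentiable (at 0)"
proof -
  have cont: "continuous_on UNIV w" using lip by (rule lipschitz_on_continuous_on)
  then have [measurable]: "w \<in> borel_measurable borel" by (rule borel_measurable_continuous_onI)
  define N where "N = {x. \<not> (\<lambda>t. w (x + t *\<^sub>R e)) differentiable (at 0)}"
  have contl: "continuous_on UNIV (\<lambda>t. w (x + t *\<^sub>R e))" for x
    using lipschitz_on_line[OF lip] by (rule lipschitz_on_continuous_on)
  have "N = {x \<in> space borel. \<not> (\<forall>m::nat. \<exists>n::nat. \<forall>s t::rat.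
     0 < \<bar>real_of_rat s\<bar> \<and> \<bar>real_of_rat s\<bar> < 1 / Suc n \<and> 0 < \<bar>real_of_rat t\<bar> \<and> \<bar>real_of_rat t\<bar> < 1 / Suc n \<longrightarrow>
     \<bar>(w (x + real_of_rat s *\<^sub>R e) - w (x + 0 *\<^sub>R e)) / real_of_rat s - (w (x + real_of_rat t *\<^sub>R e) - w (x + 0 *\<^sub>R e)) / real_of_rat t\<bar> \<le> 1 / Suc m)}"
    unfolding N_def differentiable_iff_rational_Cauchy[OF contl] by simp
  also have "\<dots> \<in> sets borel" by measurable
  finally have N [measurable]: "N \<in> sets borel" .
  have line: "{t. x + t *\<^sub>R e \<in> N} \<in> null_sets lborel" for x
  proof -
    have "\<not> (\<lambda>t. w (x + t *\<^sub>R e)) differentiable (at t)" if t: "x + t *\<^sub>R e \<in> N" for t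
    proof
      assume "(\<lambda>t. w (x + t *\<^sub>R e)) differentiable (at t)"
      then obtain D where "((\<lambda>t. w (x + t *\<^sub>R e)) has_real_derivative D) (at (0 + t))"
        by (auto simp: real_differentiable_def)
      then have "((\<lambda>s. w (x + (s + t) *\<^sub>R e)) has_real_derivative D) (at 0)"
        by (rule DERIV_shift[THEN iffD1])
      then have "((\<lambda>s. w (x + t *\<^sub>R e + s *\<^sub>R e)) has_real_derivative D) (at 0)"
        by (simp add: algebra_simps)
      then show False using t by (auto simp: N_def real_differentiable_def)
    qed
    then have "{t. x + t *\<^sub>R e \<in> N} \<subseteq> {t. \<not> (\<lambda>t. w (x + t *\<^sub>R e)) differentiable (at t)}" by blast
    then have "negligible {t. x + t *\<^sub>R e \<in> N}"
      using lipschitz_AE_differentiable[OF lipschitz_on_line[OF lip]] negligible_subset by blast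
    moreover have "{t. x + t *\<^sub>R e \<in> N} \<in> sets lborel"
    proof -
      have "{t \<in> space borel. x + t *\<^sub>R e \<in> N} \<in> sets borel" by measurable
      then show ?thesis by simp
    qed
    ultimately show ?thesis
      by (simp add: negligible_iff_null_sets null_sets_completion_iff)
  qed
  have shift: "(\<integral>\<^sup>+x. indicator N (x + t *\<^sub>R e) \<partial>lborel) = emeasure lborel N" for t
  proof -
    have "emeasure lborel N = (\<integral>\<^sup>+x. indicator N x \<partial>distr lborel borel ((+) (t *\<^sub>R e)))"
      by (simp add: lborel_distr_plus)
    also have "\<dots> = (\<integral>\<^sup>+x. indicator N (t *\<^sub>R e + x) \<partial>lborel)"
      by (rule nn_integral_distr) auto
    finally show ?thesis by (simp add: add.commute)
  qed
  have "emeasure lborel N = (\<integral>\<^sup>+t. indicator {0..1} t * emeasure lborel N \<partial>(lborel::real measure))"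
    by (simp add: nn_integral_multc)
  also have "\<dots> = (\<integral>\<^sup>+t. (\<integral>\<^sup>+x. indicator {0..1::real} t * indicator N (x + t *\<^sub>R e) \<partial>lborel) \<partial>lborel)"
    by (simp add: nn_integral_cmult shift)
  also have "\<dots> = (\<integral>\<^sup>+x. (\<integral>\<^sup>+t. indicator {0..1::real} t * indicator N (x + t *\<^sub>R e) \<partial>lborel) \<partial>lborel)"
    by (rule lborel_pair.Fubini') measurable
  also have "\<dots> = (\<integral>\<^sup>+(x::'a). 0 \<partial>lborel)"
  proof (rule nn_integral_cong)
    fix x
    have "AE t in lborel. t \<notin> {t. x + t *\<^sub>R e \<in> N}" using line by (rule AE_not_in)
    then have "AE t in lborel. indicator {0..1::real} t * indicator N (x + t *\<^sub>R e) = (0::ennreal)"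
      by eventually_elim auto
    then show "(\<integral>\<^sup>+t. indicator {0..1::real} t * indicator N (x + t *\<^sub>R e) \<partial>lborel) = 0"
      by (subst nn_integral_0_iff_AE) auto
  qed
  finally have "N \<in> null_sets lborel" by (simp add: null_sets_def)
  then show ?thesis by (rule AE_I') (auto simp: N_def)
qed

lemma lipschitz_difference_quotient_le:
  fixes w :: "real^'n \<Rightarrow> real"
  assumes lip: "L-lipschitz_on UNIV w"
  shows "\<bar>Suc i * (w (x + (1 / Suc i) *\<^sub>R axis k 1) - w x)\<bar> \<le> L"
proof -
  have "\<bar>Suc i * (w (x + (1 / Suc i) *\<^sub>R axis k 1) - w x)\<bar> = Suc i * \<bar>w (x + (1 / Suc i) *\<^sub>R axis k 1) - w x\<bar>"
    by (simp only: abs_mult abs_of_nat)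
  also have "\<dots> \<le> Suc i * (L * (1 / Suc i))"
    using lipschitz_onD[OF lip, of "x + (1 / Suc i) *\<^sub>R axis k 1" x]
    by (intro mult_left_mono) (simp_all add: dist_norm)
  finally show ?thesis by simp
qed

lemma lipschitz_AE_partial:
  fixes w :: "real^'n \<Rightarrow> real"
  assumes lip: "L-lipschitz_on UNIV w"
  shows "AE x in lebesgue. (\<lambda>i. Suc i * (w (x + (1 / Suc i) *\<^sub>R axis k 1) - w x)) \<longlonglongrightarrow> partial k w x"
proof -
  have "AE x in lborel. (\<lambda>i. Suc i * (w (x + (1 / Suc i) *\<^sub>R axis k 1) - w x)) \<longlonglongrightarrow> partial k w x"
    using lipschitz_AE_directional[OF lip, of "axis k 1"]
  proof eventually_elim
    case (elim x)
    then have "((\<lambda>t. w (x + t *\<^sub>R axis k 1)) has_real_derivative partial k w x) (at 0)"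
      by (simp add: partial_def DERIV_deriv_iff_real_differentiable)
    then have "((\<lambda>h. (w (x + h *\<^sub>R axis k 1) - w x) / h) \<longlongrightarrow> partial k w x) (at 0)"
      by (simp add: DERIV_def)
    moreover have "filterlim (\<lambda>i. 1 / real (Suc i)) (at 0) sequentially"
      using LIMSEQ_inverse_real_of_nat by (auto simp: filterlim_at inverse_eq_divide)
    ultimately have "(\<lambda>i. (w (x + (1 / real (Suc i)) *\<^sub>R axis k 1) - w x) / (1 / real (Suc i))) \<longlonglongrightarrow> partial k w x"
      by (rule filterlim_compose)
    then show ?case by (simp add: mult.commute)
  qed
  then show ?thesis by (simp add: AE_completion_iff)
qed

text \<open>\<open>partial\<close> is defined through \<open>deriv\<close>, whose value is
  unspecified where the derivative fails to exist. It agrees almost everywhere with a limit of Borel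
  difference quotients, which are bounded by \<open>L\<close>; this gives Lebesgue measurability and
  the bound.\<close>

lemma lipschitz_partial_measurable:
  fixes w :: "real^'n \<Rightarrow> real"
  assumes lip: "L-lipschitz_on UNIV w"
  shows "partial k w \<in> borel_measurable lebesgue" "AE x in lebesgue. \<bar>partial k w x\<bar> \<le> L"
proof -
  have [measurable]: "w \<in> borel_measurable borel"
    using lip by (intro borel_measurable_continuous_onI lipschitz_on_continuous_on)
  let ?a = "\<lambda>i x. Suc i * (w (x + (1 / Suc i) *\<^sub>R axis k 1) - w x)"
  have "(\<lambda>x. lim (\<lambda>i. ?a i x)) \<in> borel_measurable borel"
    by (intro borel_measurable_lim_metric) measurable
  then have "(\<lambda>x. lim (\<lambda>i. ?a i x)) \<in> borel_measurable lebesgue"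
    by (intro measurable_completion) simp
  moreover have "AE x in lebesgue. lim (\<lambda>i. ?a i x) = partial k w x"
    using lipschitz_AE_partial[OF lip] by eventually_elim (rule limI)
  ultimately show "partial k w \<in> borel_measurable lebesgue"
    by (rule borel_measurable_AE)
  show "AE x in lebesgue. \<bar>partial k w x\<bar> \<le> L"
    using lipschitz_AE_partial[OF lip, of k]
  proof eventually_elim
    case (elim x)
    have "\<bar>?a i x\<bar> \<le> L" for i
      by (rule lipschitz_difference_quotient_le[OF lip])
    moreover have "(\<lambda>i. \<bar>?a i x\<bar>) \<longlonglongrightarrow> \<bar>partial k w x\<bar>"
      using elim by (intro tendsto_intros)
    ultimately show ?case by (intro LIMSEQ_le_const2) auto
  qed
qed

section \<open>Integration by parts for compactly supported Lipschitz functions\<close>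

lemma compact_support_borel_integrable:
  fixes g :: "'a::euclidean_space \<Rightarrow> real"
  assumes "g \<in> borel_measurable borel" "compact K" "\<And>x. x \<notin> K \<Longrightarrow> g x = 0" "\<And>x. \<bar>g x\<bar> \<le> B"
  shows "integrable lborel g"
proof (rule Bochner_Integration.integrable_bound)
  show "integrable lborel (\<lambda>x. B * indicator K x)"
    using emeasure_compact_finite[OF assms(2)] compact_imp_closed[OF assms(2)]
    by (intro integrable_mult_right integrable_real_indicator) (auto simp: borel_closed)
  have "0 \<le> B" using assms(4)[of undefined] by linarith
  then show "AE x in lborel. norm (g x) \<le> norm (B * indicator K x)"
    using assms(3,4) by (auto simp: indicator_def)
qed (use assms in simp)

lemma lborel_integral_shift:
  fixes g :: "'a::euclidean_space \<Rightarrow> real"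
  assumes "g \<in> borel_measurable borel"
  shows "(LINT x|lborel. g (c + x)) = (LINT x|lborel. g x)"
  using integral_distr[of "(+) c" lborel borel g] assms by (simp add: lborel_distr_plus)

text \<open>Translation invariance moves the forward difference quotient of \<open>w\<close> exactly
  to a backward one of \<open>\<phi>\<close>; letting the increment tend to 0 under dominated
  convergence gives the claim. The compact support of \<open>w\<close> also supplies the dominating
  functions.\<close>

lemma partial_integration_by_parts:
  fixes w :: "real^'n \<Rightarrow> real"
  assumes lip: "L-lipschitz_on UNIV w" and K: "compact K" and supp: "\<And>x. x \<notin> K \<Longrightarrow> w x = 0"
    and \<phi>: "\<phi> \<in> C_infty"
  shows "(LINT x|lebesgue. \<phi> x * partial k w x) = - (LINT x|lebesgue. partial k \<phi> x * w x)"
proof -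
  let ?e = "axis k 1 :: real^'n"
  have cw: "continuous_on UNIV w" using lip by (rule lipschitz_on_continuous_on)
  have [measurable]: "w \<in> borel_measurable borel" "\<phi> \<in> borel_measurable borel"
      "partial k \<phi> \<in> borel_measurable borel"
    using cw C_infty_continuous_on[OF \<phi>] C_infty_continuous_on[OF C_infty_partial[OF \<phi>]]
    by (auto intro: borel_measurable_continuous_onI)
  obtain r where r: "r > 0" "K \<subseteq> cball 0 r"
    using compact_imp_bounded[OF K] bounded_subset_ballD[of K 0] ball_subset_cball by blast
  \<comment> \<open>Shifts have length at most 1, so \<open>K'\<close> contains the support of
    \<open>w\<close>, that of its translates, and every intermediate point of the mean value theorem
    below.\<close>
  define K' where "K' = cball (0::real^'n) (r + 2)"
  have cK': "compact K'" by (simp add: K'_def)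
  obtain B where B: "\<And>x. x \<in> K' \<Longrightarrow> \<bar>\<phi> x\<bar> \<le> B" "\<And>x. x \<in> K' \<Longrightarrow> \<bar>partial k \<phi> x\<bar> \<le> B" "0 \<le> B"
  proof -
    have "bounded (\<phi> ` K')" "bounded (partial k \<phi> ` K')"
      using cK' \<phi> by (auto intro!: compact_imp_bounded compact_continuous_image C_infty_continuous_on C_infty_partial)
    then obtain B1 B2 where B12: "\<And>x. x \<in> K' \<Longrightarrow> \<bar>\<phi> x\<bar> \<le> B1" "\<And>x. x \<in> K' \<Longrightarrow> \<bar>partial k \<phi> x\<bar> \<le> B2"
      by (auto simp: bounded_iff)
    show ?thesis
    proof (rule that[of "max 0 (max B1 B2)"])
      fix x assume "x \<in> K'"
      from B12[OF this]
      show "\<bar>\<phi> x\<bar> \<le> max 0 (max B1 B2)" "\<bar>partial k \<phi> x\<bar> \<le> max 0 (max B1 B2)" by linarith+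
    qed simp
  qed
  obtain W where W: "\<And>x. \<bar>w x\<bar> \<le> W"
  proof -
    have "bounded (w ` K)"
      using compact_continuous_image[OF continuous_on_subset[OF cw subset_UNIV] K] by (rule compact_imp_bounded)
    then obtain W where "\<forall>x\<in>K. \<bar>w x\<bar> \<le> W" by (auto simp: bounded_iff)
    then have "\<bar>w x\<bar> \<le> max 0 W" for x
      using supp by (cases "x \<in> K") (auto intro: max.coboundedI2)
    then show ?thesis by (rule that)
  qed
  define a where "a i x = Suc i * (w (x + (1 / Suc i) *\<^sub>R ?e) - w x)" for i x
  \<comment> \<open>The quotient keeps the sign of the backward shift: \<open>c\<close> tends to
    \<open>- partial k \<phi>\<close>, which produces the minus sign in the claim.\<close>
  define c where "c i x = Suc i * (\<phi> (x - (1 / Suc i) *\<^sub>R ?e) - \<phi> x)" for i x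
  have wK': "w x = 0" "w (x + (1 / Suc i) *\<^sub>R ?e) = 0" if "x \<notin> K'" for x i
  proof -
    have "norm x \<le> norm (x + (1 / Suc i) *\<^sub>R ?e) + norm ((1 / Suc i) *\<^sub>R ?e)"
      using norm_triangle_ineq4[of "x + (1 / Suc i) *\<^sub>R ?e" "(1 / Suc i) *\<^sub>R ?e"] by simp
    moreover have "norm ((1 / Suc i) *\<^sub>R ?e) \<le> 1" by simp
    moreover have "r + 2 < norm x" using that by (simp add: K'_def)
    ultimately have "r < norm x" "r < norm (x + (1 / Suc i) *\<^sub>R ?e)" by linarith+
    then have "x \<notin> K" "x + (1 / Suc i) *\<^sub>R ?e \<notin> K"
      using r(2) by (meson mem_cball_0 not_le subsetD)+
    then show "w x = 0" "w (x + (1 / Suc i) *\<^sub>R ?e) = 0" using supp by auto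
  qed
  have aL: "\<bar>a i x\<bar> \<le> L" for i x
    unfolding a_def by (rule lipschitz_difference_quotient_le[OF lip])
  have L: "0 \<le> L" using lip by (rule lipschitz_on_nonneg)
  have dom: "integrable lebesgue (\<lambda>x. D * indicator K' x)" for D :: real
    using emeasure_compact_finite[OF cK'] compact_imp_closed[OF cK']
    by (intro integrable_mult_right integrable_real_indicator) auto
  have "(\<lambda>i. LINT x|lebesgue. \<phi> x * a i x) \<longlonglongrightarrow> (LINT x|lebesgue. \<phi> x * partial k w x)"
  proof (rule integral_dominated_convergence[OF _ _ dom[of "B * L"]])
    show "(\<lambda>x. \<phi> x * partial k w x) \<in> borel_measurable lebesgue"
      by (intro borel_measurable_times lipschitz_partial_measurable(1)[OF lip] measurable_completion) simp
    show "(\<lambda>x. \<phi> x * a i x) \<in> borel_measurable lebesgue" for i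
      unfolding a_def by (intro measurable_completion) measurable
    show "AE x in lebesgue. (\<lambda>i. \<phi> x * a i x) \<longlonglongrightarrow> \<phi> x * partial k w x"
      using lipschitz_AE_partial[OF lip, of k] by eventually_elim (auto simp: a_def intro!: tendsto_intros)
    show "AE x in lebesgue. norm (\<phi> x * a i x) \<le> B * L * indicator K' x" for i
      using aL B wK' L by (intro AE_I2) (auto simp: indicator_def abs_mult a_def intro!: mult_mono)
  qed
  moreover have "(\<lambda>i. LINT x|lebesgue. c i x * w x) \<longlonglongrightarrow> (LINT x|lebesgue. - partial k \<phi> x * w x)"
  proof (rule integral_dominated_convergence[OF _ _ dom[of "B * W"]])
    show "(\<lambda>x. - partial k \<phi> x * w x) \<in> borel_measurable lebesgue"
      by (intro measurable_completion) measurable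
    show "(\<lambda>x. c i x * w x) \<in> borel_measurable lebesgue" for i
      unfolding c_def by (intro measurable_completion) measurable
    show "AE x in lebesgue. (\<lambda>i. c i x * w x) \<longlonglongrightarrow> - partial k \<phi> x * w x"
    proof (rule AE_I2, intro tendsto_mult_right)
      fix x
      have "((\<lambda>t. x + t *\<^sub>R ?e) has_derivative (\<lambda>t. t *\<^sub>R ?e)) (at (0::real))"
        by (auto intro!: derivative_eq_intros)
      from diff_chain_at[OF this, of \<phi> "\<lambda>h. grad \<phi> x \<bullet> h"]
      have "((\<lambda>t. \<phi> (x + t *\<^sub>R ?e)) has_real_derivative partial k \<phi> x) (at 0)"
        using has_derivative_grad[OF C_infty_differentiable[OF \<phi>], of x]
        by (simp add: o_def has_field_derivative_def inner_axis mult_commute_abs)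
      then have "((\<lambda>h. (\<phi> (x + h *\<^sub>R ?e) - \<phi> x) / h) \<longlongrightarrow> partial k \<phi> x) (at 0)"
        by (simp add: DERIV_def)
      moreover have "filterlim (\<lambda>i. - (1 / real (Suc i))) (at 0) sequentially"
        using tendsto_minus[OF LIMSEQ_inverse_real_of_nat] by (auto simp: filterlim_at inverse_eq_divide)
      ultimately have "(\<lambda>i. (\<phi> (x + (- (1 / real (Suc i))) *\<^sub>R ?e) - \<phi> x) / (- (1 / real (Suc i)))) \<longlonglongrightarrow> partial k \<phi> x"
        by (rule filterlim_compose)
      from tendsto_minus[OF this] show "(\<lambda>i. c i x) \<longlonglongrightarrow> - partial k \<phi> x"
        by (simp add: c_def mult.commute)
    qed
    show "AE x in lebesgue. norm (c i x * w x) \<le> B * W * indicator K' x" for i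
    proof (rule AE_I2)
      fix x
      show "norm (c i x * w x) \<le> B * W * indicator K' x"
      proof (cases "x \<in> K")
        case True
        let ?h = "- (1 / real (Suc i))"
        have x: "norm x \<le> r" using True r by auto
        have nh: "norm (x + t *\<^sub>R ?e) \<le> r + 2" if "t \<in> {?h..0}" for t
        proof -
          have "\<bar>t\<bar> \<le> 1 / real (Suc i)" using that by auto
          also have "\<dots> \<le> 1" by simp
          finally show ?thesis using norm_triangle_ineq[of x "t *\<^sub>R ?e"] x by simp
        qed
        have "\<exists>t. ?h < t \<and> t < 0 \<and> \<phi> (x + 0 *\<^sub>R ?e) - \<phi> (x + ?h *\<^sub>R ?e) = (0 - ?h) * partial k \<phi> (x + t *\<^sub>R ?e)"
        proof (rule MVT2)
          fix t :: real
          have "((\<lambda>t. x + t *\<^sub>R ?e) has_derivative (\<lambda>t. t *\<^sub>R ?e)) (at t)"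
            by (auto intro!: derivative_eq_intros)
          from diff_chain_at[OF this, of \<phi> "\<lambda>h. grad \<phi> (x + t *\<^sub>R ?e) \<bullet> h"]
          show "((\<lambda>t. \<phi> (x + t *\<^sub>R ?e)) has_real_derivative partial k \<phi> (x + t *\<^sub>R ?e)) (at t)"
            using has_derivative_grad[OF C_infty_differentiable[OF \<phi>], of "x + t *\<^sub>R ?e"]
            by (simp add: o_def has_field_derivative_def inner_axis mult_commute_abs)
        qed simp
        then obtain t where t: "?h < t" "t < 0" "\<phi> x - \<phi> (x + ?h *\<^sub>R ?e) = 1 / real (Suc i) * partial k \<phi> (x + t *\<^sub>R ?e)"
          by auto
        have "c i x = - partial k \<phi> (x + t *\<^sub>R ?e)"
          using t(3) by (simp add: c_def field_simps)
        moreover have "\<bar>partial k \<phi> (x + t *\<^sub>R ?e)\<bar> \<le> B"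
          using nh[of t] t by (intro B) (auto simp: K'_def)
        ultimately have "\<bar>c i x * w x\<bar> \<le> B * W"
          using W[of x] B(3) by (simp add: abs_mult mult_mono)
        then show ?thesis using x r by (simp add: K'_def)
      next
        case False
        have "0 \<le> W" using W[of x] by linarith
        then show ?thesis using supp[OF False] B(3) by simp
      qed
    qed
  qed
  moreover have "(LINT x|lebesgue. \<phi> x * a i x) = (LINT x|lebesgue. c i x * w x)" for i
  proof -
    let ?h = "(1 / real (Suc i)) *\<^sub>R ?e"
    have "0 \<le> W" using W[of 0] by linarith
    then have bd: "\<bar>\<phi> x * w y\<bar> \<le> B * W" if "x \<notin> K' \<Longrightarrow> w y = 0" for x y
      using B(1)[of x] B(3) W[of y] that by (cases "x \<in> K'") (auto simp: abs_mult intro: mult_mono)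
    have i1: "integrable lborel (\<lambda>x. \<phi> x * w (x + ?h))"
      using bd wK' cK' by (intro compact_support_borel_integrable[of _ K' "B * W"]) auto
    have i2: "integrable lborel (\<lambda>x. \<phi> x * w x)"
      using bd wK' cK' by (intro compact_support_borel_integrable[of _ K' "B * W"]) auto
    have sh: "(LINT x|lborel. \<phi> (x - ?h) * w x) = (LINT x|lborel. \<phi> x * w (x + ?h))"
      using lborel_integral_shift[of "\<lambda>x. \<phi> (x - ?h) * w x" ?h] by (simp add: add.commute)
    have i3: "integrable lborel (\<lambda>x. \<phi> (x - ?h) * w x)"
    proof -
      have "integrable (distr lborel borel ((+) ?h)) (\<lambda>x. \<phi> (x - ?h) * w x)"
        using i1 by (subst integrable_distr_eq) (auto simp: add.commute)
      then show ?thesis by (simp add: lborel_distr_plus)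
    qed
    have "(LINT x|lborel. \<phi> x * a i x) = (LINT x|lborel. Suc i * (\<phi> x * w (x + ?h) - \<phi> x * w x))"
      by (intro Bochner_Integration.integral_cong) (auto simp: a_def algebra_simps)
    also have "\<dots> = Suc i * ((LINT x|lborel. \<phi> (x - ?h) * w x) - (LINT x|lborel. \<phi> x * w x))"
      using i1 i2 by (simp only: integral_mult_right_zero Bochner_Integration.integral_diff sh)
    also have "\<dots> = (LINT x|lborel. Suc i * (\<phi> (x - ?h) * w x - \<phi> x * w x))"
      using i3 i2 by (simp only: integral_mult_right_zero Bochner_Integration.integral_diff)
    also have "\<dots> = (LINT x|lborel. c i x * w x)"
      by (intro Bochner_Integration.integral_cong) (auto simp: c_def algebra_simps)
    finally show ?thesis
      by (subst (1 2) integral_completion) (simp_all add: a_def c_def)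
  qed
  ultimately have "(LINT x|lebesgue. \<phi> x * partial k w x) = (LINT x|lebesgue. - partial k \<phi> x * w x)"
    by (simp add: LIMSEQ_unique)
  then show ?thesis by simp
qed

section \<open>The vector fields\<close>

text \<open>Composition with the nearest-point projection, which is 1-Lipschitz, makes locally
  Lipschitz fields globally bounded and Lipschitz without changing them on the ball of radius
  \<open>r\<close>.\<close>

definition trunc_fields :: "real \<Rightarrow> (real^'n \<Rightarrow> real^'n^'m) \<Rightarrow> real^'n \<Rightarrow> real^'n^'m" where
  "trunc_fields r b x = b (closest_point (cball 0 r) x)"

lemma trunc_fields_eq: "norm x \<le> r \<Longrightarrow> trunc_fields r b x = b x"
  by (simp add: trunc_fields_def closest_point_self)

lemma trunc_fields_lipschitz:
  fixes b :: "real^'n \<Rightarrow> real^'n^'m"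
  assumes b: "locally_lipschitz_fields b" and r: "0 < r"
  obtains L M where "0 \<le> L" "0 \<le> M" "\<And>j. L-lipschitz_on UNIV (\<lambda>x. trunc_fields r b x $ j)"
    "\<And>x j. norm (trunc_fields r b x $ j) \<le> M"
proof -
  have "\<exists>L. L-lipschitz_on (cball 0 r) (\<lambda>y. b y $ j $ k)" for j k
  proof -
    \<comment> \<open>\<open>local_lipschitz\<close> speaks of time-dependent functions; the single
      dummy time \<open>0\<close> gives access to the passage from local constants to one constant
      on a compact set.\<close>
    have "local_lipschitz {0::real} UNIV (\<lambda>_ y. b y $ j $ k)"
      unfolding local_lipschitz_def
    proof (intro ballI)
      fix x :: "real^'n" and t :: real assume "t \<in> {0}"
      obtain \<epsilon> L where \<epsilon>: "\<epsilon> > 0" "L-lipschitz_on (ball x \<epsilon>) (\<lambda>y. b y $ j $ k)"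
        using b unfolding locally_lipschitz_fields_def by blast
      then have "L-lipschitz_on (cball x (\<epsilon> / 2) \<inter> UNIV) (\<lambda>y. b y $ j $ k)"
        by (intro lipschitz_on_subset[OF \<epsilon>(2)]) auto
      then show "\<exists>u>0. \<exists>L. \<forall>t\<in>cball t u \<inter> {0}. L-lipschitz_on (cball x u \<inter> UNIV) (\<lambda>y. b y $ j $ k)"
        using \<epsilon>(1) by (intro exI[of _ "\<epsilon> / 2"] conjI exI[of _ L]) auto
    qed
    then have "local_lipschitz {0::real} (cball 0 r) (\<lambda>_ y. b y $ j $ k)"
      by (rule local_lipschitz_subset) auto
    then show ?thesis
      using local_lipschitz_compact_implies_lipschitz[where X = "cball 0 r" and T = "{0::real}" and f = "\<lambda>_ y. b y $ j $ k"]
      by (metis compact_cball compact_sing continuous_on_const singletonI)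
  qed
  then obtain Lf where Lf: "\<And>j k. (Lf j k)-lipschitz_on (cball 0 r) (\<lambda>y. b y $ j $ k)" by metis
  have Lf0: "0 \<le> Lf j k" for j k using Lf by (rule lipschitz_on_nonneg)
  define L where "L = (\<Sum>j\<in>UNIV. \<Sum>k\<in>UNIV. Lf j k)"
  define M where "M = (\<Sum>j\<in>UNIV. norm (b 0 $ j)) + L * r"
  have L0: "0 \<le> L" unfolding L_def by (intro sum_nonneg Lf0)
  have M0: "0 \<le> M" unfolding M_def using L0 r by (intro add_nonneg_nonneg sum_nonneg) auto
  let ?c = "closest_point (cball (0::real^'n) r)"
  have cc: "?c x \<in> cball 0 r" for x using r by (intro closest_point_in_set) auto
  have lip: "dist (b x $ j) (b y $ j) \<le> L * dist x y" if "x \<in> cball 0 r" "y \<in> cball 0 r" for x y j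
  proof -
    have "dist (b x $ j) (b y $ j) \<le> (\<Sum>k\<in>UNIV. \<bar>(b x $ j - b y $ j) $ k\<bar>)"
      by (simp only: dist_norm norm_le_l1_cart)
    also have "\<dots> \<le> (\<Sum>k\<in>UNIV. Lf j k * dist x y)"
      using lipschitz_onD[OF Lf that] by (intro sum_mono) (simp add: dist_real_def)
    also have "\<dots> = (\<Sum>k\<in>UNIV. Lf j k) * dist x y" by (simp add: sum_distrib_right)
    also have "\<dots> \<le> L * dist x y"
      unfolding L_def by (intro mult_right_mono member_le_sum[of j UNIV "\<lambda>j. \<Sum>k\<in>UNIV. Lf j k"] sum_nonneg Lf0) auto
    finally show ?thesis .
  qed
  show ?thesis
  proof (rule that[OF L0 M0])
    fix j
    show "L-lipschitz_on UNIV (\<lambda>x. trunc_fields r b x $ j)"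
    proof (rule lipschitz_onI[OF _ L0])
      fix x y :: "real^'n"
      have "dist (b (?c x) $ j) (b (?c y) $ j) \<le> L * dist (?c x) (?c y)"
        by (intro lip cc)
      also have "\<dots> \<le> L * dist x y"
        using r by (intro mult_left_mono closest_point_lipschitz L0) auto
      finally show "dist (trunc_fields r b x $ j) (trunc_fields r b y $ j) \<le> L * dist x y"
        by (simp add: trunc_fields_def)
    qed
    fix x
    have "norm (b (?c x) $ j) \<le> norm (b 0 $ j) + dist (b (?c x) $ j) (b 0 $ j)"
      using norm_triangle_sub[of "b (?c x) $ j" "b 0 $ j"] by (simp add: dist_norm)
    also have "dist (b (?c x) $ j) (b 0 $ j) \<le> L * dist (?c x) 0"
      using r by (intro lip cc) auto
    also have "\<dots> \<le> L * r" using cc[of x] L0 by (intro mult_left_mono) (auto simp: dist_norm)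
    also have "norm (b 0 $ j) \<le> (\<Sum>j\<in>UNIV. norm (b 0 $ j))"
      by (intro member_le_sum) auto
    finally show "norm (trunc_fields r b x $ j) \<le> M" by (simp add: M_def trunc_fields_def)
  qed
qed

lemma continuous_on_fields:
  assumes "locally_lipschitz_fields b"
  shows "continuous_on A (\<lambda>x. b x $ j)"
proof -
  have "isCont (\<lambda>x. b x $ j) x" for x
  proof -
    define r where "r = norm x + 1"
    have r: "0 < r" by (simp add: r_def add_nonneg_pos)
    obtain L M where "\<And>j. L-lipschitz_on UNIV (\<lambda>x. trunc_fields r b x $ j)"
      using trunc_fields_lipschitz[OF assms r] by metis
    then have "continuous_on UNIV (\<lambda>x. trunc_fields r b x $ j)"
      using lipschitz_on_continuous_on by blast
    then have "continuous_on (ball 0 r) (\<lambda>x. trunc_fields r b x $ j)"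
      by (rule continuous_on_subset) simp
    then have "continuous_on (ball 0 r) (\<lambda>x. b x $ j)"
      by (rule continuous_on_cong[THEN iffD1, rotated 2]) (auto simp: trunc_fields_eq)
    moreover have "x \<in> ball 0 r" by (simp add: r_def)
    ultimately show ?thesis by (simp add: continuous_on_eq_continuous_at)
  qed
  then show ?thesis by (simp add: continuous_at_imp_continuous_on)
qed

section \<open>Adjoint fields and the distributional gradient of smooth functions\<close>

lemma partial_outside_support:
  assumes "closed K" "\<And>y. y \<notin> K \<Longrightarrow> g y = 0" "x \<notin> K"
  shows "partial k g x = 0"
proof (rule partial_eqI[of g "\<lambda>_. 0"])
  have "((\<lambda>_. 0) has_derivative (\<lambda>_. 0)) (at x)" by simp
  then show "(g has_derivative (\<lambda>_. 0)) (at x)"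
    by (rule has_derivative_transform_within_open[of _ _ _ _ "- K"]) (use assms in auto)
qed

lemma lipschitz_on_mult_bounded:
  fixes f g :: "'a::metric_space \<Rightarrow> real"
  assumes "L-lipschitz_on A f" "M-lipschitz_on A g" "\<And>x. x \<in> A \<Longrightarrow> \<bar>f x\<bar> \<le> F" "\<And>x. x \<in> A \<Longrightarrow> \<bar>g x\<bar> \<le> G"
    "0 \<le> F" "0 \<le> G"
  shows "(F * M + G * L)-lipschitz_on A (\<lambda>x. f x * g x)"
proof (rule lipschitz_onI)
  fix x y assume xy: "x \<in> A" "y \<in> A"
  have "f x * g x - f y * g y = f x * (g x - g y) + g y * (f x - f y)" by (simp add: algebra_simps)
  then have "\<bar>f x * g x - f y * g y\<bar> \<le> \<bar>f x\<bar> * \<bar>g x - g y\<bar> + \<bar>g y\<bar> * \<bar>f x - f y\<bar>"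
    by (metis abs_mult abs_triangle_ineq)
  also have "\<dots> \<le> F * (M * dist x y) + G * (L * dist x y)"
    using assms lipschitz_onD[OF assms(1) xy] lipschitz_onD[OF assms(2) xy] xy
    by (intro add_mono mult_mono) (auto simp: dist_real_def)
  finally show "dist (f x * g x) (f y * g y) \<le> (F * M + G * L) * dist x y"
    by (simp add: dist_real_def algebra_simps)
qed (use assms(5,6) lipschitz_on_nonneg[OF assms(1)] lipschitz_on_nonneg[OF assms(2)] in simp)

lemma C0_infty_lipschitz:
  assumes \<eta>: "\<eta> \<in> C0_infty \<Omega>"
  obtains L B where "L-lipschitz_on UNIV \<eta>" "\<And>x. \<bar>\<eta> x\<bar> \<le> B" "0 \<le> B"
proof -
  obtain K where K: "compact K" "\<And>x. x \<notin> K \<Longrightarrow> \<eta> x = 0" and sm: "\<eta> \<in> C_infty"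
    using \<eta> by (auto simp: C0_infty_def)
  have "bounded (\<eta> ` K)" "bounded (grad \<eta> ` K)"
    using K(1) sm by (auto intro!: compact_imp_bounded compact_continuous_image C_infty_continuous_on continuous_on_grad)
  then obtain B L where B: "\<And>x. x \<in> K \<Longrightarrow> \<bar>\<eta> x\<bar> \<le> B" and L: "\<And>x. x \<in> K \<Longrightarrow> norm (grad \<eta> x) \<le> L"
    by (auto simp: bounded_iff)
  have B': "\<bar>\<eta> x\<bar> \<le> max 0 B" for x
    using B[of x] K(2)[of x] by (cases "x \<in> K") (auto intro: max.coboundedI2)
  have L': "norm (grad \<eta> x) \<le> max 0 L" for x
  proof (cases "x \<in> K")
    case False
    then have "grad \<eta> x = 0"
      using partial_outside_support[OF compact_imp_closed[OF K(1)] K(2)] by (simp add: vec_eq_iff)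
    then show ?thesis by simp
  qed (use L in \<open>auto intro: max.coboundedI2\<close>)
  have "(max 0 L)-lipschitz_on UNIV \<eta>"
  proof (rule lipschitz_onI)
    fix x y
    have "norm (\<eta> x - \<eta> y) \<le> max 0 L * norm (x - y)"
    proof (rule differentiable_bound[of UNIV \<eta> "\<lambda>x h. grad \<eta> x \<bullet> h"])
      show "(\<eta> has_derivative (\<lambda>h. grad \<eta> x \<bullet> h)) (at x within UNIV)" for x
        using has_derivative_grad[OF C_infty_differentiable[OF sm]] by simp
      show "onorm (\<lambda>h. grad \<eta> x \<bullet> h) \<le> max 0 L" for x
      proof (rule onorm_le)
        fix h
        have "norm (grad \<eta> x \<bullet> h) \<le> norm (grad \<eta> x) * norm h" using Cauchy_Schwarz_ineq2[of "grad \<eta> x" h] by simp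
        also have "\<dots> \<le> max 0 L * norm h" by (intro mult_right_mono L') auto
        finally show "norm (grad \<eta> x \<bullet> h) \<le> max 0 L * norm h" .
      qed
    qed auto
    then show "dist (\<eta> x) (\<eta> y) \<le> max 0 L * dist x y" by (simp add: dist_norm)
  qed simp
  then show ?thesis using B' that by (metis max.cobounded1)
qed

text \<open>The factor \<open>\<eta>\<close> vanishes outside a compact set, so the coefficient may
  be replaced by its truncation, and a product of bounded Lipschitz functions is Lipschitz.\<close>

lemma field_mult_lipschitz:
  fixes b :: "real^'n \<Rightarrow> real^'n^'m"
  assumes b: "locally_lipschitz_fields b" and \<eta>: "\<eta> \<in> C0_infty \<Omega>"
  obtains L where "L-lipschitz_on UNIV (\<lambda>y. b y $ j $ k * \<eta> y)"
proof -
  obtain K where K: "compact K" "\<And>x. x \<notin> K \<Longrightarrow> \<eta> x = 0"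
    using \<eta> by (auto simp: C0_infty_def)
  obtain r where r: "0 < r" "\<And>x. x \<in> K \<Longrightarrow> norm x \<le> r"
    using compact_imp_bounded[OF K(1)] by (auto simp: bounded_pos)
  obtain L B where LB: "L-lipschitz_on UNIV \<eta>" "\<And>x. \<bar>\<eta> x\<bar> \<le> B" "0 \<le> B"
    using C0_infty_lipschitz[OF \<eta>] by blast
  obtain L' M where M: "0 \<le> M" "\<And>j. L'-lipschitz_on UNIV (\<lambda>x. trunc_fields r b x $ j)"
    "\<And>x j. norm (trunc_fields r b x $ j) \<le> M"
    using trunc_fields_lipschitz[OF b r(1)] by metis
  have "L'-lipschitz_on UNIV (\<lambda>x. trunc_fields r b x $ j $ k)"
  proof (rule lipschitz_onI)
    fix x y
    show "dist (trunc_fields r b x $ j $ k) (trunc_fields r b y $ j $ k) \<le> L' * dist x y"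
      using lipschitz_onD[OF M(2)[of j], of x y] dist_vec_nth_le[of "trunc_fields r b x $ j" k "trunc_fields r b y $ j"]
      by simp
  qed (use M(2) lipschitz_on_nonneg in blast)
  moreover have "\<bar>trunc_fields r b x $ j $ k\<bar> \<le> M" for x
    using M(3)[of x j] component_le_norm_cart[of "trunc_fields r b x $ j" k] by simp
  ultimately have "(M * L + B * L')-lipschitz_on UNIV (\<lambda>y. trunc_fields r b y $ j $ k * \<eta> y)"
    using LB M(1) by (intro lipschitz_on_mult_bounded) auto
  moreover have "(\<lambda>y. trunc_fields r b y $ j $ k * \<eta> y) = (\<lambda>y. b y $ j $ k * \<eta> y)"
    using K(2) r(2) trunc_fields_eq by (metis mult_zero_right)
  ultimately show ?thesis using that by metis
qed

text \<open>The almost everywhere bound is what lets the right-hand side of the identity in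
  \<open>X_distr\<close> pass to the limit under convergence in mean.\<close>

lemma X_adjoint_measurable:
  fixes b :: "real^'n \<Rightarrow> real^'n^'m"
  assumes b: "locally_lipschitz_fields b" and \<eta>: "\<eta> \<in> C0_infty \<Omega>"
  shows "X_adjoint b j \<eta> \<in> borel_measurable lebesgue"
    and "\<exists>C. AE x in lebesgue. \<bar>X_adjoint b j \<eta> x\<bar> \<le> C"
proof -
  have "\<forall>k. \<exists>L. L-lipschitz_on UNIV (\<lambda>y. b y $ j $ k * \<eta> y)"
    using field_mult_lipschitz[OF b \<eta>] by metis
  then obtain L where L: "\<And>k. (L k)-lipschitz_on UNIV (\<lambda>y. b y $ j $ k * \<eta> y)" by metis
  show "X_adjoint b j \<eta> \<in> borel_measurable lebesgue"
    unfolding X_adjoint_def by (intro borel_measurable_uminus borel_measurable_sum lipschitz_partial_measurable[OF L])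
  have "AE x in lebesgue. \<forall>k. \<bar>partial k (\<lambda>y. b y $ j $ k * \<eta> y) x\<bar> \<le> L k"
    using lipschitz_partial_measurable(2)[OF L] by (simp add: AE_all_countable)
  then have "AE x in lebesgue. \<bar>X_adjoint b j \<eta> x\<bar> \<le> (\<Sum>k\<in>UNIV. L k)"
    by eventually_elim (auto simp: X_adjoint_def intro!: order_trans[OF sum_abs] sum_mono)
  then show "\<exists>C. AE x in lebesgue. \<bar>X_adjoint b j \<eta> x\<bar> \<le> C" by blast
qed

text \<open>The derivatives are moved, one coefficient at a time, to the Lipschitz products
  \<open>b x $ j $ k * \<eta> x\<close>. These carry the compact support, so \<open>\<phi>\<close>
  may be any smooth function; its classical gradient thus satisfies the identity in
  \<open>X_distr\<close>.\<close>

lemma X_classical_integration_by_parts: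
  fixes b :: "real^'n \<Rightarrow> real^'n^'m"
  assumes b: "locally_lipschitz_fields b" and \<eta>: "\<eta> \<in> C0_infty \<Omega>" and \<phi>: "\<phi> \<in> C_infty"
  shows "(LINT x:\<Omega>|lebesgue. X_classical b \<phi> x $ j * \<eta> x) = (LINT x:\<Omega>|lebesgue. \<phi> x * X_adjoint b j \<eta> x)"
proof -
  obtain K where K: "compact K" "K \<subseteq> \<Omega>" "\<And>x. x \<notin> K \<Longrightarrow> \<eta> x = 0"
    using \<eta> by (auto simp: C0_infty_def)
  let ?w = "\<lambda>k y. b y $ j $ k * \<eta> y"
  have w0: "?w k x = 0" if "x \<notin> K" for k x using K(3) that by simp
  have p0: "partial k (?w k) x = 0" if "x \<notin> K" for k x
    using partial_outside_support[OF compact_imp_closed[OF K(1)] w0 that] .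
  have "\<forall>k. \<exists>L. L-lipschitz_on UNIV (?w k)"
    using field_mult_lipschitz[OF b \<eta>] by metis
  then obtain L where L: "\<And>k. (L k)-lipschitz_on UNIV (?w k)" by metis
  have [measurable]: "\<phi> \<in> borel_measurable borel" "\<And>k. partial k \<phi> \<in> borel_measurable borel"
    "\<And>k. ?w k \<in> borel_measurable borel"
    using C_infty_continuous_on[OF \<phi>] C_infty_continuous_on[OF C_infty_partial[OF \<phi>]] lipschitz_on_continuous_on[OF L]
    by (auto intro: borel_measurable_continuous_onI)
  obtain B where B: "\<And>x. x \<in> K \<Longrightarrow> \<bar>\<phi> x\<bar> \<le> B"
    using compact_imp_bounded[OF compact_continuous_image[OF C_infty_continuous_on[OF \<phi>] K(1)]]
    by (auto simp: bounded_iff)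
  have dom: "integrable lebesgue (\<lambda>x. D * indicator K x)" for D :: real
    using emeasure_compact_finite[OF K(1)] compact_imp_closed[OF K(1)]
    by (intro integrable_mult_right integrable_real_indicator) auto
  have i1: "integrable lebesgue (\<lambda>x. \<phi> x * partial k (?w k) x)" for k
  proof (rule Bochner_Integration.integrable_bound[OF dom[of "B * L k"]])
    show "(\<lambda>x. \<phi> x * partial k (?w k) x) \<in> borel_measurable lebesgue"
      by (intro borel_measurable_times lipschitz_partial_measurable(1)[OF L] measurable_completion) simp
    show "AE x in lebesgue. norm (\<phi> x * partial k (?w k) x) \<le> norm (B * L k * indicator K x)"
      using lipschitz_partial_measurable(2)[OF L[of k], of k]
    proof eventually_elim
      case (elim x)
      then show ?case
        using p0[of x k] B[of x] lipschitz_on_nonneg[OF L[of k]]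
        by (cases "x \<in> K") (auto simp: abs_mult intro!: mult_mono)
    qed
  qed
  have i2: "integrable lebesgue (\<lambda>x. partial k \<phi> x * ?w k x)" for k
  proof -
    have "continuous_on K (\<lambda>x. partial k \<phi> x * ?w k x)"
      by (rule continuous_on_mult[OF C_infty_continuous_on[OF C_infty_partial[OF \<phi>]]
            continuous_on_subset[OF lipschitz_on_continuous_on[OF L[of k]] subset_UNIV]])
    from borel_integrable_compact[OF K(1) this]
    have "integrable lborel (\<lambda>x. indicator K x *\<^sub>R (partial k \<phi> x * ?w k x))" .
    also have "(\<lambda>x. indicator K x *\<^sub>R (partial k \<phi> x * ?w k x)) = (\<lambda>x. partial k \<phi> x * ?w k x)"
      using K(3) by (force simp: indicator_def)
    finally have "integrable lborel (\<lambda>x. partial k \<phi> x * ?w k x)" .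
    then show ?thesis by (simp add: integrable_completion)
  qed
  have out: "\<eta> x = 0" "partial k (?w k) x = 0" if "x \<notin> \<Omega>" for k x
    using K(2) K(3)[of x] p0[of x k] that by blast+
  have "(LINT x:\<Omega>|lebesgue. \<phi> x * X_adjoint b j \<eta> x) = (LINT x|lebesgue. - (\<Sum>k\<in>UNIV. \<phi> x * partial k (?w k) x))"
    unfolding set_lebesgue_integral_def
    by (intro Bochner_Integration.integral_cong) (auto simp: X_adjoint_def indicator_def sum_distrib_left out)
  also have "\<dots> = - (\<Sum>k\<in>UNIV. LINT x|lebesgue. \<phi> x * partial k (?w k) x)"
    using i1 by (simp add: Bochner_Integration.integral_sum)
  also have "\<dots> = (\<Sum>k\<in>UNIV. LINT x|lebesgue. partial k \<phi> x * ?w k x)"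
    using partial_integration_by_parts[OF L K(1) w0 \<phi>] by (simp add: sum_negf)
  also have "\<dots> = (LINT x|lebesgue. (\<Sum>k\<in>UNIV. partial k \<phi> x * ?w k x))"
    using i2 by (simp add: Bochner_Integration.integral_sum)
  also have "\<dots> = (LINT x:\<Omega>|lebesgue. X_classical b \<phi> x $ j * \<eta> x)"
    unfolding set_lebesgue_integral_def
    by (intro Bochner_Integration.integral_cong)
      (auto simp: X_classical_def indicator_def sum_distrib_left sum_distrib_right mult_ac out)
  finally show ?thesis by simp
qed

section \<open>Subunit curves\<close>

text \<open>A gauge argument. In a fine tagged division, intervals tagged at good points contribute
  at most C + \<epsilon> times their length by differentiability; those tagged in the exceptional
  null set lie in an open set of small measure and are controlled by absolute continuity.\<close>

lemma absolutely_continuous_derivative_bound: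
  fixes \<gamma> :: "real \<Rightarrow> 'a::real_normed_vector"
  assumes ac: "absolutely_continuous_curve a c \<gamma>"
    and se: "a \<le> s" "s \<le> e" "e \<le> c"
    and ae: "AE t in lebesgue. s < t \<and> t < e \<longrightarrow>
      (\<exists>v. (\<gamma> has_vector_derivative v) (at t within {a..c}) \<and> norm v \<le> C)"
    and C: "0 \<le> C"
  shows "norm (\<gamma> e - \<gamma> s) \<le> C * (e - s)"
proof (rule field_le_epsilon)
  fix \<epsilon>' :: real assume "0 < \<epsilon>'"
  \<comment> \<open>The total error will be \<epsilon> (e - s) from differentiability plus
    \<epsilon> from the exceptional intervals.\<close>
  define \<epsilon> where "\<epsilon> = \<epsilon>' / (e - s + 1)"
  have \<epsilon>: "0 < \<epsilon>" using \<open>0 < \<epsilon>'\<close> se by (auto simp: \<epsilon>_def)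
  have \<epsilon>': "\<epsilon> * (e - s) + \<epsilon> = \<epsilon>'"
  proof -
    have "\<epsilon> * (e - s + 1) = \<epsilon>'" using se by (simp add: \<epsilon>_def)
    then show ?thesis by (simp add: distrib_left)
  qed
  let ?good = "\<lambda>t. \<exists>v. (\<gamma> has_vector_derivative v) (at t within {a..c}) \<and> norm v \<le> C"
  \<comment> \<open>The hypothesis says nothing about the derivative at the end points, yet they can
    be tags; they are counted as exceptional.\<close>
  define N where "N = {t. s < t \<and> t < e \<and> \<not> ?good t} \<union> {s, e}"
  have "{t. s < t \<and> t < e \<and> \<not> ?good t} \<in> null_sets lebesgue"
    using ae unfolding completion.AE_iff_null_sets
    by (rule back_subst[of "\<lambda>A. A \<in> null_sets lebesgue"]) auto
  then have "negligible N"
    unfolding N_def by (intro negligible_Un) (auto simp: negligible_iff_null_sets)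
  obtain \<delta> where \<delta>: "\<delta> > 0" "\<And>D. finite D \<Longrightarrow> (\<And>p q. (p, q) \<in> D \<Longrightarrow> a \<le> p \<and> p \<le> q \<and> q \<le> c) \<Longrightarrow>
      pairwise (\<lambda>(p, q) (p', q'). disjnt {p<..<q} {p'<..<q'}) D \<Longrightarrow> (\<Sum>(p, q)\<in>D. q - p) < \<delta> \<Longrightarrow>
      (\<Sum>(p, q)\<in>D. norm (\<gamma> q - \<gamma> p)) < \<epsilon>"
  proof -
    obtain \<delta> where "\<delta> > 0" and d: "\<forall>D. finite D \<and> (\<forall>(p, q)\<in>D. a \<le> p \<and> p \<le> q \<and> q \<le> c) \<and>
      pairwise (\<lambda>(p, q) (p', q'). disjnt {p<..<q} {p'<..<q'}) D \<and> (\<Sum>(p, q)\<in>D. q - p) < \<delta> \<longrightarrow>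
      (\<Sum>(p, q)\<in>D. norm (\<gamma> q - \<gamma> p)) < \<epsilon>"
      using ac[unfolded absolutely_continuous_curve_def, rule_format, OF \<epsilon>] by blast
    show ?thesis
      by (rule that[OF \<open>\<delta> > 0\<close>]) (rule d[rule_format], blast)
  qed
  obtain U where U: "open U" "N \<subseteq> U" "emeasure lebesgue U < \<delta>"
  proof -
    have "N \<in> sets lebesgue" "emeasure lebesgue N = 0"
      using \<open>negligible N\<close> by (auto simp: negligible_iff_null_sets null_sets_def)
    then obtain U where U: "open U" "N \<subseteq> U" "U - N \<in> lmeasurable" "emeasure lebesgue (U - N) < ennreal \<delta>"
      using sets_lebesgue_outer_open[OF _ \<delta>(1)] by metis
    have "emeasure lebesgue U \<le> emeasure lebesgue (N \<union> (U - N))"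
      using U \<open>N \<in> sets lebesgue\<close> by (intro emeasure_mono) auto
    also have "\<dots> \<le> emeasure lebesgue N + emeasure lebesgue (U - N)"
      using U \<open>N \<in> sets lebesgue\<close> by (intro emeasure_subadditive) (auto intro: fmeasurableD)
    also have "\<dots> < \<delta>" using U \<open>emeasure lebesgue N = 0\<close> by simp
    finally show ?thesis using U that by blast
  qed
  \<comment> \<open>The gauge: around an exceptional point the interval is kept inside
    \<open>U\<close>, around a good point the linear approximation is enforced.\<close>
  have "\<exists>d>0. (x \<in> N \<longrightarrow> ball x d \<subseteq> U) \<and>
      (s < x \<and> x < e \<and> x \<notin> N \<longrightarrow> (\<forall>y\<in>{a..c}. \<bar>y - x\<bar> < d \<longrightarrow> norm (\<gamma> y - \<gamma> x) \<le> (C + \<epsilon>) * \<bar>y - x\<bar>))" for x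
  proof (cases "x \<in> N")
    case True
    then show ?thesis using U by (metis open_contains_ball subset_iff)
  next
    case False
    show ?thesis
    proof (cases "s < x \<and> x < e")
      case True
      then obtain v where v: "(\<gamma> has_vector_derivative v) (at x within {a..c})" "norm v \<le> C"
        using False by (auto simp: N_def)
      then obtain d where d: "d > 0" "\<And>y. y \<in> {a..c} \<Longrightarrow> norm (y - x) < d \<Longrightarrow>
          norm (\<gamma> y - \<gamma> x - (y - x) *\<^sub>R v) \<le> \<epsilon> * norm (y - x)"
        using \<epsilon> unfolding has_vector_derivative_def has_derivative_within_alt by blast
      have "norm (\<gamma> y - \<gamma> x) \<le> (C + \<epsilon>) * \<bar>y - x\<bar>" if "y \<in> {a..c}" "\<bar>y - x\<bar> < d" for y
      proof -
        have "norm (\<gamma> y - \<gamma> x) \<le> norm (\<gamma> y - \<gamma> x - (y - x) *\<^sub>R v) + norm ((y - x) *\<^sub>R v)"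
          using norm_triangle_sub[of "\<gamma> y - \<gamma> x" "(y - x) *\<^sub>R v"] by linarith
        also have "\<dots> \<le> \<epsilon> * \<bar>y - x\<bar> + \<bar>y - x\<bar> * C"
          using d(2)[of y] that v(2) by (intro add_mono) (auto intro!: mult_left_mono)
        finally show ?thesis by (simp add: algebra_simps)
      qed
      then show ?thesis using d(1) False by blast
    next
      case out: False
      then show ?thesis using False zero_less_one by blast
    qed
  qed
  then obtain d where d: "\<And>x. d x > 0" "\<And>x. x \<in> N \<Longrightarrow> ball x (d x) \<subseteq> U"
    "\<And>x y. s < x \<Longrightarrow> x < e \<Longrightarrow> x \<notin> N \<Longrightarrow> y \<in> {a..c} \<Longrightarrow> \<bar>y - x\<bar> < d x \<Longrightarrow> norm (\<gamma> y - \<gamma> x) \<le> (C + \<epsilon>) * \<bar>y - x\<bar>"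
    by metis
  have "gauge (\<lambda>x. ball x (d x))" using d(1) by (intro gauge_ball_dependent) auto
  then obtain p where p: "p tagged_division_of {s..e}" "(\<lambda>x. ball x (d x)) fine p"
    using fine_division_exists_real by blast
  have fin: "finite p" using p(1) by (rule tagged_division_of_finite)
  have K: "\<exists>u v. K = {u..v} \<and> u \<le> v \<and> s \<le> u \<and> v \<le> e \<and> u \<le> x \<and> x \<le> v \<and> {u..v} \<subseteq> ball x (d x)"
    if xK: "(x, K) \<in> p" for x K
  proof -
    obtain u v where uv: "K = {u..v}" using tagged_division_ofD(4)[OF p(1) xK] by (auto simp: box_real)
    have "x \<in> K" "K \<subseteq> {s..e}" using tagged_division_ofD(2,3)[OF p(1) xK] by auto
    moreover have "K \<subseteq> ball x (d x)" using p(2) xK by (auto simp: fine_def)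
    ultimately show ?thesis using uv by auto
  qed
  define g where "g = (\<lambda>(x :: real, K :: real set). norm (\<gamma> (Sup K) - \<gamma> (Inf K)))"
  define l where "l = (\<lambda>(x :: real, K :: real set). Sup K - Inf K)"
  have l0: "0 \<le> l z" if "z \<in> p" for z
    using K that by (cases z) (force simp: l_def)
  have suml: "sum l p = e - s"
    using additive_tagged_division_1[OF se(2) p(1), of "\<lambda>x. x"] by (simp add: l_def)
  have "norm (\<gamma> e - \<gamma> s) = norm (\<Sum>(x, K)\<in>p. \<gamma> (Sup K) - \<gamma> (Inf K))"
    using additive_tagged_division_1[OF se(2) p(1), of \<gamma>] by simp
  also have "\<dots> \<le> sum g p"
    unfolding g_def by (rule order_trans[OF norm_sum]) (auto simp: case_prod_beta)
  also have "\<dots> = sum g {z \<in> p. fst z \<in> N} + sum g {z \<in> p. fst z \<notin> N}"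
    using fin by (subst sum.union_disjoint[symmetric]) (auto intro!: sum.cong)
  also have "sum g {z \<in> p. fst z \<notin> N} \<le> (C + \<epsilon>) * (e - s)"
  proof -
    have "g z \<le> (C + \<epsilon>) * l z" if z: "z \<in> p" "fst z \<notin> N" for z
    proof -
      obtain x K where xK: "z = (x, K)" by (cases z)
      obtain u v where uv: "K = {u..v}" "u \<le> v" "s \<le> u" "v \<le> e" "u \<le> x" "x \<le> v" "{u..v} \<subseteq> ball x (d x)"
        using K[of x K] z xK by blast
      have x: "s < x" "x < e" "x \<notin> N" using z uv xK by (auto simp: N_def)
      have "norm (\<gamma> v - \<gamma> x) \<le> (C + \<epsilon>) * \<bar>v - x\<bar>" "norm (\<gamma> u - \<gamma> x) \<le> (C + \<epsilon>) * \<bar>u - x\<bar>"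
        using uv se by (intro d(3)[OF x]; force simp: subset_iff dist_real_def)+
      then have "norm (\<gamma> v - \<gamma> u) \<le> (C + \<epsilon>) * (v - x) + (C + \<epsilon>) * (x - u)"
        using norm_triangle_ineq4[of "\<gamma> v - \<gamma> x" "\<gamma> u - \<gamma> x"] uv by simp
      then show ?thesis using uv xK by (simp add: g_def l_def algebra_simps)
    qed
    then have "sum g {z \<in> p. fst z \<notin> N} \<le> (\<Sum>z\<in>{z \<in> p. fst z \<notin> N}. (C + \<epsilon>) * l z)"
      by (intro sum_mono) auto
    also have "\<dots> \<le> (\<Sum>z\<in>p. (C + \<epsilon>) * l z)"
      using fin l0 C \<epsilon> by (intro sum_mono2) auto
    finally show ?thesis by (simp add: sum_distrib_left[symmetric] suml)
  qed
  also have "sum g {z \<in> p. fst z \<in> N} \<le> \<epsilon>"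
  proof -
    \<comment> \<open>Absolute continuity is stated for a set of end point pairs, so the passage
      \<open>F\<close> to such pairs must be injective. Non-overlapping intervals with equal end
      points are degenerate; dropping the degenerate ones costs nothing, as they contribute
      0.\<close>
    define q where "q = {z \<in> p. fst z \<in> N \<and> 0 < l z}"
    define F where "F = (\<lambda>(x :: real, K :: real set). (Inf K, Sup K))"
    have finq: "finite q" using fin by (simp add: q_def)
    have disj: "disjnt {Inf K<..<Sup K} {Inf K'<..<Sup K'}"
      if z: "(x, K) \<in> p" "(x', K') \<in> p" "(x, K) \<noteq> (x', K')" for x K x' K'
    proof -
      have "interior K \<inter> interior K' = {}"
        using tagged_division_ofD(5)[OF p(1) z(1,2,3)] .
      moreover obtain u v u' v' where "K = {u..v}" "u \<le> v" "K' = {u'..v'}" "u' \<le> v'"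
        using K[OF z(1)] K[OF z(2)] by blast
      ultimately show ?thesis by (simp add: disjnt_def)
    qed
    have inj: "inj_on F q"
    proof (rule inj_onI)
      fix z z' assume zz: "z \<in> q" "z' \<in> q" "F z = F z'"
      obtain x K x' K' where xK: "z = (x, K)" "z' = (x', K')" by (cases z; cases z')
      show "z = z'"
      proof (rule ccontr)
        assume "z \<noteq> z'"
        then have "disjnt {Inf K<..<Sup K} {Inf K'<..<Sup K'}"
          using zz xK by (intro disj[of x K x' K']) (auto simp: q_def)
        then have "{Inf K<..<Sup K} = {}" using zz xK by (simp add: F_def disjnt_def)
        then show False using zz xK by (auto simp: q_def l_def)
      qed
    qed
    have "sum g {z \<in> p. fst z \<in> N} = sum g q"
    proof (rule sum.mono_neutral_right)
      show "\<forall>z\<in>{z \<in> p. fst z \<in> N} - q. g z = 0"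
        using l0 by (force simp: q_def g_def l_def)
    qed (use fin in \<open>auto simp: q_def\<close>)
    also have "\<dots> = (\<Sum>(u, v)\<in>F ` q. norm (\<gamma> v - \<gamma> u))"
      by (subst sum.reindex[OF inj]) (auto simp: F_def g_def case_prod_beta intro!: sum.cong)
    also have "\<dots> < \<epsilon>"
    proof (rule \<delta>(2))
      show "finite (F ` q)" using finq by simp
      show "a \<le> u \<and> u \<le> v \<and> v \<le> c" if uv: "(u, v) \<in> F ` q" for u v
      proof -
        obtain x K where xK: "(x, K) \<in> p" "u = Inf K" "v = Sup K" using uv by (auto simp: F_def q_def)
        then show ?thesis using K[OF xK(1)] se by auto
      qed
      show "pairwise (\<lambda>(p, q) (p', q'). disjnt {p<..<q} {p'<..<q'}) (F ` q)"
        unfolding pairwise_def using disj by (fastforce simp: F_def q_def)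
      have "(\<Sum>(u, v)\<in>F ` q. ennreal (v - u)) = (\<Sum>z\<in>q. emeasure lebesgue {Inf (snd z)<..<Sup (snd z)})"
        by (subst sum.reindex[OF inj]) (auto simp: F_def q_def l_def case_prod_beta intro!: sum.cong)
      also have "\<dots> = emeasure lebesgue (\<Union>z\<in>q. {Inf (snd z)<..<Sup (snd z)})"
      proof (rule sum_emeasure)
        show "disjoint_family_on (\<lambda>z. {Inf (snd z)<..<Sup (snd z)}) q"
          unfolding disjoint_family_on_def using disj by (fastforce simp: q_def disjnt_def)
      qed (use finq in auto)
      also have "\<dots> \<le> emeasure lebesgue U"
      proof (rule emeasure_mono)
        show "(\<Union>z\<in>q. {Inf (snd z)<..<Sup (snd z)}) \<subseteq> U"
        proof safe
          fix x K y assume "(x, K) \<in> q" "y \<in> {Inf (snd (x, K))<..<Sup (snd (x, K))}"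
          then have "(x, K) \<in> p" "x \<in> N" "y \<in> {Inf K<..<Sup K}" by (auto simp: q_def)
          obtain u v where uv: "K = {u..v}" "u \<le> v" "{u..v} \<subseteq> ball x (d x)"
            using K[OF \<open>(x, K) \<in> p\<close>] by blast
          then have "y \<in> {u..v}" using \<open>y \<in> {Inf K<..<Sup K}\<close> by simp
          then show "y \<in> U" using uv(3) d(2)[OF \<open>x \<in> N\<close>] by blast
        qed
      qed (use U in auto)
      also have "\<dots> < \<delta>" by fact
      finally have "(\<Sum>(u, v)\<in>F ` q. ennreal (v - u)) < \<delta>" .
      moreover have "(\<Sum>(u, v)\<in>F ` q. ennreal (v - u)) = ennreal (\<Sum>(u, v)\<in>F ` q. v - u)"
        unfolding case_prod_beta by (rule sum_ennreal) (auto simp: F_def q_def l_def)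
      ultimately show "(\<Sum>(u, v)\<in>F ` q. v - u) < \<delta>" by (metis ennreal_leI not_le)
    qed
    finally show ?thesis by simp
  qed
  finally have "norm (\<gamma> e - \<gamma> s) \<le> \<epsilon> + (C + \<epsilon>) * (e - s)" by simp
  also have "\<epsilon> + (C + \<epsilon>) * (e - s) = C * (e - s) + \<epsilon>'"
    unfolding \<epsilon>'[symmetric] by (simp only: distrib_right add_ac)
  finally show "norm (\<gamma> e - \<gamma> s) \<le> C * (e - s) + \<epsilon>'" .
qed

lemma absolutely_continuous_curve_continuous:
  fixes \<gamma> :: "real \<Rightarrow> 'a::real_normed_vector"
  assumes ac: "absolutely_continuous_curve a c \<gamma>"
  shows "continuous_on {a..c} \<gamma>"
  unfolding continuous_on_iff
proof (intro ballI allI impI)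
  fix x \<epsilon> :: real assume x: "x \<in> {a..c}" and "0 < \<epsilon>"
  obtain \<delta> where "\<delta> > 0" and \<delta>: "\<forall>D. finite D \<and> (\<forall>(p, q)\<in>D. a \<le> p \<and> p \<le> q \<and> q \<le> c) \<and>
      pairwise (\<lambda>(p, q) (p', q'). disjnt {p<..<q} {p'<..<q'}) D \<and> (\<Sum>(p, q)\<in>D. q - p) < \<delta> \<longrightarrow>
      (\<Sum>(p, q)\<in>D. norm (\<gamma> q - \<gamma> p)) < \<epsilon>"
    using ac[unfolded absolutely_continuous_curve_def, rule_format, OF \<open>0 < \<epsilon>\<close>] by blast
  have one: "norm (\<gamma> q - \<gamma> p) < \<epsilon>" if "a \<le> p" "p \<le> q" "q \<le> c" "q - p < \<delta>" for p q
    using \<delta>[rule_format, of "{(p, q)}"] that by simp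
  have "dist (\<gamma> y) (\<gamma> x) < \<epsilon>" if "y \<in> {a..c}" "dist y x < \<delta>" for y
    using one[of x y] one[of y x] that x
    by (cases "x \<le> y") (auto simp: dist_norm norm_minus_commute)
  then show "\<exists>d>0. \<forall>y\<in>{a..c}. dist y x < d \<longrightarrow> dist (\<gamma> y) (\<gamma> x) < \<epsilon>"
    using \<open>\<delta> > 0\<close> by blast
qed

section \<open>Short subunit curves along a single field\<close>

lemma vector_derivative_bound_0:
  fixes g :: "real \<Rightarrow> 'a::real_normed_vector"
  assumes "\<And>s. s \<in> {0..t} \<Longrightarrow> (g has_vector_derivative g' s) (at s within {0..t})"
    and "\<And>s. s \<in> {0..t} \<Longrightarrow> norm (g' s) \<le> B" and "p \<in> {0..t}" "q \<in> {0..t}"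
  shows "norm (g p - g q) \<le> B * norm (p - q)"
proof (rule differentiable_bound[of "{0..t}" g "\<lambda>s h. h *\<^sub>R g' s"])
  show "(g has_derivative (\<lambda>h. h *\<^sub>R g' s)) (at s within {0..t})" if "s \<in> {0..t}" for s
    using assms(1)[OF that] by (simp add: has_vector_derivative_def)
  show "onorm (\<lambda>h. h *\<^sub>R g' s) \<le> B" if "s \<in> {0..t}" for s
    by (rule onorm_le) (use mult_right_mono[OF assms(2)[OF that] abs_ge_zero] in \<open>simp add: mult.commute\<close>)
qed (use assms in auto)

text \<open>Banach's fixed point theorem for the Picard operator; the curves are defined on all of the
  real line by freezing the time outside \<open>[0, \<tau>]\<close>.\<close>

lemma picard:
  fixes v :: "'a::euclidean_space \<Rightarrow> 'a"
  assumes lip: "L-lipschitz_on UNIV v" and M: "\<And>x. norm (v x) \<le> M" and \<tau>: "0 < \<tau>" "L * \<tau> < 1"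
  obtains \<gamma> where "\<gamma> 0 = y"
    "\<And>s. s \<in> {0..\<tau>} \<Longrightarrow> (\<gamma> has_vector_derivative v (\<gamma> s)) (at s within {0..\<tau>})"
proof -
  have L: "0 \<le> L" using lip by (rule lipschitz_on_nonneg)
  have M0: "0 \<le> M" using M[of undefined] norm_ge_zero order_trans by blast
  have cv: "continuous_on UNIV v" using lip by (rule lipschitz_on_continuous_on)
  define c where "c s = max 0 (min \<tau> s)" for s :: real
  have c: "c s \<in> {0..\<tau>}" for s using \<tau> by (auto simp: c_def)
  have cvf: "continuous_on A (\<lambda>s. v (apply_bcontfun f s))" for f :: "real \<Rightarrow>\<^sub>C 'a" and A
    by (intro continuous_on_compose2[OF cv] continuous_on_apply_bcontfun) auto
  have int: "(\<lambda>s. v (apply_bcontfun f s)) integrable_on {p..q}" for f :: "real \<Rightarrow>\<^sub>C 'a" and p q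
    by (intro integrable_continuous_real cvf)
  define F where "F f s = y + integral {0..c s} (\<lambda>s. v (apply_bcontfun f s))" for f :: "real \<Rightarrow>\<^sub>C 'a" and s
  have Fb: "F f \<in> bcontfun" for f
  proof -
    have "continuous_on UNIV (\<lambda>s. integral {0..c s} (\<lambda>s. v (apply_bcontfun f s)))"
      by (rule continuous_on_compose2[OF indefinite_integral_continuous_1[OF int[of f 0 \<tau>]]])
        (use c in \<open>auto simp: c_def intro!: continuous_intros\<close>)
    then have "continuous_on UNIV (F f)" unfolding F_def by (intro continuous_intros)
    moreover have "norm (F f s) \<le> norm y + M * \<tau>" for s
    proof -
      have "norm (integral {0..c s} (\<lambda>s. v (apply_bcontfun f s))) \<le> M * (c s - 0)"
        using c[of s] M by (intro integral_bound cvf) auto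
      also have "\<dots> \<le> M * \<tau>" using c[of s] M0 by (intro mult_left_mono) auto
      finally show ?thesis unfolding F_def by (rule norm_triangle_mono[OF order_refl])
    qed
    ultimately show ?thesis by (auto simp: bcontfun_def bounded_iff)
  qed
  have "\<exists>!f. Bcontfun (F f) = f"
  proof (rule banach_fix_type)
    show "0 \<le> L * \<tau>" "L * \<tau> < 1" using L \<tau> by auto
    show "\<forall>f g. dist (Bcontfun (F f)) (Bcontfun (F g)) \<le> L * \<tau> * dist f g"
    proof (intro allI dist_bound)
      fix f g s
      have "norm (F f s - F g s) = norm (integral {0..c s} (\<lambda>s. v (apply_bcontfun f s) - v (apply_bcontfun g s)))"
        by (simp add: F_def integral_diff int)
      also have "\<dots> \<le> (L * dist f g) * (c s - 0)"
      proof (rule integral_bound)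
        fix t
        have "dist (v (apply_bcontfun f t)) (v (apply_bcontfun g t)) \<le> L * dist (apply_bcontfun f t) (apply_bcontfun g t)"
          using lip by (rule lipschitz_onD) auto
        also have "\<dots> \<le> L * dist f g" using L by (intro mult_left_mono dist_bounded)
        finally show "norm (v (apply_bcontfun f t) - v (apply_bcontfun g t)) \<le> L * dist f g"
          by (simp add: dist_norm)
      qed (use c[of s] in \<open>auto intro!: continuous_intros cvf\<close>)
      also have "\<dots> \<le> L * dist f g * \<tau>" using c[of s] L by (intro mult_left_mono) auto
      finally show "dist (apply_bcontfun (Bcontfun (F f)) s) (apply_bcontfun (Bcontfun (F g)) s) \<le> L * \<tau> * dist f g"
        by (simp add: Bcontfun_inverse[OF Fb] dist_norm mult_ac)
    qed
  qed
  then obtain f where f: "Bcontfun (F f) = f" by blast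
  have "apply_bcontfun (Bcontfun (F f)) = F f" by (rule Bcontfun_inverse[OF Fb])
  then have "apply_bcontfun f = F f" by (simp only: f)
  then have fs: "apply_bcontfun f s = y + integral {0..s} (\<lambda>s. v (apply_bcontfun f s))" if "s \<in> {0..\<tau>}" for s
    using that unfolding fun_eq_iff F_def by (metis atLeastAtMost_iff c_def max_absorb2 min_absorb2)
  show ?thesis
  proof (rule that[of "apply_bcontfun f"])
    show "apply_bcontfun f 0 = y" using \<tau> by (subst fs) auto
    fix s assume s: "s \<in> {0..\<tau>}"
    have "((\<lambda>s. y + integral {0..s} (\<lambda>s. v (apply_bcontfun f s))) has_vector_derivative v (apply_bcontfun f s)) (at s within {0..\<tau>})"
      using has_vector_derivative_add[OF has_vector_derivative_const integral_has_vector_derivative[OF cvf s, of f]] by simp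
    then show "(apply_bcontfun f has_vector_derivative v (apply_bcontfun f s)) (at s within {0..\<tau>})"
      by (rule has_vector_derivative_transform[OF s, rotated]) (rule fs)
  qed
qed

lemma lipschitz_absolutely_continuous_curve:
  fixes \<gamma> :: "real \<Rightarrow> 'a::real_normed_vector"
  assumes M: "0 \<le> M" and lip: "\<And>p q. a \<le> p \<Longrightarrow> p \<le> q \<Longrightarrow> q \<le> c \<Longrightarrow> norm (\<gamma> q - \<gamma> p) \<le> M * (q - p)"
  shows "absolutely_continuous_curve a c \<gamma>"
  unfolding absolutely_continuous_curve_def
proof (intro allI impI)
  fix \<epsilon> :: real assume "0 < \<epsilon>"
  show "\<exists>\<delta>>0. \<forall>D. finite D \<and> (\<forall>(s, t)\<in>D. a \<le> s \<and> s \<le> t \<and> t \<le> c) \<and>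
        pairwise (\<lambda>(s, t) (s', t'). disjnt {s<..<t} {s'<..<t'}) D \<and> (\<Sum>(s, t)\<in>D. t - s) < \<delta>
        \<longrightarrow> (\<Sum>(s, t)\<in>D. norm (\<gamma> t - \<gamma> s)) < \<epsilon>"
  proof (rule exI[of _ "\<epsilon> / (M + 1)"], intro conjI allI impI; (elim conjE)?)
    show "0 < \<epsilon> / (M + 1)" using M \<open>0 < \<epsilon>\<close> by simp
    fix D assume D: "\<forall>(s, t)\<in>D. a \<le> s \<and> s \<le> t \<and> t \<le> c" "(\<Sum>(s, t)\<in>D. t - s) < \<epsilon> / (M + 1)"
    have "(\<Sum>(s, t)\<in>D. norm (\<gamma> t - \<gamma> s)) \<le> (\<Sum>(s, t)\<in>D. M * (t - s))"
      using D(1) lip by (intro sum_mono) auto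
    also have "\<dots> = M * (\<Sum>(s, t)\<in>D. t - s)"
      by (simp add: sum_distrib_left case_prod_beta)
    also have "\<dots> \<le> (M + 1) * (\<Sum>(s, t)\<in>D. t - s)"
      using D(1) by (intro mult_right_mono sum_nonneg) auto
    also have "\<dots> < \<epsilon>" using D(2) M by (simp add: pos_less_divide_eq mult.commute)
    finally show "(\<Sum>(s, t)\<in>D. norm (\<gamma> t - \<gamma> s)) < \<epsilon>" .
  qed
qed

lemma cc_dist_le: "T \<in> subunit_times b x y \<Longrightarrow> cc_dist b x y \<le> T"
  unfolding cc_dist_def by (rule cInf_lower) (auto simp: subunit_times_def bdd_below_def)

text \<open>The curves are integral curves of one field with a sign; they are subunit because that
  field accounts for one summand of the sum of squares. The error of order t^2 is the deviation from
  the tangent line, caused by the Lipschitz variation of the field along the curve.\<close>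

lemma short_subunit_curves:
  fixes b :: "real^'n \<Rightarrow> real^'n^'m"
  assumes b: "locally_lipschitz_fields b" and r: "0 < r"
  obtains C \<tau> where "0 \<le> C" "0 < \<tau>"
    "\<And>y t j \<sigma>. norm y \<le> r \<Longrightarrow> 0 \<le> t \<Longrightarrow> t \<le> \<tau> \<Longrightarrow> \<bar>\<sigma>\<bar> = 1 \<Longrightarrow>
       \<exists>z. cc_dist b y z \<le> t \<and> norm (z - (y + (t * \<sigma>) *\<^sub>R (b y $ j))) \<le> C * t\<^sup>2"
proof -
  have r1: "0 < r + 1" using r by simp
  obtain L M where LM: "0 \<le> L" "0 \<le> M" "\<And>j. L-lipschitz_on UNIV (\<lambda>x. trunc_fields (r + 1) b x $ j)"
    "\<And>x j. norm (trunc_fields (r + 1) b x $ j) \<le> M"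
    using trunc_fields_lipschitz[OF b r1] by metis
  \<comment> \<open>Small enough for the Picard contraction (\<open>L * \<tau> < 1\<close>) and for
    the curve to stay within distance 1 of its start (\<open>M * \<tau> \<le> 1\<close>), where the
    truncated fields are the given ones.\<close>
  define \<tau> where "\<tau> = 1 / (L + M + 1)"
  have \<tau>: "0 < \<tau>" "L * \<tau> < 1" "M * \<tau> \<le> 1" using LM by (auto simp: \<tau>_def field_simps)
  show ?thesis
  proof (rule that[of "L * M" \<tau>])
    show "0 \<le> L * M" "0 < \<tau>" using LM \<tau> by auto
    fix y :: "real^'n" and t \<sigma> :: real and j :: 'm
    assume y: "norm y \<le> r" and t: "0 \<le> t" "t \<le> \<tau>" and \<sigma>: "\<bar>\<sigma>\<bar> = 1"
    define v where "v x = \<sigma> *\<^sub>R trunc_fields (r + 1) b x $ j" for x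
    have vL: "L-lipschitz_on UNIV v"
      unfolding v_def using lipschitz_on_cmult[OF LM(3)[of j], of \<sigma>] \<sigma> by simp
    have vM: "norm (v x) \<le> M" for x using LM(4)[of x j] \<sigma> by (simp add: v_def)
    obtain \<gamma> where \<gamma>: "\<gamma> 0 = y" "\<And>s. s \<in> {0..\<tau>} \<Longrightarrow> (\<gamma> has_vector_derivative v (\<gamma> s)) (at s within {0..\<tau>})"
      using picard[OF vL vM \<tau>(1,2), of y] by metis
    have \<gamma>': "(\<gamma> has_vector_derivative v (\<gamma> s)) (at s within {0..t})" if "s \<in> {0..t}" for s
      using \<gamma>(2)[of s] that t by (auto intro: has_vector_derivative_within_subset)
    have lip: "norm (\<gamma> p - \<gamma> q) \<le> M * norm (p - q)" if "p \<in> {0..t}" "q \<in> {0..t}" for p q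
      using \<gamma>' vM that by (rule vector_derivative_bound_0)
    have near: "norm (\<gamma> s - y) \<le> M * s" if "s \<in> {0..t}" for s
      using lip[of s 0] that \<gamma>(1) t by simp
    have stay: "norm (\<gamma> s) \<le> r + 1" if "s \<in> {0..t}" for s
    proof -
      have "M * s \<le> M * \<tau>" using that t LM by (intro mult_left_mono) auto
      then have "norm (\<gamma> s - y) \<le> 1" using near[OF that] \<tau>(3) by linarith
      then show ?thesis using y norm_triangle_sub[of "\<gamma> s" y] by simp
    qed
    have "subunit b t \<gamma>"
      unfolding subunit_def
    proof
      show "absolutely_continuous_curve 0 t \<gamma>"
      proof (rule lipschitz_absolutely_continuous_curve[OF LM(2)])
        show "norm (\<gamma> q - \<gamma> p) \<le> M * (q - p)" if "0 \<le> p" "p \<le> q" "q \<le> t" for p q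
          using lip[of q p] that by simp
      qed
      show "AE s in lebesgue. s \<in> {0..t} \<longrightarrow>
        (\<exists>v. (\<gamma> has_vector_derivative v) (at s within {0..t}) \<and>
             (\<forall>\<xi>. (v \<bullet> \<xi>)\<^sup>2 \<le> (\<Sum>j\<in>UNIV. (b (\<gamma> s) $ j \<bullet> \<xi>)\<^sup>2)))"
      proof (rule AE_I2, intro impI exI conjI allI)
        fix s \<xi> assume s: "s \<in> {0..t}"
        show "(\<gamma> has_vector_derivative v (\<gamma> s)) (at s within {0..t})" by (rule \<gamma>'[OF s])
        have "(v (\<gamma> s) \<bullet> \<xi>)\<^sup>2 = (b (\<gamma> s) $ j \<bullet> \<xi>)\<^sup>2"
          using \<sigma> stay[OF s] by (simp add: v_def trunc_fields_eq power_mult_distrib abs_square_eq_1[THEN iffD2])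
        also have "\<dots> \<le> (\<Sum>j\<in>UNIV. (b (\<gamma> s) $ j \<bullet> \<xi>)\<^sup>2)"
          by (intro member_le_sum) auto
        finally show "(v (\<gamma> s) \<bullet> \<xi>)\<^sup>2 \<le> (\<Sum>j\<in>UNIV. (b (\<gamma> s) $ j \<bullet> \<xi>)\<^sup>2)" .
      qed
    qed
    then have "cc_dist b y (\<gamma> t) \<le> t"
      using t \<gamma>(1) by (intro cc_dist_le) (auto simp: subunit_times_def)
    moreover have "norm (\<gamma> t - (y + (t * \<sigma>) *\<^sub>R (b y $ j))) \<le> L * M * t\<^sup>2"
    proof -
      have "norm ((\<gamma> t - t *\<^sub>R v y) - (\<gamma> 0 - 0 *\<^sub>R v y)) \<le> (L * M * t) * norm (t - 0)"
      proof (rule vector_derivative_bound_0[of t "\<lambda>s. \<gamma> s - s *\<^sub>R v y" "\<lambda>s. v (\<gamma> s) - v y"])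
        fix s assume s: "s \<in> {0..t}"
        show "((\<lambda>s. \<gamma> s - s *\<^sub>R v y) has_vector_derivative v (\<gamma> s) - v y) (at s within {0..t})"
          by (auto intro!: derivative_eq_intros \<gamma>'[OF s])
        have "norm (v (\<gamma> s) - v y) \<le> L * norm (\<gamma> s - y)"
          using lipschitz_onD[OF vL, of "\<gamma> s" y] by (simp add: dist_norm)
        also have "\<dots> \<le> L * (M * t)"
          using near[OF s] s LM mult_left_mono[of s t M] by (intro mult_left_mono) auto
        finally show "norm (v (\<gamma> s) - v y) \<le> L * M * t" by simp
      qed (use t in auto)
      moreover have "v y = \<sigma> *\<^sub>R b y $ j" using y by (simp add: v_def trunc_fields_eq)
      ultimately show ?thesis using \<gamma>(1) t by (simp add: algebra_simps power2_eq_square)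
    qed
    ultimately show "\<exists>z. cc_dist b y z \<le> t \<and> norm (z - (y + (t * \<sigma>) *\<^sub>R (b y $ j))) \<le> L * M * t\<^sup>2"
      by blast
  qed
qed

section \<open>Topology of the Carnot-Caratheodory distance\<close>

lemma cc_dist_metric:
  assumes "cc_space b Q"
  shows "0 \<le> cc_dist b x y" "cc_dist b x y = cc_dist b y x" "cc_dist b x x = 0"
    "cc_dist b x z \<le> cc_dist b x y + cc_dist b y z"
proof -
  interpret Metric_space UNIV "cc_dist b" using assms by (simp add: cc_space_def)
  show "0 \<le> cc_dist b x y" "cc_dist b x y = cc_dist b y x" "cc_dist b x x = 0"
    "cc_dist b x z \<le> cc_dist b x y + cc_dist b y z"
    by (auto simp: commute triangle)
qed

lemma open_cc_ball:
  assumes "cc_space b Q"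
  shows "open (cc_ball b x r)"
proof -
  interpret Metric_space UNIV "cc_dist b" using assms by (simp add: cc_space_def)
  have "continuous_map euclidean mtopology id" using assms by (simp add: cc_space_def)
  from openin_continuous_map_preimage[OF this openin_mball[of x r]]
  show ?thesis by (simp add: cc_ball_def mball_def)
qed

lemma continuous_on_cc_dist:
  assumes "cc_space b Q"
  shows "continuous_on A (cc_dist b x)"
proof -
  have "continuous_on UNIV (cc_dist b x)"
    unfolding continuous_on_iff
  proof (intro ballI allI impI)
    fix y and e :: real assume "0 < e"
    then have "y \<in> cc_ball b y e" using cc_dist_metric(3)[OF assms] by (simp add: cc_ball_def)
    then obtain d where d: "d > 0" "ball y d \<subseteq> cc_ball b y e"
      using open_cc_ball[OF assms] open_contains_ball by blast
    have "dist (cc_dist b x z) (cc_dist b x y) < e" if "dist z y < d" for z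
    proof -
      have "cc_dist b y z < e" using d(2) that by (auto simp: cc_ball_def subset_iff dist_commute)
      then show ?thesis
        using cc_dist_metric(4)[OF assms, of x z y] cc_dist_metric(4)[OF assms, of x y z]
          cc_dist_metric(2)[OF assms, of y z]
        by (simp add: dist_real_def abs_less_iff)
    qed
    then show "\<exists>d>0. \<forall>z\<in>UNIV. dist z y < d \<longrightarrow> dist (cc_dist b x z) (cc_dist b x y) < e"
      using d(1) by blast
  qed
  then show ?thesis by (rule continuous_on_subset) simp
qed

text \<open>Test the condition with \<xi> = v, bound the sum of squares by the square of the sum,
  and cancel |v|^2.\<close>

lemma norm_le_of_subunit:
  fixes B :: "real^'n^'m"
  assumes "\<And>\<xi>. (v \<bullet> \<xi>)\<^sup>2 \<le> (\<Sum>j\<in>UNIV. (B $ j \<bullet> \<xi>)\<^sup>2)"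
  shows "norm v \<le> (\<Sum>j\<in>UNIV. norm (B $ j))"
proof (cases "v = 0")
  case False
  have S: "0 \<le> (\<Sum>j\<in>UNIV. norm (B $ j))" by (intro sum_nonneg) auto
  have "(norm v)\<^sup>2 * (norm v)\<^sup>2 = (v \<bullet> v)\<^sup>2" by (simp add: dot_square_norm power2_eq_square)
  also have "\<dots> \<le> (\<Sum>j\<in>UNIV. (B $ j \<bullet> v)\<^sup>2)" by (rule assms)
  also have "\<dots> \<le> (\<Sum>j\<in>UNIV. \<bar>B $ j \<bullet> v\<bar>)\<^sup>2"
  proof -
    have "(B $ j \<bullet> v)\<^sup>2 \<le> \<bar>B $ j \<bullet> v\<bar> * (\<Sum>j\<in>UNIV. \<bar>B $ j \<bullet> v\<bar>)" for j
      using member_le_sum[of j UNIV "\<lambda>j. \<bar>B $ j \<bullet> v\<bar>"]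
      by (subst power2_abs[symmetric], subst power2_eq_square) (intro mult_left_mono, auto)
    then show ?thesis
      by (subst (2) power2_eq_square) (simp add: sum_distrib_right sum_mono)
  qed
  also have "\<dots> \<le> ((\<Sum>j\<in>UNIV. norm (B $ j)) * norm v)\<^sup>2"
    by (intro power_mono) (auto simp: sum_distrib_right intro!: sum_mono sum_nonneg Cauchy_Schwarz_ineq2)
  also have "\<dots> = (\<Sum>j\<in>UNIV. norm (B $ j))\<^sup>2 * (norm v)\<^sup>2" by (simp add: power_mult_distrib)
  finally have "(norm v)\<^sup>2 \<le> (\<Sum>j\<in>UNIV. norm (B $ j))\<^sup>2"
    by (rule mult_right_le_imp_le) (use False in simp)
  then show ?thesis using S by (rule power2_le_imp_le)
qed (simp add: sum_nonneg)

text \<open>A subunit curve leaving the unit ball around \<open>x\<close> has, up to its first exit, speed at most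
  \<open>M\<close>, so it needs time at least \<open>1 / M\<close>.\<close>

lemma cc_ball_subset_cball:
  fixes b :: "real^'n \<Rightarrow> real^'n^'m"
  assumes b: "locally_lipschitz_fields b" and cc: "cc_space b Q"
  obtains \<rho> where "\<rho> > 0" "cc_ball b x \<rho> \<subseteq> cball x 1"
proof -
  have "continuous_on (cball x 1) (\<lambda>z. \<Sum>j\<in>UNIV. norm (b z $ j))"
    by (intro continuous_intros continuous_on_fields[OF b])
  then have "bounded ((\<lambda>z. \<Sum>j\<in>UNIV. norm (b z $ j)) ` cball x 1)"
    by (intro compact_imp_bounded compact_continuous_image) auto
  then obtain M where M: "M > 0" "\<And>z. z \<in> cball x 1 \<Longrightarrow> (\<Sum>j\<in>UNIV. norm (b z $ j)) \<le> M"
    unfolding bounded_pos by (auto simp: abs_le_iff)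
  have "y \<in> cball x 1" if y: "y \<in> cc_ball b x (1 / M)" for y
  proof (rule ccontr)
    assume out: "y \<notin> cball x 1"
    have "subunit_times b x y \<noteq> {}" using cc by (simp add: cc_space_def)
    then obtain T where T: "T \<in> subunit_times b x y" "T < 1 / M"
      using y cInf_lessD[of "subunit_times b x y" "1 / M"] by (auto simp: cc_ball_def cc_dist_def)
    then obtain \<gamma> where \<gamma>: "subunit b T \<gamma>" "\<gamma> 0 = x" "\<gamma> T = y" "0 \<le> T"
      by (auto simp: subunit_times_def)
    have ac: "absolutely_continuous_curve 0 T \<gamma>" using \<gamma>(1) by (simp add: subunit_def)
    have cont: "continuous_on {0..T} \<gamma>" using ac by (rule absolutely_continuous_curve_continuous)
    define S where "S = {t \<in> {0..T}. 1 \<le> norm (\<gamma> t - x)}"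
    have "closed S"
      unfolding S_def by (intro continuous_on_closed_Collect_le continuous_intros cont)
    then have "compact ({0..T} \<inter> S)" by (intro compact_Int_closed) auto
    moreover have "{0..T} \<inter> S = S" by (auto simp: S_def)
    ultimately have "compact S" by simp
    moreover have "T \<in> S" using out \<gamma> by (auto simp: S_def dist_norm norm_minus_commute)
    ultimately obtain s where s: "s \<in> S" "\<And>t. t \<in> S \<Longrightarrow> s \<le> t"
      using compact_attains_inf[of S] by blast
    have "norm (\<gamma> s - \<gamma> 0) \<le> M * (s - 0)"
    proof (rule absolutely_continuous_derivative_bound[OF ac])
      show "AE t in lebesgue. 0 < t \<and> t < s \<longrightarrow>
          (\<exists>v. (\<gamma> has_vector_derivative v) (at t within {0..T}) \<and> norm v \<le> M)"
        using \<gamma>(1)[unfolded subunit_def, THEN conjunct2]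
      proof (eventually_elim, intro impI)
        fix t assume t: "t \<in> {0..T} \<longrightarrow> (\<exists>v. (\<gamma> has_vector_derivative v) (at t within {0..T}) \<and>
             (\<forall>\<xi>. (v \<bullet> \<xi>)\<^sup>2 \<le> (\<Sum>j\<in>UNIV. (b (\<gamma> t) $ j \<bullet> \<xi>)\<^sup>2)))" and ts: "0 < t \<and> t < s"
        have "t \<in> {0..T}" using ts s by (auto simp: S_def)
        moreover have "t \<notin> S" using s(2)[of t] ts by auto
        ultimately have "\<gamma> t \<in> cball x 1" by (auto simp: S_def dist_norm norm_minus_commute)
        obtain v where v: "(\<gamma> has_vector_derivative v) (at t within {0..T})"
          "\<And>\<xi>. (v \<bullet> \<xi>)\<^sup>2 \<le> (\<Sum>j\<in>UNIV. (b (\<gamma> t) $ j \<bullet> \<xi>)\<^sup>2)"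
          using t \<open>t \<in> {0..T}\<close> by blast
        have "norm v \<le> M"
          using norm_le_of_subunit[OF v(2)] M(2)[OF \<open>\<gamma> t \<in> cball x 1\<close>] by linarith
        then show "\<exists>v. (\<gamma> has_vector_derivative v) (at t within {0..T}) \<and> norm v \<le> M" using v(1) by blast
      qed
    qed (use s M in \<open>auto simp: S_def\<close>)
    moreover have "M * (s - 0) \<le> M * T" using s M by (auto simp: S_def)
    moreover have "M * T < 1" using T(2) M by (simp add: field_simps)
    ultimately show False using s \<gamma>(2) by (simp add: S_def)
  qed
  then show ?thesis using M(1) by (intro that[of "1 / M"]) auto
qed

text \<open>Compactness is given in the topology of \<open>cc_dist\<close> and has to be carried to
  the Euclidean one. Covering by small \<open>cc_dist\<close> balls, each inside a Euclidean unit
  ball, yields boundedness; continuity of the distance yields closedness.\<close>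

lemma compact_cc_cball:
  fixes b :: "real^'n \<Rightarrow> real^'n^'m"
  assumes b: "locally_lipschitz_fields b" and cc: "cc_space b Q"
  shows "compact (cc_cball b x r)"
proof -
  interpret Metric_space UNIV "cc_dist b" using cc by (simp add: cc_space_def)
  have "compactin mtopology (cc_cball b x r)" using cc by (simp add: cc_space_def)
  have "\<forall>z. \<exists>\<rho>>0. cc_ball b z \<rho> \<subseteq> cball z 1"
    using cc_ball_subset_cball[OF b cc] by metis
  then obtain \<rho> where \<rho>: "\<And>z. \<rho> z > 0" "\<And>z. cc_ball b z (\<rho> z) \<subseteq> cball z 1" by metis
  have mb: "mball z (\<rho> z) = cc_ball b z (\<rho> z)" for z by (simp add: mball_def cc_ball_def)
  have "\<exists>\<F>. finite \<F> \<and> \<F> \<subseteq> range (\<lambda>z. cc_ball b z (\<rho> z)) \<and> cc_cball b x r \<subseteq> \<Union>\<F>"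
  proof (rule compactinD[OF \<open>compactin mtopology (cc_cball b x r)\<close>])
    show "openin mtopology U" if "U \<in> range (\<lambda>z. cc_ball b z (\<rho> z))" for U
      using that openin_mball unfolding mb[symmetric] by blast
    have "z \<in> cc_ball b z (\<rho> z)" for z
      using \<rho>(1) cc_dist_metric(3)[OF cc] by (simp add: cc_ball_def)
    then show "cc_cball b x r \<subseteq> \<Union> (range (\<lambda>z. cc_ball b z (\<rho> z)))" by blast
  qed
  then obtain \<F> where F: "finite \<F>" "\<F> \<subseteq> range (\<lambda>z. cc_ball b z (\<rho> z))" "cc_cball b x r \<subseteq> \<Union>\<F>" by blast
  have "bounded (\<Union>\<F>)"
    using F(1,2) \<rho>(2) by (intro bounded_Union) (auto intro: bounded_subset[OF bounded_cball])
  then have "bounded (cc_cball b x r)" using F(3) bounded_subset by blast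
  moreover have "closed (cc_cball b x r)"
    unfolding cc_cball_def
    by (rule closed_Collect_le[OF continuous_on_cc_dist[OF cc] continuous_on_const])
  ultimately show ?thesis by (simp add: compact_eq_bounded_closed)
qed

lemma emeasure_cc_ball_le:
  assumes "cc_doubling b C"
  shows "emeasure lebesgue (cc_ball b x (2 ^ k)) \<le> ennreal C ^ k * emeasure lebesgue (cc_ball b x 1)"
proof (induction k)
  case (Suc k)
  have "emeasure lebesgue (cc_ball b x (2 ^ Suc k)) \<le> ennreal C * emeasure lebesgue (cc_ball b x (2 ^ k))"
    using assms by (simp add: cc_doubling_def)
  also have "\<dots> \<le> ennreal C * (ennreal C ^ k * emeasure lebesgue (cc_ball b x 1))"
    using Suc by (intro mult_left_mono) auto
  finally show ?case by (simp add: mult.assoc)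
qed simp

section \<open>Regularised distance functions\<close>

text \<open>The supremal convolution \<open>S\<close> is locally Lipschitz. If \<open>P\<close> decreases at most at
  unit rate along the integral curves of \<open>- v\<close>, then \<open>S\<close> increases almost at most at unit
  rate along \<open>v\<close>: a near-maximiser \<open>y\<close> for the point \<open>x + t v(x)\<close> is moved along \<open>- v\<close> for time
  \<open>t\<close> to a competitor for \<open>x\<close>, and the change of the quadratic penalty is controlled by the Lipschitz
  constant of \<open>v\<close> times the penalty itself, which is small by the uniform continuity of \<open>P\<close>.\<close>

lemma sup_convolution:
  fixes P :: "'a::euclidean_space \<Rightarrow> real"
  assumes P: "uniformly_continuous_on UNIV P" "\<And>x. 0 \<le> P x" "\<And>x. P x \<le> H" "\<And>x. r < norm x \<Longrightarrow> P x = 0"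
    and v: "\<And>v. v \<in> \<V> \<Longrightarrow> L-lipschitz_on UNIV v" "\<And>v. v \<in> \<V> \<Longrightarrow> \<forall>x. norm (v x) \<le> M"
    and LM: "0 \<le> L" "0 \<le> M"
    and C: "0 \<le> C" "0 < \<tau>"
      "\<And>v. v \<in> \<V> \<Longrightarrow> \<forall>y. \<forall>t\<in>{0..\<tau>}. \<exists>z. P y - t \<le> P z \<and> norm (z - (y - t *\<^sub>R v y)) \<le> C * t\<^sup>2"
    and e: "0 < e"
  obtains S \<Lambda> D t1 where "0 \<le> \<Lambda>" "\<And>x y. norm (x - y) \<le> 1 \<Longrightarrow> S x - S y \<le> \<Lambda> * norm (x - y)"
    "\<And>x. \<bar>S x - P x\<bar> \<le> e" "\<And>x. r + 1 \<le> norm x \<Longrightarrow> S x = 0"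
    "0 < t1" "\<And>v. v \<in> \<V> \<Longrightarrow> \<forall>x. \<forall>t\<in>{0<..t1}. S (x + t *\<^sub>R v x) - S x \<le> (5/4) * t + D * t\<^sup>2"
proof -
  \<comment> \<open>\<open>\<delta>\<close> will bound the penalty of near-maximisers up to a small
    error. The second entry makes the growth rate 2 L \<delta> of that penalty at most 1/4, which is
    the excess of 5/4 over the unit rate.\<close>
  define \<delta> where "\<delta> = min e (1 / (8 * (L + 1)))"
  have \<delta>: "0 < \<delta>" "\<delta> \<le> e" "2 * L * \<delta> \<le> 1 / 4"
  proof -
    have "0 < 1 / (8 * (L + 1))" using LM by simp
    then show "0 < \<delta>" "\<delta> \<le> e" using e unfolding \<delta>_def by linarith+
    have "\<delta> \<le> 1 / (8 * (L + 1))" unfolding \<delta>_def by (rule min.cobounded2)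
    then have "\<delta> * (8 * (L + 1)) \<le> 1" using LM by (subst (asm) pos_le_divide_eq) auto
    then have "8 * (L * \<delta>) + 8 * \<delta> \<le> 1" by (simp add: distrib_left mult_ac)
    then show "2 * L * \<delta> \<le> 1 / 4" using \<open>0 < \<delta>\<close> by simp
  qed
  obtain \<kappa> where \<kappa>: "0 < \<kappa>" "\<kappa> \<le> 1" "\<And>x y. norm (x - y) < \<kappa> \<Longrightarrow> \<bar>P x - P y\<bar> \<le> \<delta>"
  proof -
    obtain d where d: "d > 0" "\<And>x y. dist y x < d \<Longrightarrow> dist (P y) (P x) < \<delta>"
      using P(1) \<delta>(1) unfolding uniformly_continuous_on_def by blast
    show ?thesis
    proof (rule that[of "min d 1"])
      fix x y :: 'a assume "norm (x - y) < min d 1"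
      then show "\<bar>P x - P y\<bar> \<le> \<delta>" using d(2)[where y = x and x = y] by (simp add: dist_norm)
    qed (use d in auto)
  qed
  have H: "0 \<le> H" using P(2,3) order_trans by blast
  \<comment> \<open>With this weight a displacement of length at least \<open>\<kappa>\<close> costs
    more than \<open>H + 1\<close>, the range of \<open>P\<close> plus a slack of 1, so only points
    within \<open>\<kappa>\<close> compete.\<close>
  define \<epsilon> where "\<epsilon> = \<kappa>\<^sup>2 / (4 * (H + 1))"
  have \<epsilon>: "0 < \<epsilon>" using \<kappa> H by (simp add: \<epsilon>_def)
  have pen: "H + 1 < (norm w)\<^sup>2 / (2 * \<epsilon>)" if "\<kappa> \<le> norm w" for w :: 'a
  proof -
    have "\<epsilon> * (4 * (H + 1)) = \<kappa>\<^sup>2" unfolding \<epsilon>_def using H by (intro nonzero_eq_divide_eq[THEN iffD1] refl) simp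
    then have "2 * \<epsilon> * (H + 1) = \<kappa>\<^sup>2 / 2" by (simp add: algebra_simps)
    also have "\<dots> < \<kappa>\<^sup>2" using \<kappa> by simp
    also have "\<dots> \<le> (norm w)\<^sup>2" using that \<kappa> by (intro power_mono) auto
    finally show ?thesis using \<epsilon> by (simp add: field_simps)
  qed
  define p where "p x y = P y - (norm (x - y))\<^sup>2 / (2 * \<epsilon>)" for x y
  define S where "S x = (SUP y. p x y)" for x
  have pH: "p x y \<le> H" for x y
  proof -
    have "0 \<le> (norm (x - y))\<^sup>2 / (2 * \<epsilon>)" using \<epsilon> by simp
    then show ?thesis using P(3)[of y] unfolding p_def by linarith
  qed
  have bdd: "bdd_above (range (p x))" for x using pH by (auto simp: bdd_above_def)
  have pS: "p x y \<le> S x" for x y unfolding S_def by (rule cSUP_upper[OF _ bdd]) auto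
  have PS: "P x \<le> S x" for x using pS[of x x] by (simp add: p_def)
  \<comment> \<open>Comparing with the competitor y = x bounds the penalty of a near-maximiser by
    the oscillation \<open>\<delta>\<close> of \<open>P\<close> plus the error \<open>e'\<close>,
    which is what the slack of 1 permits.\<close>
  have near: "\<exists>y. S x - e' < p x y \<and> norm (x - y) < \<kappa> \<and> (norm (x - y))\<^sup>2 / (2 * \<epsilon>) \<le> \<delta> + e'"
    if e': "0 < e'" "e' \<le> 1" for x e'
  proof -
    obtain y where y: "S x - e' < p x y"
      using less_cSUP_iff[OF _ bdd, of "S x - e'" x] e' unfolding S_def by auto
    have "norm (x - y) < \<kappa>"
    proof (rule ccontr)
      assume "\<not> norm (x - y) < \<kappa>"
      then have "p x y < - 1" using pen[of "x - y"] P(3)[of y] by (simp add: p_def)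
      then show False using y PS[of x] P(2)[of x] e' by linarith
    qed
    moreover from this have "\<bar>P x - P y\<bar> \<le> \<delta>" by (rule \<kappa>(3))
    ultimately show ?thesis using y PS[of x] by (intro exI[of _ y]) (simp add: p_def abs_le_iff)
  qed
  have SP: "S x \<le> P x + \<delta>" for x
    unfolding S_def
  proof (rule cSUP_least)
    fix y
    show "p x y \<le> P x + \<delta>"
    proof (cases "norm (x - y) < \<kappa>")
      case True
      have "0 \<le> (norm (x - y))\<^sup>2 / (2 * \<epsilon>)" using \<epsilon> by simp
      then show ?thesis using \<kappa>(3)[OF True] unfolding p_def by linarith
    next
      case False
      then show ?thesis using pen[of "x - y"] P(3)[of y] P(2)[of x] \<delta>(1) by (simp add: p_def)
    qed
  qed simp
  \<comment> \<open>Moving the centre by at most 1 raises the squared distance by at most the length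
    of the move times a sum of two distances, which are at most \<kappa> and \<kappa> + 1.\<close>
  define \<Lambda> where "\<Lambda> = (2 * \<kappa> + 1) / (2 * \<epsilon>)"
  define t1 where "t1 = min \<tau> 1"
  define E where "E = 2 * (C + L * M) + (L + C + L * M)\<^sup>2"
  define D where "D = 1 + 2 * L + E / (2 * \<epsilon>)"
  show ?thesis
  proof (rule that[of \<Lambda> S t1 D])
    show "0 \<le> \<Lambda>" using \<kappa> \<epsilon> by (simp add: \<Lambda>_def)
    show "\<bar>S x - P x\<bar> \<le> e" for x using PS[of x] SP[of x] \<delta> by linarith
    show "0 < t1" using C by (simp add: t1_def)
    show "S x = 0" if x: "r + 1 \<le> norm x" for x
    proof -
      have "S x \<le> 0"
        unfolding S_def
      proof (rule cSUP_least)
        fix y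
        show "p x y \<le> 0"
        proof (cases "norm (x - y) < \<kappa>")
          case True
          then have "r < norm y" using norm_triangle_sub[of x y] x \<kappa> by linarith
          then show ?thesis using P(4) \<epsilon> by (simp add: p_def)
        next
          case False
          then show ?thesis using pen[of "x - y"] P(3)[of y] by (simp add: p_def)
        qed
      qed simp
      then show ?thesis using PS[of x] P(2)[of x] by linarith
    qed
    show "S x' - S x \<le> \<Lambda> * norm (x' - x)" if xx: "norm (x' - x) \<le> 1" for x x'
    proof (rule field_le_epsilon)
      fix e' :: real assume "0 < e'"
      obtain y where y: "S x' - min e' 1 < p x' y" "norm (x' - y) < \<kappa>"
        using near[of "min e' 1" x'] \<open>0 < e'\<close> by auto
      have d: "norm (x - y) \<le> norm (x' - x) + norm (x' - y)"
        using norm_triangle_ineq4[of "x' - y" "x' - x"] by (simp add: add.commute)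
      have "(norm (x - y))\<^sup>2 - (norm (x' - y))\<^sup>2 = (norm (x - y) - norm (x' - y)) * (norm (x - y) + norm (x' - y))"
        by (simp add: power2_eq_square algebra_simps)
      also have "\<dots> \<le> norm (x' - x) * (2 * \<kappa> + 1)"
        using d y(2) xx by (intro mult_mono) auto
      finally have "((norm (x - y))\<^sup>2 - (norm (x' - y))\<^sup>2) / (2 * \<epsilon>) \<le> norm (x' - x) * (2 * \<kappa> + 1) / (2 * \<epsilon>)"
        using \<epsilon> by (intro divide_right_mono) auto
      then have "(norm (x - y))\<^sup>2 / (2 * \<epsilon>) - (norm (x' - y))\<^sup>2 / (2 * \<epsilon>) \<le> \<Lambda> * norm (x' - x)"
        by (simp add: \<Lambda>_def diff_divide_distrib mult.commute)
      then show "S x' - S x \<le> \<Lambda> * norm (x' - x) + e'"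
        using pS[of x y] y(1) unfolding p_def by linarith
    qed
    show "\<forall>x. \<forall>t\<in>{0<..t1}. S (x + t *\<^sub>R v x) - S x \<le> (5/4) * t + D * t\<^sup>2" if vV: "v \<in> \<V>" for v
    proof (intro allI ballI)
      fix x t assume "t \<in> {0<..t1}"
      then have t: "0 < t" "t \<le> t1" by auto
      define x' where "x' = x + t *\<^sub>R v x"
      have t': "t \<le> 1" "t \<le> \<tau>" "t\<^sup>2 \<le> 1" using t by (auto simp: t1_def power_le_one)
      \<comment> \<open>A near-maximiser with error t^2 suffices, since this error goes into the
        term \<open>D * t\<^sup>2\<close>.\<close>
      obtain y where y: "S x' - t\<^sup>2 < p x' y" "norm (x' - y) < \<kappa>" "(norm (x' - y))\<^sup>2 / (2 * \<epsilon>) \<le> \<delta> + t\<^sup>2"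
        using near[of "t\<^sup>2" x'] t t' by auto
      obtain z where z: "P y - t \<le> P z" "norm (z - (y - t *\<^sub>R v y)) \<le> C * t\<^sup>2"
        using C(3)[OF vV, rule_format, of t y] t t' by auto
      define a where "a = norm (x' - y)"
      have a: "0 \<le> a" "a \<le> 1" using y \<kappa> by (auto simp: a_def)
      define w where "w = norm ((x - z) - (x' - y))"
      have "norm (y - x) \<le> a + t * M"
      proof -
        have "norm (y - x) \<le> norm (x' - y) + norm (x' - x)"
          using norm_triangle_ineq4[of "x' - x" "x' - y"] by simp
        also have "norm (x' - x) \<le> t * M" using v(2)[OF vV, rule_format, of x] t by (simp add: x'_def mult_left_mono)
        finally show ?thesis by (simp add: a_def)
      qed
      then have "norm (v y - v x) \<le> L * (a + t * M)"
        using lipschitz_onD[OF v(1)[OF vV], of y x] LM by (auto simp: dist_norm intro: order_trans mult_left_mono)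
      have "(x - z) - (x' - y) = - (z - (y - t *\<^sub>R v y)) + t *\<^sub>R (v y - v x)"
        by (simp add: x'_def algebra_simps)
      then have "w = norm (- (z - (y - t *\<^sub>R v y)) + t *\<^sub>R (v y - v x))" unfolding w_def by (rule arg_cong)
      also have "\<dots> \<le> norm (- (z - (y - t *\<^sub>R v y))) + norm (t *\<^sub>R (v y - v x))" by (rule norm_triangle_ineq)
      also have "\<dots> = norm (z - (y - t *\<^sub>R v y)) + t * norm (v y - v x)" using t(1) by (simp only: norm_minus_cancel norm_scaleR abs_of_pos)
      also have "\<dots> \<le> C * t\<^sup>2 + t * (L * (a + t * M))"
        using z(2) t \<open>norm (v y - v x) \<le> _\<close> by (intro add_mono mult_left_mono) auto
      \<comment> \<open>The part of the displacement error that is linear in t carries the factor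
        \<open>a\<close>. In the cross term \<open>a * w\<close> it becomes t L a^2, a multiple of
        the penalty itself, whereas everything else is of order t^2.\<close>
      finally have w1: "w \<le> t * L * a + (C + L * M) * t\<^sup>2" by (simp add: algebra_simps power2_eq_square)
      have w0: "0 \<le> w" by (simp add: w_def)
      have "w \<le> t * L * 1 + (C + L * M) * t"
      proof -
        have "t * L * a \<le> t * L * 1" using t LM a by (intro mult_left_mono) auto
        moreover have "(C + L * M) * t\<^sup>2 \<le> (C + L * M) * t"
          using t t' LM C by (intro mult_left_mono) (auto simp: power2_eq_square mult_left_le)
        ultimately show ?thesis using w1 by linarith
      qed
      then have "w \<le> (L + C + L * M) * t" by (simp add: algebra_simps)
      then have w2: "w\<^sup>2 \<le> (L + C + L * M)\<^sup>2 * t\<^sup>2"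
        using w0 power_mono[of w "(L + C + L * M) * t" 2] by (simp add: power_mult_distrib)
      have "a * w \<le> a * (t * L * a + (C + L * M) * t\<^sup>2)" using w1 a by (intro mult_left_mono)
      also have "\<dots> \<le> t * L * a\<^sup>2 + (C + L * M) * t\<^sup>2"
      proof -
        have "a * ((C + L * M) * t\<^sup>2) \<le> 1 * ((C + L * M) * t\<^sup>2)" using a C LM by (intro mult_right_mono) auto
        then show ?thesis by (simp add: distrib_left power2_eq_square mult_ac)
      qed
      finally have aw: "a * w \<le> t * L * a\<^sup>2 + (C + L * M) * t\<^sup>2" .
      have "norm (x - z) \<le> a + w"
        using norm_triangle_sub[of "x - z" "x' - y"] by (simp add: a_def w_def)
      then have "(norm (x - z))\<^sup>2 \<le> (a + w)\<^sup>2" by (intro power_mono) auto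
      also have "\<dots> = a\<^sup>2 + 2 * (a * w) + w\<^sup>2" by (simp add: power2_sum)
      also have "\<dots> \<le> a\<^sup>2 + 2 * t * L * a\<^sup>2 + E * t\<^sup>2"
        using aw w2 by (simp add: E_def algebra_simps)
      finally have "(norm (x - z))\<^sup>2 / (2 * \<epsilon>) \<le> (a\<^sup>2 + 2 * t * L * a\<^sup>2 + E * t\<^sup>2) / (2 * \<epsilon>)"
        using \<epsilon> by (intro divide_right_mono) auto
      also have "\<dots> = a\<^sup>2 / (2 * \<epsilon>) + 2 * t * L * (a\<^sup>2 / (2 * \<epsilon>)) + E / (2 * \<epsilon>) * t\<^sup>2"
        by (simp add: add_divide_distrib)
      also have "2 * t * L * (a\<^sup>2 / (2 * \<epsilon>)) \<le> 2 * t * L * (\<delta> + t\<^sup>2)"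
        using y(3) t LM by (intro mult_left_mono) (auto simp: a_def)
      also have "\<dots> = t * (2 * L * \<delta>) + t * (2 * L * t\<^sup>2)" by (simp add: algebra_simps)
      also have "\<dots> \<le> t * (1 / 4) + 1 * (2 * L * t\<^sup>2)"
        using \<delta>(3) t t' LM by (intro add_mono mult_left_mono mult_right_mono) auto
      finally have fin: "(norm (x - z))\<^sup>2 / (2 * \<epsilon>) \<le> a\<^sup>2 / (2 * \<epsilon>) + (t / 4 + 2 * L * t\<^sup>2) + E / (2 * \<epsilon>) * t\<^sup>2"
        by simp
      have "S x' < t\<^sup>2 + P y - a\<^sup>2 / (2 * \<epsilon>)" using y(1) by (simp add: p_def a_def)
      moreover have "P z - (norm (x - z))\<^sup>2 / (2 * \<epsilon>) \<le> S x" using pS[of x z] by (simp add: p_def)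
      moreover have "D * t\<^sup>2 = t\<^sup>2 + 2 * L * t\<^sup>2 + E / (2 * \<epsilon>) * t\<^sup>2" by (simp add: D_def distrib_right)
      ultimately have "S x' - S x \<le> (5/4) * t + D * t\<^sup>2" using fin z(1) by linarith
      then show "S (x + t *\<^sub>R v x) - S x \<le> (5/4) * t + D * t\<^sup>2" by (simp add: x'_def)
    qed
  qed
qed

text \<open>At the averaged point x + z the hypothesis concerns v(x + z), while the derivative of
  the average uses v(x). The two differ by at most L \<eta>, and the Lipschitz bound of
  \<open>S\<close> turns this into an error \<Lambda> L \<eta> per unit time, which a small
  mollification radius makes harmless.\<close>

lemma mollify_along_fields:
  fixes S :: "real^'n \<Rightarrow> real"
  assumes \<Lambda>: "0 \<le> \<Lambda>" and lip: "\<And>x y. norm (x - y) \<le> 1 \<Longrightarrow> S x - S y \<le> \<Lambda> * norm (x - y)"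
    and supp: "\<And>x. r \<le> norm x \<Longrightarrow> S x = 0"
    and L: "0 \<le> L" and v: "\<And>v. v \<in> \<V> \<Longrightarrow> L-lipschitz_on UNIV v"
    and t1: "0 < t1" and dir: "\<And>v. v \<in> \<V> \<Longrightarrow> \<forall>x. \<forall>t\<in>{0<..t1}. S (x + t *\<^sub>R v x) - S x \<le> K * t + D * t\<^sup>2"
    and e: "0 < e"
  obtains V where "V \<in> C_infty" "\<And>x. \<bar>V x - S x\<bar> \<le> e" "\<And>x. r + 1 \<le> norm x \<Longrightarrow> V x = 0"
    "\<And>v. v \<in> \<V> \<Longrightarrow> \<forall>x. grad V x \<bullet> v x \<le> K + e"
proof -
  \<comment> \<open>One radius serves both errors: \<Lambda> \<eta> for the distance from
    \<open>S\<close> and \<Lambda> L \<eta> for the rate along the fields.\<close>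
  define \<eta> where "\<eta> = min 1 (e / (\<Lambda> * (L + 1) + 1))"
  have q: "0 < \<Lambda> * (L + 1) + 1" using \<Lambda> L by (intro add_nonneg_pos mult_nonneg_nonneg) auto
  have \<eta>: "0 < \<eta>" "\<eta> \<le> 1" using e q by (auto simp: \<eta>_def)
  have \<eta>e: "\<Lambda> * \<eta> \<le> e" "\<Lambda> * L * \<eta> \<le> e"
  proof -
    have "\<eta> \<le> e / (\<Lambda> * (L + 1) + 1)" unfolding \<eta>_def by (rule min.cobounded2)
    then have "\<eta> * (\<Lambda> * (L + 1) + 1) \<le> e" using q by (subst (asm) pos_le_divide_eq) auto
    then have *: "\<Lambda> * L * \<eta> + \<Lambda> * \<eta> + \<eta> \<le> e" by (simp add: algebra_simps)
    have "0 \<le> \<Lambda> * L * \<eta>" "0 \<le> \<Lambda> * \<eta>" using \<Lambda> L \<eta> by auto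
    with * \<eta>(1) show "\<Lambda> * \<eta> \<le> e" "\<Lambda> * L * \<eta> \<le> e" by linarith+
  qed
  obtain \<rho> :: "real^'n \<Rightarrow> real" where \<rho>: "\<rho> \<in> C_infty" "\<And>z. 0 \<le> \<rho> z" "\<And>z. \<rho> (- z) = \<rho> z"
    "\<And>z. \<eta> \<le> norm z \<Longrightarrow> \<rho> z = 0" "integrable lborel \<rho>" "(LINT z|lborel. \<rho> z) = 1"
    using mollifier_exists[OF \<eta>(1)] by blast
  have lip': "\<bar>S x - S y\<bar> \<le> \<Lambda> * norm (x - y)" if "norm (x - y) \<le> 1" for x y
    using lip[OF that] lip[of y x] that by (simp add: norm_minus_commute abs_le_iff)
  have contS: "continuous_on UNIV S"
    unfolding continuous_on_iff
  proof (intro ballI allI impI)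
    fix x and e' :: real assume "0 < e'"
    show "\<exists>d>0. \<forall>y\<in>UNIV. dist y x < d \<longrightarrow> dist (S y) (S x) < e'"
    proof (intro exI[of _ "min 1 (e' / (\<Lambda> + 1))"] conjI ballI impI)
      show "0 < min 1 (e' / (\<Lambda> + 1))" using \<Lambda> \<open>0 < e'\<close> by simp
      fix y assume y: "dist y x < min 1 (e' / (\<Lambda> + 1))"
      then have "dist (S y) (S x) \<le> \<Lambda> * dist y x" using lip'[of y x] by (simp add: dist_norm)
      also have "\<dots> \<le> (\<Lambda> + 1) * dist y x" by (intro mult_right_mono) auto
      also have "\<dots> < e'" using y \<Lambda> by (simp add: pos_less_divide_eq mult.commute)
      finally show "dist (S y) (S x) < e'" .
    qed
  qed
  have [measurable]: "S \<in> borel_measurable borel" "\<rho> \<in> borel_measurable borel"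
    using contS C_infty_continuous_on[OF \<rho>(1)] by (auto intro: borel_measurable_continuous_onI)
  \<comment> \<open>\<open>C_infty_convolution\<close> integrates over a box; one that contains the
    support of \<open>S\<close> makes this the full convolution.\<close>
  obtain c where c: "cball 0 r \<subseteq> cbox (- c) (c :: real^'n)"
    using bounded_subset_cbox_symmetric[OF bounded_cball] by blast
  define V where "V x = integral (cbox (- c) c) (\<lambda>y. S y * \<rho> (x - y))" for x
  have smV: "V \<in> C_infty" unfolding V_def by (rule C_infty_convolution[OF contS \<rho>(1)])
  have S0: "S y = 0" if "y \<notin> cbox (- c) c" for y
    using that c supp[of y] by (cases "norm y \<le> r") (auto simp: subset_iff)
  have int: "integrable lborel (\<lambda>z. S (x + z) * \<rho> z)" for x
  proof -
    have "integrable lborel (\<lambda>z. indicator (cball 0 \<eta>) z *\<^sub>R (S (x + z) * \<rho> z))"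
      by (intro borel_integrable_compact continuous_intros continuous_on_compose2[OF contS] C_infty_continuous_on[OF \<rho>(1)]) auto
    also have "(\<lambda>z. indicator (cball 0 \<eta>) z *\<^sub>R (S (x + z) * \<rho> z)) = (\<lambda>z. S (x + z) * \<rho> z)"
      using \<rho>(4) by (force simp: indicator_def)
    finally show ?thesis .
  qed
  have V: "V x = (LINT z|lborel. S (x + z) * \<rho> z)" for x
  proof -
    have "set_integrable lborel (cbox (- c) c) (\<lambda>y. S y * \<rho> (x - y))"
      unfolding set_integrable_def
      by (intro borel_integrable_compact continuous_intros continuous_on_subset[OF contS]
          continuous_on_compose2[OF C_infty_continuous_on[OF \<rho>(1), of UNIV]]) auto
    then have "V x = (LINT y:cbox (- c) c|lborel. S y * \<rho> (x - y))"
      unfolding V_def by (rule set_borel_integral_eq_integral(2)[symmetric])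
    also have "\<dots> = (LINT y|lborel. S y * \<rho> (x - y))"
      unfolding set_lebesgue_integral_def
      using S0 by (intro Bochner_Integration.integral_cong) (auto simp: indicator_def)
    also have "\<dots> = (LINT z|lborel. S (x + z) * \<rho> (x - (x + z)))"
      by (rule lborel_integral_shift[symmetric]) measurable
    also have "\<dots> = (LINT z|lborel. S (x + z) * \<rho> z)" by (simp add: \<rho>(3))
    finally show ?thesis .
  qed
  have avg: "V x - B \<le> A" if "\<And>z. norm z < \<eta> \<Longrightarrow> S (x + z) \<le> B + A" for x A B
  proof -
    have "V x \<le> (LINT z|lborel. (B + A) * \<rho> z)"
      unfolding V
    proof (rule integral_mono[OF int])
      show "integrable lborel (\<lambda>z. (B + A) * \<rho> z)" using \<rho>(5) by simp
      show "S (x + z) * \<rho> z \<le> (B + A) * \<rho> z" for z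
        using that[of z] \<rho>(2)[of z] \<rho>(4)[of z] by (cases "norm z < \<eta>") (auto intro: mult_right_mono)
    qed
    also have "\<dots> = B + A" using \<rho>(6) by simp
    finally show ?thesis by simp
  qed
  have V0: "V x = 0" if x: "r + 1 \<le> norm x" for x
  proof -
    have "S (x + z) * \<rho> z = 0" for z
    proof (cases "norm z < \<eta>")
      case True
      then have "r \<le> norm (x + z)" using norm_triangle_ineq4[of "x + z" z] x \<eta> by simp
      then show ?thesis using supp by simp
    qed (use \<rho>(4) in simp)
    then have "(\<lambda>z. S (x + z) * \<rho> z) = (\<lambda>z. 0)" by (rule ext)
    then show ?thesis by (simp only: V Bochner_Integration.integral_zero)
  qed
  show ?thesis
  proof (rule that[OF smV])
    show "V x = 0" if "r + 1 \<le> norm x" for x using V0 that .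
    show "\<bar>V x - S x\<bar> \<le> e" for x
    proof -
      have *: "\<bar>S (x + z) - S x\<bar> * \<rho> z \<le> e * \<rho> z" for z
      proof (cases "norm z < \<eta>")
        case True
        have "\<bar>S (x + z) - S x\<bar> \<le> \<Lambda> * norm z" using lip'[of "x + z" x] True \<eta> by simp
        also have "\<dots> \<le> \<Lambda> * \<eta>" using True \<Lambda> by (intro mult_left_mono) auto
        finally show ?thesis using \<eta>e(1) \<rho>(2) by (intro mult_right_mono) auto
      qed (use \<rho>(4) in simp)
      have "V x - S x = (LINT z|lborel. S (x + z) * \<rho> z - S x * \<rho> z)"
        using int \<rho>(5,6) by (simp add: V)
      also have "\<bar>\<dots>\<bar> \<le> (LINT z|lborel. e * \<rho> z)"
        using \<rho>(5) by (intro integral_abs_bound_integral Bochner_Integration.integrable_diff int integrable_mult_right)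
          (use * \<rho>(2) in \<open>auto simp: abs_mult left_diff_distrib[symmetric]\<close>)
      finally show ?thesis using \<rho>(6) by simp
    qed
    show "\<forall>x. grad V x \<bullet> v x \<le> K + e" if vV: "v \<in> \<V>" for v
    proof
      fix x
      \<comment> \<open>Keeps the two points compared below within distance 1, the range in which
        the Lipschitz bound for \<open>S\<close> is available.\<close>
      define t2 where "t2 = min t1 (1 / (L + 1))"
      have t2: "0 < t2" "t2 \<le> t1" "L * t2 \<le> 1"
      proof -
        show "0 < t2" "t2 \<le> t1" using t1 L by (auto simp: t2_def)
        have "t2 \<le> 1 / (L + 1)" by (simp add: t2_def)
        then have "t2 * (L + 1) \<le> 1" using L by (subst (asm) pos_le_divide_eq) auto
        then show "L * t2 \<le> 1" using \<open>0 < t2\<close> by (simp add: algebra_simps)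
      qed
      have quot: "(V (x + t *\<^sub>R v x) - V x) / t \<le> K + e + D * t" if t: "0 < t" "t \<le> t2" for t
      proof -
        have pt: "S (x + t *\<^sub>R v x + z) - S (x + z) \<le> K * t + D * t\<^sup>2 + e * t" if z: "norm z < \<eta>" for z
        proof -
          have n: "norm (v x - v (x + z)) \<le> L * norm z"
            using lipschitz_onD[OF v[OF vV], of x "x + z"] by (simp add: dist_norm)
          have "norm (t *\<^sub>R (v x - v (x + z))) \<le> t * (L * norm z)"
            using n t by (simp add: mult_left_mono)
          also have "\<dots> \<le> t * (L * \<eta>)" using z t L by (intro mult_left_mono) auto
          finally have d: "norm (t *\<^sub>R (v x - v (x + z))) \<le> t * (L * \<eta>)" .
          also have "\<dots> \<le> t2 * (L * 1)" using t L \<eta> by (intro mult_mono) auto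
          finally have d1: "norm (t *\<^sub>R (v x - v (x + z))) \<le> 1" using t2(3) by (simp add: mult.commute)
          have "S (x + t *\<^sub>R v x + z) - S (x + z + t *\<^sub>R v (x + z)) \<le> \<Lambda> * norm (t *\<^sub>R (v x - v (x + z)))"
            using lip[of "x + t *\<^sub>R v x + z" "x + z + t *\<^sub>R v (x + z)"] d1 by (simp add: algebra_simps)
          also have "\<dots> \<le> \<Lambda> * (t * (L * \<eta>))" using d \<Lambda> by (intro mult_left_mono)
          also have "\<dots> = t * (\<Lambda> * L * \<eta>)" by simp
          also have "\<dots> \<le> t * e" using \<eta>e(2) t by (intro mult_left_mono) auto
          finally show ?thesis
            using dir[OF vV, rule_format, of t "x + z"] t t2 by (simp add: mult.commute)
        qed
        have "V (x + t *\<^sub>R v x) - V x = (LINT z|lborel. S (x + t *\<^sub>R v x + z) * \<rho> z - S (x + z) * \<rho> z)"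
          using int by (simp add: V)
        also have "\<dots> \<le> (LINT z|lborel. (K * t + D * t\<^sup>2 + e * t) * \<rho> z)"
        proof (rule integral_mono)
          show "integrable lborel (\<lambda>z. S (x + t *\<^sub>R v x + z) * \<rho> z - S (x + z) * \<rho> z)"
            by (intro Bochner_Integration.integrable_diff int)
          show "integrable lborel (\<lambda>z. (K * t + D * t\<^sup>2 + e * t) * \<rho> z)" using \<rho>(5) by simp
          show "S (x + t *\<^sub>R v x + z) * \<rho> z - S (x + z) * \<rho> z \<le> (K * t + D * t\<^sup>2 + e * t) * \<rho> z" for z
            using pt[of z] \<rho>(2)[of z] \<rho>(4)[of z] unfolding left_diff_distrib[symmetric]
            by (cases "norm z < \<eta>") (auto intro: mult_right_mono)
        qed
        also have "\<dots> = K * t + D * t\<^sup>2 + e * t" using \<rho>(6) by simp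
        also have "\<dots> = (K + e + D * t) * t" by (simp add: algebra_simps power2_eq_square)
        finally show ?thesis using t by (simp add: pos_divide_le_eq)
      qed
      have "((\<lambda>t. x + t *\<^sub>R v x) has_derivative (\<lambda>t. t *\<^sub>R v x)) (at (0::real))"
        by (auto intro!: derivative_eq_intros)
      from diff_chain_at[OF this, of V "\<lambda>h. grad V x \<bullet> h"]
      have "((\<lambda>t. V (x + t *\<^sub>R v x)) has_real_derivative grad V x \<bullet> v x) (at 0)"
        using has_derivative_grad[OF C_infty_differentiable[OF smV], of x]
        by (simp add: o_def has_field_derivative_def mult_commute_abs)
      then have lim: "((\<lambda>t. (V (x + t *\<^sub>R v x) - V x) / t) \<longlongrightarrow> grad V x \<bullet> v x) (at_right 0)"
        by (simp add: DERIV_def filterlim_at_split)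
      have lim': "((\<lambda>t. K + e + D * t) \<longlongrightarrow> K + e + D * 0) (at_right 0)"
        by (intro tendsto_intros)
      have ev: "\<forall>\<^sub>F t in at_right 0. (V (x + t *\<^sub>R v x) - V x) / t \<le> K + e + D * t"
        unfolding eventually_at_right_field using quot t2(1) by (intro exI[of _ t2]) auto
      show "grad V x \<bullet> v x \<le> K + e"
        using tendsto_le[OF _ lim' lim ev] by simp
    qed
  qed
qed

text \<open>The truncated distance \<open>P\<close> is 1-Lipschitz for \<open>cc_dist\<close>, and
  following a field for time t costs at most t, so \<open>P\<close> drops at most at unit rate along
  the fields and both regularisations apply. The family \<open>\<V>\<close> contains each field with
  both signs, which turns one-sided bounds into bounds on the absolute value.\<close>

lemma cc_cutoff:
  fixes b :: "real^'n \<Rightarrow> real^'n^'m"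
  assumes b: "locally_lipschitz_fields b" and cc: "cc_space b Q" and R: "0 < R"
  obtains V where "V \<in> C_infty" "\<And>x. \<bar>V x - max 0 (3 * R - cc_dist b x0 x)\<bar> \<le> R / 2"
    "\<And>x j. \<bar>X_classical b V x $ j\<bar> \<le> 2"
proof -
  define P where "P x = max 0 (3 * R - cc_dist b x0 x)" for x
  note d = cc_dist_metric[OF cc]
  have contP: "continuous_on UNIV P"
    unfolding P_def by (intro continuous_intros continuous_on_cc_dist[OF cc])
  have PH: "0 \<le> P x" "P x \<le> 3 * R" for x using d(1)[of x0 x] R by (auto simp: P_def)
  have Pd: "P x - cc_dist b x y \<le> P y" for x y
    using d(4)[of x0 y x] d(1)[of x y] d(2)[of x y] by (auto simp: P_def)
  obtain r where r: "0 < r" "\<And>x. r < norm x \<Longrightarrow> P x = 0"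
  proof -
    obtain r where "0 < r" "\<forall>x\<in>cc_cball b x0 (3 * R). norm x \<le> r"
      using compact_imp_bounded[OF compact_cc_cball[OF b cc]] unfolding bounded_pos by blast
    note r = this
    show ?thesis
    proof (rule that[OF r(1)])
      fix x :: "real^'n" assume "r < norm x"
      then have "x \<notin> cc_cball b x0 (3 * R)" using r(2) by force
      then show "P x = 0" by (simp add: P_def cc_cball_def)
    qed
  qed
  have ucP: "uniformly_continuous_on UNIV P"
  proof -
    have uc: "uniformly_continuous_on (cball 0 (r + 1)) P"
      by (intro compact_uniformly_continuous continuous_on_subset[OF contP]) auto
    show ?thesis
      unfolding uniformly_continuous_on_def
    proof (intro allI impI)
      fix e :: real assume "0 < e"
      then obtain \<delta> where \<delta>: "\<delta> > 0" "\<And>x y. x \<in> cball 0 (r + 1) \<Longrightarrow> y \<in> cball 0 (r + 1) \<Longrightarrow> dist y x < \<delta> \<Longrightarrow> dist (P y) (P x) < e"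
        using uc unfolding uniformly_continuous_on_def by metis
      have "dist (P y) (P x) < e" if xy: "dist y x < min \<delta> 1" for x y
      proof (cases "norm x \<le> r \<or> norm y \<le> r")
        case True
        then have "norm x \<le> r + 1" "norm y \<le> r + 1"
          using norm_triangle_sub[of x y] norm_triangle_sub[of y x] xy
          by (auto simp: dist_norm norm_minus_commute)
        then show ?thesis using \<delta>(2)[of x y] xy by simp
      next
        case False
        then show ?thesis using r(2)[of x] r(2)[of y] \<open>0 < e\<close> by simp
      qed
      then show "\<exists>d>0. \<forall>x\<in>UNIV. \<forall>y\<in>UNIV. dist y x < d \<longrightarrow> dist (P y) (P x) < e"
        using \<delta>(1) by (intro exI[of _ "min \<delta> 1"]) auto
    qed
  qed
  \<comment> \<open>\<open>P\<close>, \<open>S\<close> and \<open>V\<close> vanish outside the balls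
    of radius r, r + 1 and r + 2, so truncating the fields at r + 3 loses nothing.\<close>
  have r2: "0 < r + 3" using r by simp
  obtain L M where LM: "0 \<le> L" "0 \<le> M" "\<And>j. L-lipschitz_on UNIV (\<lambda>x. trunc_fields (r + 3) b x $ j)"
    "\<And>x j. norm (trunc_fields (r + 3) b x $ j) \<le> M"
    using trunc_fields_lipschitz[OF b r2] by metis
  obtain C \<tau> where C: "0 \<le> C" "0 < \<tau>"
    "\<And>y t j \<sigma>. norm y \<le> r + 3 \<Longrightarrow> 0 \<le> t \<Longrightarrow> t \<le> \<tau> \<Longrightarrow> \<bar>\<sigma>\<bar> = 1 \<Longrightarrow>
       \<exists>z. cc_dist b y z \<le> t \<and> norm (z - (y + (t * \<sigma>) *\<^sub>R (b y $ j))) \<le> C * t\<^sup>2"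
    using short_subunit_curves[OF b r2] by metis
  define \<V> where "\<V> = {\<lambda>x. \<sigma> *\<^sub>R trunc_fields (r + 3) b x $ j | \<sigma> j. \<bar>\<sigma>\<bar> = 1}"
  have vL: "L-lipschitz_on UNIV v" if v: "v \<in> \<V>" for v
  proof -
    obtain \<sigma> j where "v = (\<lambda>x. \<sigma> *\<^sub>R trunc_fields (r + 3) b x $ j)" "\<bar>\<sigma>\<bar> = 1"
      using v unfolding \<V>_def by blast
    then show ?thesis using lipschitz_on_cmult[OF LM(3)[of j], of \<sigma>] by simp
  qed
  have vM: "\<forall>x. norm (v x) \<le> M" if "v \<in> \<V>" for v
    using that LM(4) by (auto simp: \<V>_def)
  have step1: "\<exists>z. P y - t \<le> P z \<and> norm (z - (y - t *\<^sub>R v y)) \<le> C * t\<^sup>2"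
    if v: "v \<in> \<V>" and t: "0 \<le> t" "t \<le> \<tau>" for v y t
  proof (cases "norm y \<le> r + 3")
    case True
    obtain \<sigma> j where vj: "v = (\<lambda>x. \<sigma> *\<^sub>R trunc_fields (r + 3) b x $ j)" "\<bar>\<sigma>\<bar> = 1"
      using v unfolding \<V>_def by blast
    obtain z where z: "cc_dist b y z \<le> t" "norm (z - (y + (t * (- \<sigma>)) *\<^sub>R (b y $ j))) \<le> C * t\<^sup>2"
      using C(3)[OF True t, of "- \<sigma>" j] vj(2) by auto
    have "P y - t \<le> P z" using Pd[of y z] z(1) by linarith
    then show ?thesis using z(2) by (intro exI[of _ z]) (simp add: vj(1) trunc_fields_eq[OF True])
  next
    case False
    then have "P y = 0" using r by simp
    then show ?thesis using PH(1)[of "y - t *\<^sub>R v y"] t C(1) by (intro exI[of _ "y - t *\<^sub>R v y"]) auto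
  qed
  have step: "\<forall>y. \<forall>t\<in>{0..\<tau>}. \<exists>z. P y - t \<le> P z \<and> norm (z - (y - t *\<^sub>R v y)) \<le> C * t\<^sup>2"
    if v: "v \<in> \<V>" for v
    using step1[OF v] by simp
  have R4: "0 < R / 4" using R by simp
  obtain S \<Lambda> D t1 where S: "0 \<le> \<Lambda>" "\<And>x y. norm (x - y) \<le> 1 \<Longrightarrow> S x - S y \<le> \<Lambda> * norm (x - y)"
    "\<And>x. \<bar>S x - P x\<bar> \<le> R / 4" "\<And>x. r + 1 \<le> norm x \<Longrightarrow> S x = 0"
    "0 < t1" "\<And>v. v \<in> \<V> \<Longrightarrow> \<forall>x. \<forall>t\<in>{0<..t1}. S (x + t *\<^sub>R v x) - S x \<le> (5/4) * t + D * t\<^sup>2"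
  proof (rule sup_convolution[where P = P and H = "3 * R" and r = r and \<V> = \<V> and L = L and M = M
        and C = C and \<tau> = \<tau> and e = "R / 4", OF ucP PH r(2) vL vM LM(1,2) C(1,2) step R4])
    fix S \<Lambda> D t1
    assume 1: "0 \<le> \<Lambda>" "\<And>x y. norm (x - y) \<le> 1 \<Longrightarrow> S x - S y \<le> \<Lambda> * norm (x - y)"
    "\<And>x. \<bar>S x - P x\<bar> \<le> R / 4" "\<And>x. r + 1 \<le> norm x \<Longrightarrow> S x = 0"
    "0 < t1" "\<And>v. v \<in> \<V> \<Longrightarrow> \<forall>x. \<forall>t\<in>{0<..t1}. S (x + t *\<^sub>R v x) - S x \<le> (5/4) * t + D * t\<^sup>2"
    show thesis by (rule that[OF 1])
  qed
  \<comment> \<open>The first entry completes the error to R / 2, the second completes the rate 5 /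
    4 to 2.\<close>
  have m: "0 < min (R / 4) (3 / 4)" using R by simp
  obtain V where V: "V \<in> C_infty" "\<And>x. \<bar>V x - S x\<bar> \<le> min (R / 4) (3 / 4)" "\<And>x. r + 1 + 1 \<le> norm x \<Longrightarrow> V x = 0"
    "\<And>v. v \<in> \<V> \<Longrightarrow> \<forall>x. grad V x \<bullet> v x \<le> 5 / 4 + min (R / 4) (3 / 4)"
  proof (rule mollify_along_fields[where S = S and \<Lambda> = \<Lambda> and r = "r + 1" and \<V> = \<V> and L = L and ?t1.0 = t1
        and K = "5 / 4" and D = D and e = "min (R / 4) (3 / 4)", OF S(1,2,4) LM(1) vL S(5,6) m])
    fix V
    assume 1: "V \<in> C_infty" "\<And>x. \<bar>V x - S x\<bar> \<le> min (R / 4) (3 / 4)" "\<And>x. r + 1 + 1 \<le> norm x \<Longrightarrow> V x = 0"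
      "\<And>v. v \<in> \<V> \<Longrightarrow> \<forall>x. grad V x \<bullet> v x \<le> 5 / 4 + min (R / 4) (3 / 4)"
    show thesis by (rule that[OF 1])
  qed
  show ?thesis
  proof (rule that[OF V(1)])
    show "\<bar>V x - max 0 (3 * R - cc_dist b x0 x)\<bar> \<le> R / 2" for x
    proof -
      have "\<bar>V x - P x\<bar> \<le> \<bar>V x - S x\<bar> + \<bar>S x - P x\<bar>" by linarith
      also have "\<dots> \<le> R / 4 + R / 4" using V(2)[of x] S(3)[of x] by (intro add_mono) auto
      finally show ?thesis by (simp add: P_def)
    qed
    show "\<bar>X_classical b V x $ j\<bar> \<le> 2" for x j
    proof (cases "norm x \<le> r + 3")
      case True
      have "grad V x \<bullet> (\<sigma> *\<^sub>R b x $ j) \<le> 2" if "\<bar>\<sigma>\<bar> = 1" for \<sigma>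
      proof -
        have "(\<lambda>x. \<sigma> *\<^sub>R trunc_fields (r + 3) b x $ j) \<in> \<V>" using that unfolding \<V>_def by blast
        from V(4)[OF this, rule_format, of x] show ?thesis by (simp add: trunc_fields_eq[OF True])
      qed
      from this[of 1] this[of "- 1"] show ?thesis by (simp add: X_classical_eq_inner)
    next
      case False
      have "partial k V x = 0" for k
        by (rule partial_outside_support[of "cball 0 (r + 2)"]) (use V(3) False in auto)
      then show ?thesis by (simp add: X_classical_def)
    qed
  qed
qed

section \<open>Convergence in mean\<close>

lemma powr_sum3_le:
  fixes x y z p :: real
  assumes "0 \<le> x" "0 \<le> y" "0 \<le> z" "0 \<le> p"
  shows "(x + y + z) powr p \<le> 3 powr p * (x powr p + y powr p + z powr p)"
proof -
  define m where "m = max x (max y z)"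
  have "(x + y + z) powr p \<le> (3 * m) powr p"
    using assms by (intro powr_mono2) (auto simp: m_def)
  also have "\<dots> = 3 powr p * m powr p" using assms by (simp add: powr_mult m_def)
  also have "m powr p \<le> x powr p + y powr p + z powr p"
    by (auto simp: m_def max_def)
  finally show ?thesis by (simp add: mult_left_mono)
qed

text \<open>Either t is at most \<delta>, or t^(1 - p) is at most \<delta>^(1 - p). On a finite
  measure space this takes the place of Hoelder's inequality: after integration the first term is
  small with \<delta>, and for fixed \<delta> the second one tends to 0 with the p-th mean.\<close>

lemma le_powr_bound:
  fixes t p \<delta> :: real
  assumes "0 \<le> t" "1 \<le> p" "0 < \<delta>"
  shows "t \<le> \<delta> + \<delta> powr (1 - p) * t powr p"
proof (cases "t \<le> \<delta>")
  case True
  then show ?thesis by (simp add: add_increasing2)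
next
  case False
  then have "t = t powr (1 - p) * t powr p" using assms by (simp add: powr_add[symmetric])
  also have "\<dots> \<le> \<delta> powr (1 - p) * t powr p"
    using False assms by (intro mult_right_mono powr_mono2') auto
  finally show ?thesis using assms by simp
qed

lemma (in finite_measure) Lp_integrable:
  fixes f :: "'a \<Rightarrow> real"
  assumes p: "1 \<le> p" and f: "f \<in> borel_measurable M" "\<And>x. 0 \<le> f x" and int: "integrable M (\<lambda>x. f x powr p)"
  shows "integrable M f"
    and "0 < \<delta> \<Longrightarrow> (LINT x|M. f x) \<le> \<delta> * measure M (space M) + \<delta> powr (1 - p) * (LINT x|M. f x powr p)"
proof -
  have bd: "integrable M (\<lambda>x. \<delta> + \<delta> powr (1 - p) * f x powr p)" for \<delta>
    using int by (intro Bochner_Integration.integrable_add) auto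
  show i: "integrable M f"
    by (rule Bochner_Integration.integrable_bound[OF bd[of 1] f(1)])
      (use le_powr_bound[OF f(2) p, of 1] f(2) in auto)
  assume \<delta>: "0 < \<delta>"
  have "(LINT x|M. f x) \<le> (LINT x|M. \<delta> + \<delta> powr (1 - p) * f x powr p)"
    using i bd le_powr_bound[OF f(2) p \<delta>] by (intro integral_mono) auto
  also have "\<dots> = \<delta> * measure M (space M) + \<delta> powr (1 - p) * (LINT x|M. f x powr p)"
    using int by (simp add: mult.commute)
  finally show "(LINT x|M. f x) \<le> \<delta> * measure M (space M) + \<delta> powr (1 - p) * (LINT x|M. f x powr p)" .
qed

lemma (in finite_measure) Lp_tendsto_L1:
  fixes f :: "nat \<Rightarrow> 'a \<Rightarrow> real"
  assumes p: "1 \<le> p" and f: "\<And>n. f n \<in> borel_measurable M" "\<And>n x. 0 \<le> f n x"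
    and int: "\<And>n. integrable M (\<lambda>x. f n x powr p)" and lim: "(\<lambda>n. LINT x|M. f n x powr p) \<longlonglongrightarrow> 0"
  shows "(\<lambda>n. LINT x|M. f n x) \<longlonglongrightarrow> 0"
proof (rule LIMSEQ_I)
  fix e :: real assume "0 < e"
  define m where "m = measure M (space M)"
  define \<delta> where "\<delta> = e / (2 * (m + 1))"
  have m: "0 \<le> m" by (simp add: m_def)
  then have \<delta>: "0 < \<delta>" "\<delta> * m < e / 2"
    using \<open>0 < e\<close> by (auto simp: \<delta>_def field_simps)
  have "(\<lambda>n. \<delta> powr (1 - p) * (LINT x|M. f n x powr p)) \<longlonglongrightarrow> \<delta> powr (1 - p) * 0"
    by (intro tendsto_mult_left lim)
  then have "\<forall>\<^sub>F n in sequentially. \<delta> powr (1 - p) * (LINT x|M. f n x powr p) < e / 2"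
    using \<open>0 < e\<close> by (intro order_tendstoD(2)) auto
  then obtain n0 where n0: "\<And>n. n \<ge> n0 \<Longrightarrow> \<delta> powr (1 - p) * (LINT x|M. f n x powr p) < e / 2"
    by (auto simp: eventually_sequentially)
  have "norm ((LINT x|M. f n x) - 0) < e" if "n \<ge> n0" for n
  proof -
    have "0 \<le> (LINT x|M. f n x)" using f(2) by (intro Bochner_Integration.integral_nonneg)
    moreover have "(LINT x|M. f n x) \<le> \<delta> * m + \<delta> powr (1 - p) * (LINT x|M. f n x powr p)"
      unfolding m_def by (rule Lp_integrable(2)[OF p f(1) f(2) int \<delta>(1)])
    ultimately show ?thesis using n0[OF that] \<delta>(2) by simp
  qed
  then show "\<exists>no. \<forall>n\<ge>no. norm ((LINT x|M. f n x) - 0) < e" by blast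
qed

lemma tendsto_integral_mult_bounded:
  fixes f :: "nat \<Rightarrow> 'a \<Rightarrow> real"
  assumes f: "\<And>n. integrable M (f n)" "integrable M g" and lim: "(\<lambda>n. LINT x|M. \<bar>f n x - g x\<bar>) \<longlonglongrightarrow> 0"
    and w: "w \<in> borel_measurable M" "AE x in M. \<bar>w x\<bar> \<le> C"
  shows "(\<lambda>n. LINT x|M. f n x * w x) \<longlonglongrightarrow> (LINT x|M. g x * w x)"
proof -
  have i: "integrable M (\<lambda>x. h x * w x)" if h: "integrable M h" for h
  proof (rule Bochner_Integration.integrable_bound[of M "\<lambda>x. C * h x"])
    show "AE x in M. norm (h x * w x) \<le> norm (C * h x)"
      using w(2)
    proof eventually_elim
      case (elim x)
      then have "\<bar>w x\<bar> * \<bar>h x\<bar> \<le> \<bar>C\<bar> * \<bar>h x\<bar>" by (intro mult_right_mono) auto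
      then show ?case by (simp add: abs_mult mult.commute)
    qed
  qed (use h w in auto)
  have "(\<lambda>n. (LINT x|M. f n x * w x) - (LINT x|M. g x * w x)) \<longlonglongrightarrow> 0"
  proof (rule Lim_null_comparison)
    show "\<forall>\<^sub>F n in sequentially. norm ((LINT x|M. f n x * w x) - (LINT x|M. g x * w x)) \<le> C * (LINT x|M. \<bar>f n x - g x\<bar>)"
    proof (rule always_eventually, rule allI)
      fix n
      have "(LINT x|M. f n x * w x) - (LINT x|M. g x * w x) = (LINT x|M. (f n x - g x) * w x)"
        using i[OF f(1)[of n]] i[OF f(2)] by (simp add: left_diff_distrib)
      also have "norm \<dots> \<le> (LINT x|M. norm ((f n x - g x) * w x))" by (rule integral_norm_bound)
      also have "\<dots> \<le> (LINT x|M. C * \<bar>f n x - g x\<bar>)"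
      proof (rule integral_mono_AE)
        show "integrable M (\<lambda>x. norm ((f n x - g x) * w x))" using f by (intro integrable_norm i) auto
        show "integrable M (\<lambda>x. C * \<bar>f n x - g x\<bar>)" using f by auto
        show "AE x in M. norm ((f n x - g x) * w x) \<le> C * \<bar>f n x - g x\<bar>"
          using w(2)
        proof eventually_elim
          case (elim x)
          then have "\<bar>w x\<bar> * \<bar>f n x - g x\<bar> \<le> C * \<bar>f n x - g x\<bar>" by (intro mult_right_mono) auto
          then show ?case by (simp add: abs_mult mult.commute)
        qed
      qed
      finally show "norm ((LINT x|M. f n x * w x) - (LINT x|M. g x * w x)) \<le> C * (LINT x|M. \<bar>f n x - g x\<bar>)"
        by simp
    qed
    show "(\<lambda>n. C * (LINT x|M. \<bar>f n x - g x\<bar>)) \<longlonglongrightarrow> 0"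
      using tendsto_mult_left[OF lim, of C] by simp
  qed
  then show ?thesis by (rule LIM_zero_cancel)
qed

section \<open>Test functions\<close>

lemma X_classical_compose_mult:
  assumes "(g has_real_derivative g') (at (h x))" "h differentiable at x" "\<psi> differentiable at x"
  shows "X_classical b (\<lambda>x. g (h x) * \<psi> x) x = (g' * \<psi> x) *\<^sub>R X_classical b h x + g (h x) *\<^sub>R X_classical b \<psi> x"
proof -
  have "(\<lambda>x. g (h x)) differentiable at x"
    using differentiable_chain_at[OF assms(2), of g] assms(1)
    by (auto simp: o_def real_differentiable_def)
  then have "partial k (\<lambda>x. g (h x) * \<psi> x) x = g (h x) * partial k \<psi> x + g' * partial k h x * \<psi> x" for k
    using partial_mult[OF _ assms(3), of "\<lambda>x. g (h x)"] partial_compose[OF assms(1,2)] by simp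
  then show ?thesis
    by (simp add: vec_eq_iff X_classical_def sum_distrib_left sum.distrib algebra_simps)
qed

lemma continuous_on_X_classical:
  assumes "locally_lipschitz_fields b" "h \<in> C_infty"
  shows "continuous_on A (X_classical b h)"
  unfolding X_classical_def
  by (intro continuous_on_vec_lambda continuous_on_sum continuous_on_mult continuous_on_component
      continuous_on_fields[OF assms(1)] C_infty_continuous_on C_infty_partial assms(2))

text \<open>For smooth approximations h of \<open>u\<close> the functions g(h) \<psi> lie in
  \<open>C0_infty \<Omega>\<close>, and their classical gradients converge to \<open>\<Phi>\<close>
  in the p-th mean. The delicate term is g'(h) - g'(u) times \<open>U\<close>: since g' is only
  bounded and continuous, it requires pointwise and dominated convergence. The distributional
  identity then passes to the limit.\<close>

lemma composite_test_function:
  fixes b :: "real^'n \<Rightarrow> real^'n^'m" and u :: "real^'n \<Rightarrow> real"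
  assumes b: "locally_lipschitz_fields b" and p: "1 \<le> p" and \<Omega>: "open \<Omega>" "bounded \<Omega>"
    and u: "X_distr b \<Omega> u U" "set_borel_measurable lebesgue \<Omega> u" "set_borel_measurable lebesgue \<Omega> U"
      "set_integrable lebesgue \<Omega> (X_energy p u U)"
      "\<And>\<epsilon>. 0 < \<epsilon> \<Longrightarrow> \<exists>h\<in>C_infty. X_norm p \<Omega> (\<lambda>x. h x - u x) (\<lambda>x. X_classical b h x - U x) < \<epsilon>"
    and g: "smooth1 g" "\<And>t. (g has_real_derivative g' t) (at t)" "continuous_on UNIV g'"
      "\<And>t. \<bar>g' t\<bar> \<le> K" "g 0 = 0"
    and \<psi>: "\<psi> \<in> C0_infty \<Omega>"
  defines "\<phi> \<equiv> \<lambda>x. g (u x) * \<psi> x"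
    and "\<Phi> \<equiv> \<lambda>x. (g' (u x) * \<psi> x) *\<^sub>R U x + g (u x) *\<^sub>R X_classical b \<psi> x"
  shows "\<phi> \<in> L1p_0 b p \<Omega>" "X_distr b \<Omega> \<phi> \<Phi>"
proof -
  \<comment> \<open>On the restricted measure set integrals become ordinary ones, and its finiteness
    lets convergence in the p-th mean imply convergence in mean.\<close>
  define N where "N = lebesgue_on \<Omega>"
  have \<Omega>m: "\<Omega> \<in> sets lebesgue" "\<Omega> \<inter> space lebesgue \<in> sets lebesgue" using \<Omega>(1) by auto
  have "\<Omega> \<in> lmeasurable" using \<Omega> by (intro bounded_set_imp_lmeasurable) auto
  then interpret N: finite_measure N
    unfolding N_def by (rule finite_measure_lebesgue_on)
  have spN: "space N = \<Omega>" by (simp add: N_def)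
  have intN: "set_integrable lebesgue \<Omega> f \<longleftrightarrow> integrable N f" for f :: "real^'n \<Rightarrow> 'z::{banach, second_countable_topology}"
    unfolding N_def set_integrable_def using \<Omega>m by (simp add: integrable_restrict_space)
  have lintN: "(LINT x:\<Omega>|lebesgue. f x) = (LINT x|N. f x)" for f :: "real^'n \<Rightarrow> real"
    unfolding N_def set_lebesgue_integral_def using \<Omega>m by (simp add: integral_restrict_space)
  have measN: "set_borel_measurable lebesgue \<Omega> f \<longleftrightarrow> f \<in> borel_measurable N" for f :: "real^'n \<Rightarrow> 'z::real_normed_vector"
    unfolding N_def set_borel_measurable_def using \<Omega>m by (simp add: borel_measurable_restrict_space_iff)
  have uN [measurable]: "u \<in> borel_measurable N" "U \<in> borel_measurable N"
    using u(2,3) by (simp_all add: measN)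
  have contN: "f \<in> borel_measurable N" if "continuous_on UNIV f" for f :: "real^'n \<Rightarrow> 'z::{banach, second_countable_topology}"
    unfolding N_def using borel_measurable_continuous_onI[OF that]
    by (intro measurable_restrict_space1 measurable_completion) simp
  have sm\<psi>: "\<psi> \<in> C_infty" using \<psi> by (simp add: C0_infty_def)
  have K0: "0 \<le> K" using g(4)[of 0] by linarith
  have gL: "\<bar>g s - g t\<bar> \<le> K * \<bar>s - t\<bar>" for s t
    using field_differentiable_bound[of UNIV g g' K s t] g(2,4) by (auto simp: has_field_derivative_at_within)
  have g1: "\<bar>g t\<bar> \<le> K * \<bar>t\<bar>" for t using gL[of t 0] g(5) by simp
  have contg: "continuous_on UNIV g" using g(2) by (meson DERIV_isCont continuous_at_imp_continuous_on)
  have [measurable]: "g \<in> borel_measurable borel" "g' \<in> borel_measurable borel"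
    using contg g(3) by (auto intro: borel_measurable_continuous_onI)
  note contX = continuous_on_X_classical[OF b]
  have [measurable]: "\<psi> \<in> borel_measurable N" "X_classical b \<psi> \<in> borel_measurable N"
    by (intro contN C_infty_continuous_on[OF sm\<psi>] contX[OF sm\<psi>])+
  obtain B where B: "0 \<le> B" "\<And>x. \<bar>\<psi> x\<bar> \<le> B" "\<And>x. norm (X_classical b \<psi> x) \<le> B"
  proof -
    obtain K where K: "compact K" "\<And>x. x \<notin> K \<Longrightarrow> \<psi> x = 0" using \<psi> by (auto simp: C0_infty_def)
    have "bounded (\<psi> ` K)" "bounded (X_classical b \<psi> ` K)"
      by (intro compact_imp_bounded compact_continuous_image C_infty_continuous_on[OF sm\<psi>] contX[OF sm\<psi>] K(1))+
    then obtain B1 B2 where B1: "\<And>x. x \<in> K \<Longrightarrow> \<bar>\<psi> x\<bar> \<le> B1" and B2: "\<And>x. x \<in> K \<Longrightarrow> norm (X_classical b \<psi> x) \<le> B2"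
      by (auto simp: bounded_iff)
    have out: "X_classical b \<psi> x = 0" if "x \<notin> K" for x
      using partial_outside_support[OF compact_imp_closed[OF K(1)] K(2) that]
      by (simp add: X_classical_def vec_eq_iff)
    show ?thesis
    proof (rule that[of "max 0 (max B1 B2)"])
      fix x
      show "\<bar>\<psi> x\<bar> \<le> max 0 (max B1 B2)" using B1[of x] K(2)[of x] by (cases "x \<in> K") auto
      show "norm (X_classical b \<psi> x) \<le> max 0 (max B1 B2)" using B2[of x] out[of x] by (cases "x \<in> K") auto
    qed simp
  qed
  have bint: "integrable N (\<lambda>x. norm (f x) powr p)" if f: "continuous_on UNIV f" for f :: "real^'n \<Rightarrow> 'z::{banach, second_countable_topology}"
  proof -
    have "compact (f ` closure \<Omega>)"
      using \<Omega>(2) by (intro compact_continuous_image continuous_on_subset[OF f]) (auto simp: compact_closure)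
    then obtain D where D: "\<And>x. x \<in> closure \<Omega> \<Longrightarrow> norm (f x) \<le> D"
      using compact_imp_bounded by (force simp: bounded_iff)
    show ?thesis
    proof (rule N.integrable_const_bound[of _ "D powr p"])
      have "norm (norm (f x) powr p) \<le> D powr p" if "x \<in> \<Omega>" for x
        using D[of x] that closure_subset[of \<Omega>] p by (auto intro!: powr_mono2)
      then show "AE x in N. norm (norm (f x) powr p) \<le> D powr p" by (intro AE_I2) (simp add: spN)
      show "(\<lambda>x. norm (f x) powr p) \<in> borel_measurable N" using contN[OF f] by measurable
    qed
  qed
  have enN: "integrable N (\<lambda>x. norm (U x) powr p + \<bar>u x\<bar> powr p)"
    using u(4) unfolding intN X_energy_def[abs_def] .
  have Up: "integrable N (\<lambda>x. norm (U x) powr p)" and up: "integrable N (\<lambda>x. \<bar>u x\<bar> powr p)"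
    by (rule Bochner_Integration.integrable_bound[OF enN]; auto)+
  let ?e = "\<lambda>h x. norm (X_classical b h x - U x) powr p + \<bar>h x - u x\<bar> powr p"
  have ei: "integrable N (?e h)" if h: "h \<in> C_infty" for h
  proof (rule Bochner_Integration.integrable_bound)
    show "integrable N (\<lambda>x. 3 powr p * (norm (X_classical b h x) powr p + norm (U x) powr p + 0 powr p)
        + 3 powr p * (\<bar>h x\<bar> powr p + \<bar>u x\<bar> powr p + 0 powr p))"
      using bint[OF contX[OF h]] bint[OF C_infty_continuous_on[OF h]] Up up by auto
    have [measurable]: "h \<in> borel_measurable N" "X_classical b h \<in> borel_measurable N"
      by (intro contN C_infty_continuous_on[OF h] contX[OF h])+
    show "?e h \<in> borel_measurable N" by measurable
    have "norm (?e h x) \<le> norm (3 powr p * (norm (X_classical b h x) powr p + norm (U x) powr p + 0 powr p)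
        + 3 powr p * (\<bar>h x\<bar> powr p + \<bar>u x\<bar> powr p + 0 powr p))" for x
    proof -
      have "norm (X_classical b h x - U x) powr p \<le> (norm (X_classical b h x) + norm (U x) + 0) powr p"
        using p by (intro powr_mono2) (auto simp: norm_triangle_ineq4)
      also have "\<dots> \<le> 3 powr p * (norm (X_classical b h x) powr p + norm (U x) powr p + 0 powr p)"
        using p by (intro powr_sum3_le) auto
      finally have 1: "norm (X_classical b h x - U x) powr p \<le> 3 powr p * (norm (X_classical b h x) powr p + norm (U x) powr p + 0 powr p)" .
      have "\<bar>h x - u x\<bar> powr p \<le> (\<bar>h x\<bar> + \<bar>u x\<bar> + 0) powr p"
        using p by (intro powr_mono2) auto
      also have "\<dots> \<le> 3 powr p * (\<bar>h x\<bar> powr p + \<bar>u x\<bar> powr p + 0 powr p)"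
        using p by (intro powr_sum3_le) auto
      finally have 2: "\<bar>h x - u x\<bar> powr p \<le> 3 powr p * (\<bar>h x\<bar> powr p + \<bar>u x\<bar> powr p + 0 powr p)" .
      have "0 \<le> ?e h x" by simp
      then show ?thesis
        unfolding real_norm_def abs_of_nonneg[OF \<open>0 \<le> ?e h x\<close>]
        by (intro order_trans[OF add_mono[OF 1 2] abs_ge_self])
    qed
    then show "AE x in N. norm (?e h x) \<le> norm (3 powr p * (norm (X_classical b h x) powr p + norm (U x) powr p + 0 powr p)
        + 3 powr p * (\<bar>h x\<bar> powr p + \<bar>u x\<bar> powr p + 0 powr p))" by (rule AE_I2)
  qed
  have "\<exists>h\<in>C_infty. (LINT x|N. ?e h x) < 1 / Suc n" for n
  proof -
    obtain h where h: "h \<in> C_infty" "X_norm p \<Omega> (\<lambda>x. h x - u x) (\<lambda>x. X_classical b h x - U x) < (1 / Suc n) powr (1 / p)"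
      using u(5)[of "(1 / Suc n) powr (1 / p)"] by auto
    then have "(LINT x|N. ?e h x) powr (1 / p) < (1 / Suc n) powr (1 / p)"
      by (simp add: X_norm_def lintN X_energy_def)
    then have "(LINT x|N. ?e h x) < 1 / Suc n"
      using powr_mono2[of "1 / p" "1 / Suc n" "LINT x|N. ?e h x"] p by (meson divide_nonneg_nonneg leI le_less_trans less_irrefl of_nat_0_le_iff zero_le_one order_trans)
    then show ?thesis using h(1) by blast
  qed
  then have "\<forall>n. \<exists>h. h \<in> C_infty \<and> (LINT x|N. ?e h x) < 1 / Suc n" by blast
  from choice[OF this] obtain h where "\<forall>n. h n \<in> C_infty \<and> (LINT x|N. ?e (h n) x) < 1 / Suc n" ..
  then have h: "h n \<in> C_infty" "(LINT x|N. ?e (h n) x) < 1 / Suc n" for n by blast+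
  have e0: "0 \<le> ?e (h n) x" for n x by simp
  have elim: "(\<lambda>n. LINT x|N. norm (?e (h n) x)) \<longlonglongrightarrow> 0"
  proof (rule tendsto_sandwich[of "\<lambda>_. 0" _ _ "\<lambda>n. 1 / Suc n"])
    show "(\<lambda>n. 1 / real (Suc n)) \<longlonglongrightarrow> 0" using LIMSEQ_inverse_real_of_nat by (simp add: inverse_eq_divide)
    show "\<forall>\<^sub>F n in sequentially. (LINT x|N. norm (?e (h n) x)) \<le> 1 / Suc n"
      using h(2) by (auto intro!: always_eventually less_imp_le)
    show "\<forall>\<^sub>F n in sequentially. 0 \<le> (LINT x|N. norm (?e (h n) x))"
      by (intro always_eventually allI Bochner_Integration.integral_nonneg) auto
  qed auto
  \<comment> \<open>Convergence of the energies gives pointwise convergence to \<open>u\<close> only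
    along a subsequence.\<close>
  obtain r where r: "strict_mono r" "AE x in N. (\<lambda>n. ?e (h (r n)) x) \<longlonglongrightarrow> 0"
    using tendsto_L1_AE_subseq[of N "\<lambda>n. ?e (h n)", OF ei[OF h(1)] elim] by blast
  define H where "H n = h (r n)" for n
  have H: "H n \<in> C_infty" for n by (simp add: H_def h)
  have [measurable]: "H n \<in> borel_measurable N" "X_classical b (H n) \<in> borel_measurable N" for n
    by (intro contN C_infty_continuous_on[OF H] contX[OF H])+
  have eH: "(\<lambda>n. LINT x|N. ?e (H n) x) \<longlonglongrightarrow> 0"
    using LIMSEQ_subseq_LIMSEQ[OF elim r(1)] by (simp add: H_def o_def)
  have Hu: "AE x in N. (\<lambda>n. H n x) \<longlonglongrightarrow> u x"
    using r(2)
  proof eventually_elim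
    case (elim x)
    have l: "(\<lambda>n. \<bar>H n x - u x\<bar> powr p) \<longlonglongrightarrow> 0"
      by (rule tendsto_sandwich[OF _ _ tendsto_const elim]) (auto simp: H_def)
    have "(\<lambda>n. (\<bar>H n x - u x\<bar> powr p) powr (1 / p)) \<longlonglongrightarrow> 0"
      by (rule tendsto_zero_powrI[OF l tendsto_const]) (use p in auto)
    moreover have "(\<bar>H n x - u x\<bar> powr p) powr (1 / p) = \<bar>H n x - u x\<bar>" for n
      using p by (simp add: powr_powr)
    ultimately have "(\<lambda>n. \<bar>H n x - u x\<bar>) \<longlonglongrightarrow> 0" by (simp only:)
    then show ?case by (simp add: LIM_zero_iff tendsto_rabs_zero_iff)
  qed
  \<comment> \<open>The one contribution that the Lipschitz bound on \<open>g\<close> does not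
    control; it is dominated by 2 K |U|, whose p-th power is integrable.\<close>
  define A2 where "A2 n x = \<bar>g' (H n x) - g' (u x)\<bar> * norm (U x)" for n x
  have A2m [measurable]: "A2 n \<in> borel_measurable N" for n unfolding A2_def by measurable
  have A2b: "A2 n x powr p \<le> (2 * K) powr p * norm (U x) powr p" for n x
  proof -
    have "\<bar>g' (H n x) - g' (u x)\<bar> \<le> 2 * K" using g(4)[of "H n x"] g(4)[of "u x"] by linarith
    then have "A2 n x powr p \<le> (2 * K * norm (U x)) powr p"
      unfolding A2_def using p by (intro powr_mono2 mult_right_mono) auto
    then show ?thesis using K0 by (simp add: powr_mult)
  qed
  have domi: "integrable N (\<lambda>x. (2 * K) powr p * norm (U x) powr p)" using Up by simp
  have A2i: "integrable N (\<lambda>x. A2 n x powr p)" for n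
    by (rule Bochner_Integration.integrable_bound[OF domi]) (use A2b in \<open>auto simp: abs_mult\<close>)
  have A2lim: "(\<lambda>n. LINT x|N. A2 n x powr p) \<longlonglongrightarrow> (LINT x|N. 0)"
  proof (rule integral_dominated_convergence[OF _ _ domi])
    show "AE x in N. (\<lambda>n. A2 n x powr p) \<longlonglongrightarrow> 0"
      using Hu
    proof eventually_elim
      case (elim x)
      have "isCont g' (u x)" using g(3) by (simp add: continuous_on_eq_continuous_at)
      then have "(\<lambda>n. g' (H n x)) \<longlonglongrightarrow> g' (u x)" using elim by (rule isCont_tendsto_compose)
      then have "(\<lambda>n. A2 n x) \<longlonglongrightarrow> \<bar>g' (u x) - g' (u x)\<bar> * norm (U x)"
        unfolding A2_def by (intro tendsto_intros)
      then have l: "(\<lambda>n. A2 n x) \<longlonglongrightarrow> 0" by simp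
      show ?case by (rule tendsto_zero_powrI[OF l tendsto_const]) (use p in \<open>auto simp: A2_def\<close>)
    qed
    show "AE x in N. norm (A2 n x powr p) \<le> (2 * K) powr p * norm (U x) powr p" for n
      using A2b by (intro AE_I2) simp
  qed auto
  define \<phi>' where "\<phi>' n x = g (H n x) * \<psi> x" for n x
  define \<Phi>' where "\<Phi>' n = X_classical b (\<phi>' n)" for n
  have \<phi>'0: "\<phi>' n \<in> C0_infty \<Omega>" for n
  proof -
    have "\<phi>' n \<in> C_infty" unfolding \<phi>'_def by (intro C_infty_mult C_infty_compose[OF g(1) H] sm\<psi>)
    moreover obtain K where "compact K" "K \<subseteq> \<Omega>" "\<And>x. x \<notin> K \<Longrightarrow> \<psi> x = 0" using \<psi> by (auto simp: C0_infty_def)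
    ultimately show ?thesis unfolding C0_infty_def by (auto simp: \<phi>'_def)
  qed
  have sm\<phi>': "\<phi>' n \<in> C_infty" for n using \<phi>'0[of n] by (simp add: C0_infty_def)
  have \<Phi>': "\<Phi>' n x = (g' (H n x) * \<psi> x) *\<^sub>R X_classical b (H n) x + g (H n x) *\<^sub>R X_classical b \<psi> x" for n x
    unfolding \<Phi>'_def \<phi>'_def
    by (intro X_classical_compose_mult g(2) C_infty_differentiable H sm\<psi>)
  have [measurable]: "\<phi>' n \<in> borel_measurable N" "\<Phi>' n \<in> borel_measurable N" for n
    unfolding \<Phi>'_def by (intro contN C_infty_continuous_on[OF sm\<phi>'] contX[OF sm\<phi>'])+
  have \<phi>m [measurable]: "\<phi> \<in> borel_measurable N" unfolding \<phi>_def by measurable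
  have \<Phi>m [measurable]: "\<Phi> \<in> borel_measurable N" unfolding \<Phi>_def by measurable
  have d1: "\<bar>\<phi>' n x - \<phi> x\<bar> \<le> K * B * \<bar>H n x - u x\<bar>" for n x
  proof -
    have "\<bar>\<phi>' n x - \<phi> x\<bar> = \<bar>g (H n x) - g (u x)\<bar> * \<bar>\<psi> x\<bar>"
      by (simp add: \<phi>'_def \<phi>_def abs_mult left_diff_distrib[symmetric])
    also have "\<dots> \<le> (K * \<bar>H n x - u x\<bar>) * B" using gL B K0 by (intro mult_mono) auto
    finally show ?thesis by (simp add: mult_ac)
  qed
  have d2: "norm (\<Phi>' n x - \<Phi> x) \<le> K * B * norm (X_classical b (H n) x - U x) + B * A2 n x + K * B * \<bar>H n x - u x\<bar>" for n x
  proof -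
    \<comment> \<open>The splitting is arranged so that the difference of the g' values multiplies
      only the fixed field \<open>U\<close>, never the varying gradient of
      \<open>H n\<close>.\<close>
    have eq: "\<Phi>' n x - \<Phi> x = (g' (H n x) * \<psi> x) *\<^sub>R (X_classical b (H n) x - U x)
        + ((g' (H n x) - g' (u x)) * \<psi> x) *\<^sub>R U x + (g (H n x) - g (u x)) *\<^sub>R X_classical b \<psi> x"
      by (simp add: \<Phi>' \<Phi>_def algebra_simps)
    have "norm (\<Phi>' n x - \<Phi> x) \<le> norm ((g' (H n x) * \<psi> x) *\<^sub>R (X_classical b (H n) x - U x))
        + norm (((g' (H n x) - g' (u x)) * \<psi> x) *\<^sub>R U x) + norm ((g (H n x) - g (u x)) *\<^sub>R X_classical b \<psi> x)"
      unfolding eq by (rule order_trans[OF norm_triangle_ineq add_right_mono[OF norm_triangle_ineq]])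
    also have "\<dots> \<le> K * B * norm (X_classical b (H n) x - U x) + B * A2 n x + K * \<bar>H n x - u x\<bar> * B"
    proof (intro add_mono)
      have "\<bar>g' (H n x)\<bar> * \<bar>\<psi> x\<bar> \<le> K * B" by (intro mult_mono g(4) B(2) K0) auto
      then show "norm ((g' (H n x) * \<psi> x) *\<^sub>R (X_classical b (H n) x - U x)) \<le> K * B * norm (X_classical b (H n) x - U x)"
        by (simp add: abs_mult mult_right_mono)
      have "norm (((g' (H n x) - g' (u x)) * \<psi> x) *\<^sub>R U x) = \<bar>\<psi> x\<bar> * A2 n x"
        by (simp add: A2_def abs_mult)
      also have "\<dots> \<le> B * A2 n x" using B by (intro mult_right_mono) (auto simp: A2_def)
      finally show "norm (((g' (H n x) - g' (u x)) * \<psi> x) *\<^sub>R U x) \<le> B * A2 n x" .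
      have "\<bar>g (H n x) - g (u x)\<bar> * norm (X_classical b \<psi> x) \<le> K * \<bar>H n x - u x\<bar> * B"
        using K0 by (intro mult_mono gL B(3)) auto
      then show "norm ((g (H n x) - g (u x)) *\<^sub>R X_classical b \<psi> x) \<le> K * \<bar>H n x - u x\<bar> * B"
        by simp
    qed
    finally show ?thesis by (simp add: mult_ac)
  qed
  \<comment> \<open>\<open>E\<close> dominates the p-th powers of both errors at once, so that every
    limit below reduces to \<open>Elim\<close>. The factor \<open>3 powr p\<close> comes from the
    three-term bound \<open>d2\<close>, the summand 1 from the error of
    \<open>\<phi>'\<close>.\<close>
  define G where "G = (3 powr p + 1) * ((K * B) powr p + B powr p)"
  define E where "E n x = G * (?e (H n) x + A2 n x powr p)" for n x
  have Ed: "norm (\<Phi>' n x - \<Phi> x) powr p + \<bar>\<phi>' n x - \<phi> x\<bar> powr p \<le> E n x" for n x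
  proof -
    let ?a = "norm (X_classical b (H n) x - U x) powr p" and ?b = "A2 n x powr p" and ?c = "\<bar>H n x - u x\<bar> powr p"
    let ?k = "(K * B) powr p + B powr p"
    have A20: "0 \<le> A2 n x" by (simp add: A2_def)
    have KB: "0 \<le> K * B" using K0 B by simp
    have "norm (\<Phi>' n x - \<Phi> x) powr p \<le>
        (K * B * norm (X_classical b (H n) x - U x) + B * A2 n x + K * B * \<bar>H n x - u x\<bar>) powr p"
      using d2 p by (intro powr_mono2) auto
    also have "\<dots> \<le> 3 powr p * ((K * B * norm (X_classical b (H n) x - U x)) powr p + (B * A2 n x) powr p + (K * B * \<bar>H n x - u x\<bar>) powr p)"
      using p KB B A20 by (intro powr_sum3_le) auto
    also have "\<dots> = 3 powr p * ((K * B) powr p * ?a + B powr p * ?b + (K * B) powr p * ?c)"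
      using KB B A20 by (simp add: powr_mult)
    also have "\<dots> \<le> 3 powr p * (?k * ?a + ?k * ?b + ?k * ?c)"
      by (intro mult_left_mono add_mono mult_right_mono) auto
    finally have 1: "norm (\<Phi>' n x - \<Phi> x) powr p \<le> 3 powr p * (?k * ?a + ?k * ?b + ?k * ?c)" .
    have "\<bar>\<phi>' n x - \<phi> x\<bar> powr p \<le> (K * B * \<bar>H n x - u x\<bar>) powr p"
      using d1 p by (intro powr_mono2) auto
    also have "\<dots> = (K * B) powr p * ?c" using KB by (simp add: powr_mult)
    also have "\<dots> \<le> ?k * ?c" by (intro mult_right_mono) auto
    also have "\<dots> \<le> ?k * ?a + ?k * ?b + ?k * ?c" by simp
    finally have "\<bar>\<phi>' n x - \<phi> x\<bar> powr p \<le> ?k * ?a + ?k * ?b + ?k * ?c" .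
    with 1 show ?thesis unfolding E_def G_def by (simp add: algebra_simps)
  qed
  have Ei: "integrable N (E n)" for n unfolding E_def using ei[OF H] A2i by simp
  have Elim: "(\<lambda>n. LINT x|N. E n x) \<longlonglongrightarrow> 0"
  proof -
    have "(LINT x|N. E n x) = G * ((LINT x|N. ?e (H n) x) + (LINT x|N. A2 n x powr p))" for n
      unfolding E_def using ei[OF H] A2i by simp
    moreover have "(\<lambda>n. G * ((LINT x|N. ?e (H n) x) + (LINT x|N. A2 n x powr p))) \<longlonglongrightarrow> G * (0 + 0)"
      using A2lim by (intro tendsto_mult_left tendsto_add eH) simp
    ultimately show ?thesis by simp
  qed
  have cmp: "integrable N f \<and> (LINT x|N. f x) \<le> (LINT x|N. E n x)"
    if "f \<in> borel_measurable N" "\<And>x. 0 \<le> f x" "\<And>x. f x \<le> E n x" for f n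
  proof
    show "integrable N f"
      by (rule Bochner_Integration.integrable_bound[OF Ei[of n]]) (use that in \<open>auto intro!: AE_I2 order_trans[OF _ abs_ge_self]\<close>)
    then show "(LINT x|N. f x) \<le> (LINT x|N. E n x)" using that Ei by (intro integral_mono) auto
  qed
  have lim_cmp: "(\<lambda>n. LINT x|N. f n x) \<longlonglongrightarrow> 0"
    if "\<And>n. f n \<in> borel_measurable N" "\<And>n x. 0 \<le> f n x" "\<And>n x. f n x \<le> E n x" for f
    by (rule tendsto_sandwich[OF _ _ tendsto_const Elim])
      (use cmp[OF that(1) that(2) that(3)] that(2) in \<open>auto intro!: always_eventually\<close>)
  have \<Phi>p: "norm (\<Phi>' n x - \<Phi> x) powr p \<le> E n x" and \<phi>p: "\<bar>\<phi>' n x - \<phi> x\<bar> powr p \<le> E n x" for n x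
    using Ed[of n x] powr_ge_zero[of "norm (\<Phi>' n x - \<Phi> x)" p] powr_ge_zero[of "\<bar>\<phi>' n x - \<phi> x\<bar>" p] by linarith+
  have \<Phi>L: "(\<lambda>n. LINT x|N. norm (\<Phi>' n x - \<Phi> x)) \<longlonglongrightarrow> 0"
  proof (rule N.Lp_tendsto_L1[OF p])
    show "integrable N (\<lambda>x. norm (\<Phi>' n x - \<Phi> x) powr p)" for n
      using cmp[of "\<lambda>x. norm (\<Phi>' n x - \<Phi> x) powr p" n] \<Phi>p by simp
    show "(\<lambda>n. LINT x|N. norm (\<Phi>' n x - \<Phi> x) powr p) \<longlonglongrightarrow> 0"
      using \<Phi>p by (intro lim_cmp) auto
  qed auto
  have \<phi>L: "(\<lambda>n. LINT x|N. \<bar>\<phi>' n x - \<phi> x\<bar>) \<longlonglongrightarrow> 0"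
  proof (rule N.Lp_tendsto_L1[OF p])
    show "integrable N (\<lambda>x. \<bar>\<phi>' n x - \<phi> x\<bar> powr p)" for n
      using cmp[of "\<lambda>x. \<bar>\<phi>' n x - \<phi> x\<bar> powr p" n] \<phi>p by simp
    show "(\<lambda>n. LINT x|N. \<bar>\<phi>' n x - \<phi> x\<bar> powr p) \<longlonglongrightarrow> 0"
      using \<phi>p by (intro lim_cmp) auto
  qed auto
  have \<phi>ip: "integrable N (\<lambda>x. \<bar>\<phi> x\<bar> powr p)"
  proof (rule Bochner_Integration.integrable_bound[of N "\<lambda>x. (K * B) powr p * \<bar>u x\<bar> powr p"])
    have "\<bar>\<phi> x\<bar> powr p \<le> (K * B) powr p * \<bar>u x\<bar> powr p" for x
    proof -
      have "\<bar>\<phi> x\<bar> \<le> K * \<bar>u x\<bar> * B" using g1 B K0 by (auto simp: \<phi>_def abs_mult intro!: mult_mono)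
      then have "\<bar>\<phi> x\<bar> powr p \<le> (K * B * \<bar>u x\<bar>) powr p" using p by (intro powr_mono2) (auto simp: mult_ac)
      then show ?thesis using K0 B by (simp add: powr_mult)
    qed
    then show "AE x in N. norm (\<bar>\<phi> x\<bar> powr p) \<le> norm ((K * B) powr p * \<bar>u x\<bar> powr p)" by (intro AE_I2) simp
  qed (use up in auto)
  have \<Phi>ip: "integrable N (\<lambda>x. norm (\<Phi> x) powr p)"
  proof (rule Bochner_Integration.integrable_bound[of N "\<lambda>x. 3 powr p * ((K * B) powr p * norm (U x) powr p + (K * B) powr p * \<bar>u x\<bar> powr p + 0 powr p)"])
    have "norm (\<Phi> x) powr p \<le> 3 powr p * ((K * B) powr p * norm (U x) powr p + (K * B) powr p * \<bar>u x\<bar> powr p + 0 powr p)" for x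
    proof -
      have "norm (\<Phi> x) \<le> norm ((g' (u x) * \<psi> x) *\<^sub>R U x) + norm (g (u x) *\<^sub>R X_classical b \<psi> x)"
        unfolding \<Phi>_def by (rule norm_triangle_ineq)
      also have "\<dots> \<le> K * B * norm (U x) + K * \<bar>u x\<bar> * B"
        using g1 g(4) B K0 by (intro add_mono) (auto simp: abs_mult intro!: mult_mono)
      finally have "norm (\<Phi> x) powr p \<le> (K * B * norm (U x) + K * B * \<bar>u x\<bar> + 0) powr p"
        using p by (intro powr_mono2) (auto simp: mult_ac)
      also have "\<dots> \<le> 3 powr p * ((K * B * norm (U x)) powr p + (K * B * \<bar>u x\<bar>) powr p + 0 powr p)"
        using p K0 B by (intro powr_sum3_le) auto
      finally show ?thesis using K0 B by (simp add: powr_mult)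
    qed
    then show "AE x in N. norm (norm (\<Phi> x) powr p) \<le>
        norm (3 powr p * ((K * B) powr p * norm (U x) powr p + (K * B) powr p * \<bar>u x\<bar> powr p + 0 powr p))"
      by (intro AE_I2) simp
  qed (use up Up in auto)
  have \<phi>i: "integrable N \<phi>"
    using N.Lp_integrable(1)[OF p _ _ \<phi>ip] by (simp add: integrable_abs_iff)
  have \<Phi>i: "integrable N \<Phi>"
    using N.Lp_integrable(1)[OF p _ _ \<Phi>ip] by (simp add: integrable_norm_iff)
  have \<phi>'i: "integrable N (\<phi>' n)" and \<Phi>'i: "integrable N (\<Phi>' n)" for n
    using N.Lp_integrable(1)[OF p _ _ bint[OF C_infty_continuous_on[OF sm\<phi>'], of n]]
      N.Lp_integrable(1)[OF p _ _ bint[OF contX[OF sm\<phi>'], of n]]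
    by (simp_all add: integrable_norm_iff \<Phi>'_def[symmetric] integrable_abs_iff)
  show distr: "X_distr b \<Omega> \<phi> \<Phi>"
    unfolding X_distr_def
  proof (intro conjI allI impI ballI)
    fix K assume K: "compact K \<and> K \<subseteq> \<Omega>"
    then have Km: "K \<in> sets lebesgue" by (auto simp: compact_imp_closed)
    show "\<phi> absolutely_integrable_on K" "\<Phi> absolutely_integrable_on K"
      using \<phi>i \<Phi>i K Km unfolding intN[symmetric] by (auto intro: set_integrable_subset)
  next
    fix \<eta> j assume \<eta>: "\<eta> \<in> C0_infty \<Omega>"
    have m\<eta>: "\<eta> \<in> borel_measurable N" using \<eta> by (intro contN C_infty_continuous_on) (simp add: C0_infty_def)
    obtain L D where D: "\<And>x. \<bar>\<eta> x\<bar> \<le> D" using C0_infty_lipschitz[OF \<eta>] by metis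
    obtain C where C: "AE x in lebesgue. \<bar>X_adjoint b j \<eta> x\<bar> \<le> C" using X_adjoint_measurable(2)[OF b \<eta>] by blast
    have "(\<lambda>n. LINT x|N. \<Phi>' n x $ j * \<eta> x) \<longlonglongrightarrow> (LINT x|N. \<Phi> x $ j * \<eta> x)"
    proof (rule tendsto_integral_mult_bounded[OF _ _ _ m\<eta>])
      show i1: "integrable N (\<lambda>x. \<Phi>' n x $ j)" "integrable N (\<lambda>x. \<Phi> x $ j)" for n
        using integrable_bounded_linear[OF bounded_linear_vec_nth] \<Phi>'i \<Phi>i by blast+
      show "(\<lambda>n. LINT x|N. \<bar>\<Phi>' n x $ j - \<Phi> x $ j\<bar>) \<longlonglongrightarrow> 0"
      proof (rule tendsto_sandwich[OF _ _ tendsto_const \<Phi>L])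
        show "\<forall>\<^sub>F n in sequentially. 0 \<le> (LINT x|N. \<bar>\<Phi>' n x $ j - \<Phi> x $ j\<bar>)" by (auto intro!: always_eventually)
        have "(LINT x|N. \<bar>\<Phi>' n x $ j - \<Phi> x $ j\<bar>) \<le> (LINT x|N. norm (\<Phi>' n x - \<Phi> x))" for n
        proof (rule integral_mono)
          show "integrable N (\<lambda>x. \<bar>\<Phi>' n x $ j - \<Phi> x $ j\<bar>)" using i1(1)[of n] i1(2) by auto
          show "integrable N (\<lambda>x. norm (\<Phi>' n x - \<Phi> x))" using \<Phi>'i[of n] \<Phi>i by auto
          show "\<bar>\<Phi>' n x $ j - \<Phi> x $ j\<bar> \<le> norm (\<Phi>' n x - \<Phi> x)" for x
            using component_le_norm_cart[of "\<Phi>' n x - \<Phi> x" j] by simp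
        qed
        then show "\<forall>\<^sub>F n in sequentially. (LINT x|N. \<bar>\<Phi>' n x $ j - \<Phi> x $ j\<bar>) \<le> (LINT x|N. norm (\<Phi>' n x - \<Phi> x))"
          by (auto intro!: always_eventually)
      qed
      show "AE x in N. \<bar>\<eta> x\<bar> \<le> D" using D by simp
    qed
    moreover have "(\<lambda>n. LINT x|N. \<phi>' n x * X_adjoint b j \<eta> x) \<longlonglongrightarrow> (LINT x|N. \<phi> x * X_adjoint b j \<eta> x)"
    proof (rule tendsto_integral_mult_bounded[OF \<phi>'i \<phi>i \<phi>L])
      show "X_adjoint b j \<eta> \<in> borel_measurable N"
        unfolding N_def by (intro measurable_restrict_space1 X_adjoint_measurable(1)[OF b \<eta>])
      show "AE x in N. \<bar>X_adjoint b j \<eta> x\<bar> \<le> C"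
        unfolding N_def AE_restrict_space_iff[OF \<Omega>m(2)] using C by eventually_elim simp
    qed
    moreover have "(LINT x|N. \<Phi>' n x $ j * \<eta> x) = (LINT x|N. \<phi>' n x * X_adjoint b j \<eta> x)" for n
      using X_classical_integration_by_parts[OF b \<eta> sm\<phi>', of n j] by (simp add: lintN \<Phi>'_def)
    ultimately show "(LINT x:\<Omega>|lebesgue. \<Phi> x $ j * \<eta> x) = (LINT x:\<Omega>|lebesgue. \<phi> x * X_adjoint b j \<eta> x)"
      unfolding lintN by (simp add: LIMSEQ_unique)
  qed
  show "\<phi> \<in> L1p_0 b p \<Omega>"
    unfolding L1p_0_def X_closure_def
  proof (intro CollectI exI[of _ \<Phi>] conjI distr allI impI)
    show "set_borel_measurable lebesgue \<Omega> \<phi>" "set_borel_measurable lebesgue \<Omega> \<Phi>"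
      unfolding measN by (fact \<phi>m \<Phi>m)+
    show "set_integrable lebesgue \<Omega> (X_energy p \<phi> \<Phi>)"
      unfolding intN X_energy_def[abs_def] using \<phi>ip \<Phi>ip by simp
    fix \<epsilon> :: real assume "0 < \<epsilon>"
    define I where "I n = (LINT x|N. norm (\<Phi>' n x - \<Phi> x) powr p + \<bar>\<phi>' n x - \<phi> x\<bar> powr p)" for n
    have "I \<longlonglongrightarrow> 0" unfolding I_def using Ed by (intro lim_cmp) auto
    moreover have "0 \<le> I n" for n unfolding I_def by (intro Bochner_Integration.integral_nonneg) auto
    ultimately have "(\<lambda>n. I n powr (1 / p)) \<longlonglongrightarrow> 0"
      using p by (intro tendsto_zero_powrI[OF _ tendsto_const]) auto
    then have "\<forall>\<^sub>F n in sequentially. I n powr (1 / p) < \<epsilon>"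
      using \<open>0 < \<epsilon>\<close> by (rule order_tendstoD(2))
    then obtain n where "I n powr (1 / p) < \<epsilon>" by (auto simp: eventually_sequentially)
    then have "X_norm p \<Omega> (\<lambda>x. \<phi>' n x - \<phi> x) (\<lambda>x. X_classical b (\<phi>' n) x - \<Phi> x) < \<epsilon>"
      by (simp add: X_norm_def lintN X_energy_def I_def \<Phi>'_def)
    then show "\<exists>h\<in>C0_infty \<Omega>. X_norm p \<Omega> (\<lambda>x. h x - \<phi> x) (\<lambda>x. X_classical b h x - \<Phi> x) < \<epsilon>"
      using \<phi>'0 by blast
  qed
qed

section \<open>The damped power\<close>

text \<open>Like \<open>flat_poly\<close>, a family closed under differentiation and made for
  coinduction; its member with the polynomial t^(2 N + 1) and exponent \<open>N\<close> is
  \<open>t * damp N t\<close>.\<close>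

definition rat_fun :: "real poly \<Rightarrow> nat \<Rightarrow> real \<Rightarrow> real" where
  "rat_fun P n t = poly P t / (1 + t\<^sup>2) ^ n"

lemma one_plus_square_pos: "0 < 1 + (t::real)\<^sup>2"
  by (rule add_pos_nonneg) auto

lemma rat_fun_deriv:
  "(rat_fun P n has_real_derivative
     rat_fun (pderiv P * [:1, 0, 1:] - smult (2 * real n) ([:0, 1:] * P)) (Suc n) t) (at t)"
proof -
  have pos: "1 + t\<^sup>2 \<noteq> 0" using one_plus_square_pos[of t] by simp
  have d: "((\<lambda>t. (1 + t\<^sup>2) ^ n) has_real_derivative real n * (1 + t\<^sup>2) ^ (n - 1) * (2 * t)) (at t)"
    by (auto intro!: derivative_eq_intros)
  have "(rat_fun P n has_real_derivative
      (poly (pderiv P) t * (1 + t\<^sup>2) ^ n - poly P t * (real n * (1 + t\<^sup>2) ^ (n - 1) * (2 * t)))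
      / ((1 + t\<^sup>2) ^ n * (1 + t\<^sup>2) ^ n)) (at t)"
    unfolding rat_fun_def[abs_def] by (rule DERIV_divide[OF poly_DERIV d]) (use pos in simp)
  moreover have "(poly (pderiv P) t * (1 + t\<^sup>2) ^ n - poly P t * (real n * (1 + t\<^sup>2) ^ (n - 1) * (2 * t)))
      / ((1 + t\<^sup>2) ^ n * (1 + t\<^sup>2) ^ n)
      = rat_fun (pderiv P * [:1, 0, 1:] - smult (2 * real n) ([:0, 1:] * P)) (Suc n) t"
  \<comment> \<open>The derivative of the denominator contains the natural number exponent
    \<open>n - 1\<close>, which truncates at \<open>n = 0\<close>; that case is harmless because of
    the factor n.\<close>
  proof (cases n)
    case (Suc m)
    define y where "y = 1 + t\<^sup>2"
    have y: "y \<noteq> 0" using pos by (simp add: y_def)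
    have ev: "poly (pderiv P * [:1, 0, 1:] - smult (2 * real n) ([:0, 1:] * P)) t
        = poly (pderiv P) t * y - 2 * real (Suc m) * (t * poly P t)"
      by (simp add: Suc y_def power2_eq_square algebra_simps)
    have "(a * (y * y ^ m) - c * (real (Suc m) * y ^ m * (2 * t))) / (y * y ^ m * (y * y ^ m))
        = (a * y - 2 * real (Suc m) * (t * c)) / (y * (y * y ^ m))" for a c
      using y by (simp add: divide_simps) (simp add: algebra_simps)
    then show ?thesis
      unfolding rat_fun_def ev unfolding y_def[symmetric] Suc by simp
  qed (use pos in \<open>simp add: rat_fun_def power2_eq_square nonzero_eq_divide_eq algebra_simps\<close>)
  ultimately show ?thesis by simp
qed

lemma smooth1_rat_fun: "smooth1 (rat_fun P n)"
proof (coinduction arbitrary: P n)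
  case smooth1
  show ?case using rat_fun_deriv by blast
qed

lemma continuous_on_rat_fun: "continuous_on A (rat_fun P n)"
  using rat_fun_deriv by (meson DERIV_isCont continuous_at_imp_continuous_on)

definition damp :: "nat \<Rightarrow> real \<Rightarrow> real" where
  "damp N t = (t\<^sup>2 / (1 + t\<^sup>2)) ^ N"

lemma damp_nonneg: "0 \<le> damp N t"
  and damp_le_1: "damp N t \<le> 1"
  and damp_le_power: "damp N t \<le> t ^ (2 * N)"
  and damp_pos: "t \<noteq> 0 \<Longrightarrow> 0 < damp N t"
proof -
  have p: "0 < 1 + t\<^sup>2" by (rule one_plus_square_pos)
  have "t\<^sup>2 * 1 \<le> t\<^sup>2 * (1 + t\<^sup>2)" by (intro mult_left_mono) auto
  then have 2: "t\<^sup>2 / (1 + t\<^sup>2) \<le> t\<^sup>2" by (subst pos_divide_le_eq[OF p]) simp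
  have 1: "t\<^sup>2 / (1 + t\<^sup>2) \<le> 1" by (subst pos_divide_le_eq[OF p]) simp
  have 0: "0 \<le> t\<^sup>2 / (1 + t\<^sup>2)" using p by (intro divide_nonneg_pos) auto
  show "0 \<le> damp N t" unfolding damp_def using 0 by (rule zero_le_power)
 show "damp N t \<le> 1" "damp N t \<le> t ^ (2 * N)"
    unfolding damp_def power_mult using power_le_one[OF 0 1] power_mono[OF 2 0] by blast+
  show "0 < damp N t" if "t \<noteq> 0" unfolding damp_def by (rule zero_less_power) (use that p in auto)
qed

text \<open>The derivative is \<open>damp N t\<close> times (2 N + 1 + t^2) / (1 + t^2), a factor
  between 1 and 2 N + 1. The lower bound serves the absorption of the gradient, the upper one is the
  Lipschitz constant wanted by \<open>composite_test_function\<close>.\<close>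

lemma damped_identity_smooth:
  obtains g' where "smooth1 (\<lambda>t. t * damp N t)" "\<And>t. ((\<lambda>t. t * damp N t) has_real_derivative g' t) (at t)"
    "continuous_on UNIV g'" "\<And>t. damp N t \<le> g' t" "\<And>t. \<bar>g' t\<bar> \<le> 2 * real N + 1"
proof -
  let ?P = "monom (1::real) (2 * N + 1)"
  let ?g = "rat_fun ?P N"
  have g: "?g = (\<lambda>t. t * damp N t)"
    by (rule ext) (simp add: rat_fun_def damp_def poly_monom power_mult power_divide)
  define g' where "g' = rat_fun (pderiv ?P * [:1, 0, 1:] - smult (2 * real N) ([:0, 1:] * ?P)) (Suc N)"
  have g'_eq: "g' t = damp N t * ((2 * real N + 1 + t\<^sup>2) / (1 + t\<^sup>2))" for t
  proof -
    have "poly (pderiv ?P * [:1, 0, 1:] - smult (2 * real N) ([:0, 1:] * ?P)) t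
        = (t\<^sup>2) ^ N * (2 * real N + 1 + t\<^sup>2)"
      by (simp add: pderiv_monom poly_monom power_mult power2_eq_square algebra_simps)
    then show ?thesis
      unfolding g'_def rat_fun_def damp_def by (simp add: power_divide)
  qed
  have quot: "1 \<le> (2 * real N + 1 + t\<^sup>2) / (1 + t\<^sup>2)" "(2 * real N + 1 + t\<^sup>2) / (1 + t\<^sup>2) \<le> 2 * real N + 1" for t
    using one_plus_square_pos[of t] by (auto simp: pos_le_divide_eq pos_divide_le_eq algebra_simps)
  show ?thesis
  proof (rule that[of g'])
    show "smooth1 (\<lambda>t. t * damp N t)" unfolding g[symmetric] by (rule smooth1_rat_fun)
    show "((\<lambda>t. t * damp N t) has_real_derivative g' t) (at t)" for t
      unfolding g[symmetric] g'_def by (rule rat_fun_deriv)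
    show "continuous_on UNIV g'" unfolding g'_def by (rule continuous_on_rat_fun)
    show lo: "damp N t \<le> g' t" for t
      unfolding g'_eq using mult_left_mono[OF quot(1) damp_nonneg] by simp
    show "\<bar>g' t\<bar> \<le> 2 * real N + 1" for t
    proof -
      have "g' t \<le> 1 * (2 * real N + 1)"
        unfolding g'_eq using damp_le_1 damp_nonneg quot by (intro mult_mono) (auto intro: order_trans[OF zero_le_one])
      moreover have "0 \<le> g' t" using lo[of t] damp_nonneg[of N t] by linarith
      ultimately show ?thesis by simp
    qed
  qed
qed

section \<open>The pointwise inequality\<close>

text \<open>The coefficient of \<open>s powr p\<close> must be exactly the constant of the
  coercivity condition. Comparing \<nu>2 y with \<nu>1 s decides which of the two terms dominates;
  this argument also covers p = 1, where Young's inequality has no finite conjugate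
  exponent.\<close>

lemma young_gradient:
  fixes s \<mu> p \<nu>1 \<nu>2 :: real
  assumes p: "1 \<le> p" and \<nu>: "0 < \<nu>1" "0 < \<nu>2" and s: "0 \<le> s" and y: "0 \<le> y"
  shows "\<nu>2 * y * (if p = 1 then 1 else s powr (p - 1)) \<le> \<nu>1 * s powr p + \<nu>2 * (\<nu>2 / \<nu>1) powr (p - 1) * y powr p"
proof (cases "\<nu>2 / \<nu>1 * y \<le> s")
  case True
  then have "\<nu>2 * y \<le> \<nu>1 * s" using \<nu> by (simp add: field_simps)
  then have "\<nu>2 * y * (if p = 1 then 1 else s powr (p - 1)) \<le> \<nu>1 * s * (if p = 1 then 1 else s powr (p - 1))"
    by (intro mult_right_mono) auto
  also have "\<dots> = \<nu>1 * s powr p"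
    using s p by (cases "s = 0") (auto simp: powr_diff)
  also have "\<dots> \<le> \<nu>1 * s powr p + \<nu>2 * (\<nu>2 / \<nu>1) powr (p - 1) * y powr p" using \<nu> by simp
  finally show ?thesis .
next
  case False
  then have sy: "s < \<nu>2 / \<nu>1 * y" by simp
  then have y0: "0 < y" using s \<nu> y by (cases "y = 0") auto
  have "(if p = 1 then 1 else s powr (p - 1)) \<le> (\<nu>2 / \<nu>1 * y) powr (p - 1)"
    using sy s p y0 \<nu> by (auto intro: powr_mono2)
  then have "\<nu>2 * y * (if p = 1 then 1 else s powr (p - 1)) \<le> \<nu>2 * y * (\<nu>2 / \<nu>1 * y) powr (p - 1)"
    using \<nu> y by (intro mult_left_mono) auto
  also have "(\<nu>2 / \<nu>1 * y) powr (p - 1) = (\<nu>2 / \<nu>1) powr (p - 1) * y powr (p - 1)"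
    by (rule powr_mult)
  also have "\<nu>2 * y * ((\<nu>2 / \<nu>1) powr (p - 1) * y powr (p - 1)) = \<nu>2 * (\<nu>2 / \<nu>1) powr (p - 1) * (y * y powr (p - 1))"
    by (simp only: mult_ac)
  also have "y * y powr (p - 1) = y powr p" using y0 by (simp add: powr_diff)
  finally have "\<nu>2 * y * (if p = 1 then 1 else s powr (p - 1)) \<le> \<nu>2 * (\<nu>2 / \<nu>1) powr (p - 1) * y powr p" .
  moreover have "0 \<le> \<nu>1 * s powr p" using \<nu> by simp
  ultimately show ?thesis by linarith
qed

text \<open>The threshold is where (C / \<nu>) l^p equals t^(q - p). Above it the term is absorbed
  by t^q. Below it \<open>damp N t\<close> is at most t^(2 N), and t^(p + 2 N) is a power of t^(q -
  p), hence bounded through l; collecting the powers of l gives \<open>\<sigma>\<close>.\<close>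

lemma young_damped:
  fixes p q \<nu> C :: real and N :: nat
  assumes p: "1 \<le> p" "p < q" and \<nu>: "0 < \<nu>" and C: "0 \<le> C" and t: "0 \<le> t" and l: "0 \<le> l"
  defines "\<sigma> \<equiv> p * (2 * real N + q) / (q - p)"
  shows "damp N t * (C * (l * t) powr p)
    \<le> \<nu> * t powr q * damp N t + C * (C / \<nu>) powr ((p + 2 * real N) / (q - p)) * l powr \<sigma>"
proof (cases "C / \<nu> * l powr p \<le> t powr (q - p)")
  case True
  then have "C * l powr p \<le> \<nu> * t powr (q - p)" using \<nu> by (simp add: field_simps)
  then have "C * l powr p * t powr p \<le> \<nu> * t powr (q - p) * t powr p" by (intro mult_right_mono) auto
  then have "C * (l * t) powr p \<le> \<nu> * t powr q"
    using l t by (cases "t = 0") (simp_all add: powr_mult mult.assoc powr_add[symmetric])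
  then have "damp N t * (C * (l * t) powr p) \<le> damp N t * (\<nu> * t powr q)"
    by (intro mult_left_mono damp_nonneg)
  then show ?thesis using C by (simp add: mult.commute add_increasing2)
next
  case False
  then have tl: "t powr (q - p) < C / \<nu> * l powr p" by simp
  let ?k = "(p + 2 * real N) / (q - p)"
  show ?thesis
  proof (cases "t = 0")
    case True
    then show ?thesis using p C by simp
  next
    case t0: False
    then have tpos: "0 < t" using t by simp
    have "damp N t * t powr p \<le> t powr (2 * real N) * t powr p"
      using damp_le_power[of N t] tpos powr_realpow[OF tpos, of "2 * N"] by (intro mult_right_mono) auto
    also have "\<dots> = (t powr (q - p)) powr ?k"
      using p by (simp add: powr_powr powr_add[symmetric] add.commute)
    also have "\<dots> \<le> (C / \<nu> * l powr p) powr ?k"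
      using tl p by (intro powr_mono2) auto
    also have "\<dots> = (C / \<nu>) powr ?k * l powr (p * ?k)"
      by (simp only: powr_mult powr_powr)
    finally have 1: "damp N t * t powr p \<le> (C / \<nu>) powr ?k * l powr (p * ?k)" .
    have "damp N t * (C * (l * t) powr p) = C * l powr p * (damp N t * t powr p)"
      using l t by (simp add: powr_mult mult_ac)
    also have "\<dots> \<le> C * l powr p * ((C / \<nu>) powr ?k * l powr (p * ?k))"
      using 1 C by (intro mult_left_mono) auto
    also have "\<dots> = C * (C / \<nu>) powr ?k * l powr (p + p * ?k)"
      by (simp add: powr_add mult_ac)
    also have "p + p * ?k = \<sigma>"
      using p by (simp add: \<sigma>_def field_simps)
    finally show ?thesis using \<nu> damp_nonneg[of N t] by (simp add: add_increasing)
  qed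
qed

text \<open>Writing the size of the cut-off gradient \<open>Z\<close> as l times \<psi> makes
  \<open>damp N t * \<psi>\<close> a common factor. \<open>young_gradient\<close> with y = l t then
  uses up the coercive term, and \<open>young_damped\<close> uses up half of the zero-order
  term.\<close>

lemma test_integrand_lower_bound:
  fixes a \<xi> Z :: "real^'m" and p q \<nu>1 \<nu>2 \<nu>3 :: real and N :: nat
  assumes p: "1 \<le> p" "p < q" and \<nu>: "0 < \<nu>1" "0 < \<nu>2" "0 < \<nu>3"
    and a: "\<nu>1 * norm \<xi> powr p \<le> a \<bullet> \<xi>" "norm a \<le> \<nu>2 * (if p = 1 then 1 else norm \<xi> powr (p - 1))"
    and F: "\<nu>3 * (\<bar>t\<bar> powr (q - 2) * t) \<le> F" and t: "0 \<le> t" and g': "damp N t \<le> g'" and \<psi>: "0 < \<psi>"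
  defines "\<sigma> \<equiv> p * (2 * real N + q) / (q - p)"
    and "C \<equiv> \<nu>2 * (\<nu>2 / \<nu>1) powr (p - 1)"
  shows "(\<nu>3 / 2) * t powr q * damp N t * \<psi>
      - C * (C / (\<nu>3 / 2)) powr ((p + 2 * real N) / (q - p)) * (\<psi> * (norm Z / \<psi>) powr \<sigma>)
    \<le> a \<bullet> ((g' * \<psi>) *\<^sub>R \<xi> + (t * damp N t) *\<^sub>R Z) + F * (t * damp N t * \<psi>)"
proof -
  define w where "w = damp N t"
  define l where "l = norm Z / \<psi>"
  define S where "S = (if p = 1 then 1 else norm \<xi> powr (p - 1))"
  have w: "0 \<le> w" unfolding w_def by (rule damp_nonneg)
  have l: "0 \<le> l" "norm Z = l * \<psi>" using \<psi> by (simp_all add: l_def)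
  have S: "0 \<le> S" by (simp add: S_def)
  have C: "0 \<le> C" using \<nu> by (simp add: C_def)
  have e1: "w * \<psi> * (\<nu>1 * norm \<xi> powr p) \<le> g' * \<psi> * (a \<bullet> \<xi>)"
    using a(1) g' \<psi> w \<nu> by (intro mult_mono) (auto simp: w_def)
  have "- (a \<bullet> Z) \<le> norm a * norm Z" using Cauchy_Schwarz_ineq2[of a Z] by linarith
  also have "\<dots> \<le> \<nu>2 * S * (l * \<psi>)" using a(2) l \<nu> \<psi> by (intro mult_mono) (auto simp: S_def)
  finally have "t * w * (- (a \<bullet> Z)) \<le> t * w * (\<nu>2 * S * (l * \<psi>))" using t w by (intro mult_left_mono) auto
  then have e2: "- (w * \<psi> * (\<nu>2 * (l * t) * S)) \<le> t * w * (a \<bullet> Z)" by (simp add: mult_ac)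
  have "\<bar>t\<bar> powr (q - 2) * t * t = t powr q"
    using t by (cases "t = 0") (simp_all add: powr_diff power2_eq_square)
  then have "\<nu>3 * t powr q = \<nu>3 * (\<bar>t\<bar> powr (q - 2) * t) * t" by simp
  also have "\<dots> \<le> F * t" using F t by (intro mult_right_mono)
  finally have "(\<nu>3 * t powr q) * (w * \<psi>) \<le> F * t * (w * \<psi>)" using w \<psi> by (intro mult_right_mono) auto
  then have e3: "w * \<psi> * (\<nu>3 * t powr q) \<le> F * (t * w * \<psi>)" by (simp add: mult_ac)
  have "\<nu>2 * (l * t) * S \<le> \<nu>1 * norm \<xi> powr p + C * (l * t) powr p"
    using young_gradient[OF p(1) \<nu>(1,2) norm_ge_zero, of "l * t" \<xi>] l t by (simp add: S_def C_def)
  then have "w * \<psi> * (\<nu>2 * (l * t) * S) \<le> w * \<psi> * (\<nu>1 * norm \<xi> powr p + C * (l * t) powr p)"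
    using w \<psi> by (intro mult_left_mono) auto
  then have e4: "w * \<psi> * (\<nu>2 * (l * t) * S) \<le> w * \<psi> * (\<nu>1 * norm \<xi> powr p) + \<psi> * (w * (C * (l * t) powr p))"
    by (simp add: distrib_left mult_ac)
  have "\<psi> * (w * (C * (l * t) powr p)) \<le> \<psi> * (\<nu>3 / 2 * t powr q * w + C * (C / (\<nu>3 / 2)) powr ((p + 2 * real N) / (q - p)) * l powr \<sigma>)"
    using young_damped[OF p _ C t l(1), of "\<nu>3 / 2" N] \<nu> \<psi> by (intro mult_left_mono) (auto simp: w_def \<sigma>_def)
  then have e5: "\<psi> * (w * (C * (l * t) powr p)) \<le> w * \<psi> * (\<nu>3 * t powr q) / 2
      + C * (C / (\<nu>3 / 2)) powr ((p + 2 * real N) / (q - p)) * (\<psi> * l powr \<sigma>)"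
    by (simp add: distrib_left mult_ac)
  have "a \<bullet> ((g' * \<psi>) *\<^sub>R \<xi> + (t * w) *\<^sub>R Z) + F * (t * w * \<psi>)
      = g' * \<psi> * (a \<bullet> \<xi>) + t * w * (a \<bullet> Z) + F * (t * w * \<psi>)"
    by (simp add: inner_add_right)
  moreover have "(\<nu>3 / 2) * t powr q * w * \<psi> = w * \<psi> * (\<nu>3 * t powr q) / 2" by simp
  ultimately show ?thesis
    using e1 e2 e3 e4 e5 unfolding w_def[symmetric] l_def[symmetric] by linarith
qed

text \<open>Raise y / c \<le> exp(y / c) to the power c. With y = 1 / s and c = 2 \<sigma> this
  bounds the cut-off term: exp(- y) is the value of \<open>flat\<close> at s, and y^2 the ratio of
  its derivative to it.\<close>

lemma powr_times_exp_le:
  assumes "0 < y" "0 < (c::real)"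
  shows "y powr c * exp (- y) \<le> c powr c"
proof -
  have "y / c \<le> exp (y / c)" using exp_ge_add_one_self[of "y / c"] by linarith
  then have "(y / c) powr c \<le> exp (y / c) powr c" using assms by (intro powr_mono2) auto
  also have "\<dots> = exp y" using assms by (simp add: exp_powr_real)
  finally have "y powr c \<le> c powr c * exp y" using assms by (simp add: powr_divide field_simps)
  then show ?thesis by (simp add: exp_minus field_simps)
qed

section \<open>The Liouville theorem\<close>

text \<open>Integrating \<open>test_integrand_lower_bound\<close> and using the weak inequality
  leaves only the cut-off term on the right. The ratio of gradient to cut-off contributes a factor 1
  / R, hence the power - \<sigma> of R. The constant \<open>D\<close> is chosen before R, as the
  later limit in R demands.\<close>

lemma ball_energy_estimate:
  fixes b :: "real^'n \<Rightarrow> real^'n^'m"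
    and A :: "real^'n \<Rightarrow> real \<Rightarrow> real^'m \<Rightarrow> real^'m"
    and f :: "real^'n \<Rightarrow> real \<Rightarrow> real" and u :: "real^'n \<Rightarrow> real" and N :: nat
  assumes b: "locally_lipschitz_fields b" and cc: "cc_space b Q" and p: "1 \<le> p" "p < q"
    and S: "S1 p A" "S2 p A" "S3 q f"
    and u: "weak_entire_solution b p A f u" "AE x in lebesgue. 0 \<le> u x"
  defines "\<sigma> \<equiv> p * (2 * real N + q) / (q - p)"
  obtains D where "0 \<le> D" "\<And>R. 0 < R \<Longrightarrow>
      (\<integral>\<^sup>+x. ennreal (u x powr q * damp N (u x)) * indicator (cc_ball b x0 R) x \<partial>lebesgue)
      \<le> ennreal (D * R powr - \<sigma>) * emeasure lebesgue (cc_ball b x0 (4 * R))"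
proof -
  obtain \<nu>1 where \<nu>1: "0 < \<nu>1" "\<And>x s \<xi>. \<nu>1 * norm \<xi> powr p \<le> A x s \<xi> \<bullet> \<xi>"
    using S(1) unfolding S1_def by blast
  obtain \<nu>2 where \<nu>2: "0 < \<nu>2" "\<And>x s \<xi>. norm (A x s \<xi>) \<le> \<nu>2 * (if p = 1 then 1 else norm \<xi> powr (p - 1))"
    using S(2) unfolding S2_def by blast
  obtain \<nu>3 where \<nu>3: "0 < \<nu>3" "\<And>x s. \<nu>3 * (\<bar>s\<bar> powr (q - 2) * s) \<le> f x s"
    using S(3) unfolding S3_def by blast
  obtain g' where g': "smooth1 (\<lambda>t. t * damp N t)" "\<And>t. ((\<lambda>t. t * damp N t) has_real_derivative g' t) (at t)"
    "continuous_on UNIV g'" "\<And>t. damp N t \<le> g' t" "\<And>t. \<bar>g' t\<bar> \<le> 2 * real N + 1"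
    using damped_identity_smooth[of N] by blast
  have \<sigma>: "0 < \<sigma>" unfolding \<sigma>_def using p by (intro divide_pos_pos mult_pos_pos) auto
  \<comment> \<open>Bounds the norm of the gradient of \<open>V\<close> by the sum of its
    components, each at most 2 in absolute value.\<close>
  define m where "m = 2 * real CARD('m)"
  define C where "C = \<nu>2 * (\<nu>2 / \<nu>1) powr (p - 1)"
  define C1 where "C1 = C * (C / (\<nu>3 / 2)) powr ((p + 2 * real N) / (q - p))"
  define C2 where "C2 = C1 * (m powr \<sigma> * (2 * \<sigma>) powr (2 * \<sigma>))"
  \<comment> \<open>On the smaller ball the argument of \<open>flat\<close> is at least 1 / 2, so
    the cut-off is at least exp(- 2) there.\<close>
  define c0 where "c0 = (\<nu>3 / 2) * exp (- 2)"
  have m0: "0 < m" by (simp add: m_def)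
  have C1: "0 \<le> C1" using \<nu>2(1) by (simp add: C1_def C_def)
  have C2: "0 \<le> C2" using C1 by (simp add: C2_def)
  have c0: "0 < c0" using \<nu>3(1) by (simp add: c0_def)
  define J where "J x = u x powr q * damp N (u x)" for x
  have J0: "0 \<le> J x" for x by (simp add: J_def damp_nonneg)
  have est: "(\<integral>\<^sup>+x. ennreal (J x) * indicator (cc_ball b x0 R) x \<partial>lebesgue)
      \<le> ennreal (C2 / c0 * R powr - \<sigma>) * emeasure lebesgue (cc_ball b x0 (4 * R))" if R: "0 < R" for R
  proof -
    let ?B = "cc_ball b x0 R" and ?B4 = "cc_ball b x0 (4 * R)"
    obtain V where V: "V \<in> C_infty" "\<And>x. \<bar>V x - max 0 (3 * R - cc_dist b x0 x)\<bar> \<le> R / 2"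
      "\<And>x j. \<bar>X_classical b V x $ j\<bar> \<le> 2"
    proof (rule cc_cutoff[OF b cc R, of x0])
      fix V assume "V \<in> C_infty" "\<And>x. \<bar>V x - max 0 (3 * R - cc_dist b x0 x)\<bar> \<le> R / 2"
        "\<And>x j. \<bar>X_classical b V x $ j\<bar> \<le> 2"
      then show thesis by (rule that)
    qed
    \<comment> \<open>As \<open>V\<close> has error at most R / 2, the shift by 1 gives s \<ge> 1 /
      2 on the ball of radius R, and s > 0 only at distances at most 3 R, well inside the ball of
      radius 4 R.\<close>
    define s where "s x = (1 / R) * V x + (- 1)" for x
    define \<psi> where "\<psi> x = flat (s x)" for x
    have sms: "s \<in> C_infty"
      unfolding s_def by (intro C_infty_add C_infty_mult C_infty_const V(1))
    have sm\<psi>: "\<psi> \<in> C_infty" unfolding \<psi>_def by (rule C_infty_compose[OF smooth1_flat_poly sms])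
    have X\<psi>: "X_classical b \<psi> x = (flat_poly ((1 - pderiv 1) * [:0, 0, 1:]) (s x) / R) *\<^sub>R X_classical b V x" for x
    proof -
      have "((\<lambda>y. flat ((1 / R) * y + (- 1))) has_real_derivative
          flat_poly ((1 - pderiv 1) * [:0, 0, 1:]) (s x) * (1 / R)) (at (V x))"
        unfolding s_def by (rule DERIV_chain2[OF flat_poly_deriv]) (use R in \<open>auto intro!: derivative_eq_intros\<close>)
      from partial_compose[OF this C_infty_differentiable[OF V(1)]]
      have "partial k \<psi> x = flat_poly ((1 - pderiv 1) * [:0, 0, 1:]) (s x) * (1 / R) * partial k V x" for k
        unfolding \<psi>_def s_def .
      then show ?thesis
        by (simp add: X_classical_def vec_eq_iff sum_distrib_left mult_ac)
    qed
    have spos: "cc_dist b x0 x \<le> 3 * R" if x: "0 < s x" for x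
    proof -
      have "R < V x" using x R by (simp add: s_def field_simps)
      then show ?thesis using V(2)[of x] R by (auto simp: abs_le_iff max_def split: if_splits)
    qed
    have B4: "x \<in> ?B4" if "0 < s x" for x using spos[OF that] R by (simp add: cc_ball_def)
    have sB: "1 / 2 \<le> s x" if x: "x \<in> ?B" for x
    proof -
      have "cc_dist b x0 x < R" using x by (simp add: cc_ball_def)
      then have "2 * R \<le> max 0 (3 * R - cc_dist b x0 x)" by linarith
      then have "3 / 2 * R \<le> V x" using V(2)[of x] by linarith
      then show ?thesis using R by (simp add: s_def field_simps)
    qed
    have comp: "compact (cc_cball b x0 (4 * R))" by (rule compact_cc_cball[OF b cc])
    obtain \<rho> where \<rho>: "cc_cball b x0 (4 * R) \<subseteq> ball 0 \<rho>"
      using bounded_subset_ballD[OF compact_imp_bounded[OF comp], of 0] by blast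
    \<comment> \<open>A Euclidean ball serves as the bounded open set; closed balls of
      \<open>cc_dist\<close> are compact and therefore fit into one.\<close>
    define \<Omega> where "\<Omega> = ball (0::real^'n) \<rho>"
    have \<Omega>: "open \<Omega>" "bounded \<Omega>" by (simp_all add: \<Omega>_def)
    have B\<Omega>: "?B \<subseteq> \<Omega>" "?B4 \<subseteq> \<Omega>" using \<rho> R by (auto simp: \<Omega>_def cc_ball_def cc_cball_def subset_iff)
    have \<psi>0: "\<psi> \<in> C0_infty \<Omega>"
      unfolding C0_infty_def
    proof (intro CollectI conjI sm\<psi> exI[of _ "cc_cball b x0 (4 * R)"] comp allI impI)
      show "cc_cball b x0 (4 * R) \<subseteq> \<Omega>" using \<rho> by (simp add: \<Omega>_def)
      show "\<psi> x = 0" if x: "x \<notin> cc_cball b x0 (4 * R)" for x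
      proof -
        have "\<not> 0 < s x" using spos[of x] x R by (force simp: cc_cball_def)
        then show ?thesis by (simp add: \<psi>_def flat_poly_def)
      qed
    qed
    \<comment> \<open>Membership yields a gradient \<open>U\<close> together with smooth
      approximations. The definition of a solution quantifies over all distributional gradients of
      \<open>u\<close> and of the test function, so \<open>U\<close> and \<open>\<Phi>\<close> may
      be inserted.\<close>
    have "u \<in> L1p b p \<Omega>" using u(1) \<Omega> by (simp add: weak_entire_solution_def L1p_loc_def)
    then obtain U where U: "X_distr b \<Omega> u U" "set_borel_measurable lebesgue \<Omega> u" "set_borel_measurable lebesgue \<Omega> U"
      "set_integrable lebesgue \<Omega> (X_energy p u U)"
      "\<And>\<epsilon>. 0 < \<epsilon> \<Longrightarrow> \<exists>h\<in>C_infty. X_norm p \<Omega> (\<lambda>x. h x - u x) (\<lambda>x. X_classical b h x - U x) < \<epsilon>"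
      unfolding L1p_def X_closure_def by blast
    define \<phi> where "\<phi> x = u x * damp N (u x) * \<psi> x" for x
    define \<Phi> where "\<Phi> x = (g' (u x) * \<psi> x) *\<^sub>R U x + (u x * damp N (u x)) *\<^sub>R X_classical b \<psi> x" for x
    have test: "\<phi> \<in> L1p_0 b p \<Omega>" "X_distr b \<Omega> \<phi> \<Phi>"
      unfolding \<phi>_def[abs_def] \<Phi>_def[abs_def]
      using composite_test_function[OF b p(1) \<Omega> U g'(1,2,3,5) _ \<psi>0] by simp_all
    define I where "I x = (\<Sum>i\<in>UNIV. A x (u x) (U x) $ i * \<Phi> x $ i) + f x (u x) * \<phi> x" for x
    have "AE x in lebesgue. x \<in> \<Omega> \<longrightarrow> 0 \<le> \<phi> x"
      using u(2) by eventually_elim (simp add: \<phi>_def \<psi>_def damp_nonneg flat_nonneg)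
    then have I: "set_integrable lebesgue \<Omega> I" "(LINT x:\<Omega>|lebesgue. I x) \<le> 0"
      using u(1) \<Omega> test U(1) unfolding weak_entire_solution_def I_def[abs_def] by blast+
    have lower: "c0 * J x * indicator ?B x \<le> indicator \<Omega> x * I x + C2 * R powr - \<sigma> * indicator ?B4 x"
      if ux: "0 \<le> u x" for x
    proof (cases "0 < s x")
      case False
      then have "\<psi> x = 0" "X_classical b \<psi> x = 0" "x \<notin> ?B"
        using sB[of x] by (auto simp: \<psi>_def X\<psi> flat_poly_def)
      then have "I x = 0" "indicator ?B x = (0::real)" by (simp_all add: I_def \<phi>_def \<Phi>_def)
      then show ?thesis using C2 by simp
    next
      case True
      then have x4: "x \<in> ?B4" "x \<in> \<Omega>" using B4 B\<Omega> by auto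
      have \<psi>pos: "0 < \<psi> x" using True by (simp add: \<psi>_def flat_pos_iff)
      have nX: "norm (X_classical b V x) \<le> m"
      proof -
        have "norm (X_classical b V x) \<le> (\<Sum>j\<in>UNIV. \<bar>X_classical b V x $ j\<bar>)" by (rule norm_le_l1_cart)
        also have "\<dots> \<le> (\<Sum>j\<in>(UNIV::'m set). 2)" by (intro sum_mono V(3))
        finally show ?thesis by (simp add: m_def)
      qed
      let ?y = "1 / s x"
      have y: "0 < ?y" using True by simp
      \<comment> \<open>The polynomial appearing in \<open>X\<psi>\<close> is y^2 with y = 1 / s,
        and the exponentials cancel in the quotient.\<close>
      have "norm (X_classical b \<psi> x) / \<psi> x = ?y\<^sup>2 / R * norm (X_classical b V x)"
        using True R by (simp add: X\<psi> \<psi>_def flat_poly_def power2_eq_square)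
      also have "\<dots> \<le> ?y\<^sup>2 / R * m" using nX R by (intro mult_left_mono) auto
      finally have "(norm (X_classical b \<psi> x) / \<psi> x) powr \<sigma> \<le> (?y\<^sup>2 / R * m) powr \<sigma>"
        using \<sigma> \<psi>pos by (intro powr_mono2) auto
      also have "\<dots> = m powr \<sigma> * R powr - \<sigma> * ?y powr (2 * \<sigma>)"
      proof -
        have y2: "(?y\<^sup>2) powr \<sigma> = ?y powr (2 * \<sigma>)"
          using powr_powr[of ?y 2 \<sigma>] powr_numeral[of ?y num.One] y by (simp add: powr_realpow[of ?y 2, simplified])
        have "(?y\<^sup>2 / R * m) powr \<sigma> = (?y\<^sup>2) powr \<sigma> / R powr \<sigma> * m powr \<sigma>"
          by (simp only: powr_mult powr_divide)
        also have "\<dots> = m powr \<sigma> * (1 / R powr \<sigma>) * (?y\<^sup>2) powr \<sigma>" by simp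
        finally show ?thesis unfolding y2 powr_minus_divide .
      qed
      finally have "\<psi> x * (norm (X_classical b \<psi> x) / \<psi> x) powr \<sigma> \<le> \<psi> x * (m powr \<sigma> * R powr - \<sigma> * ?y powr (2 * \<sigma>))"
        using \<psi>pos by (intro mult_left_mono) auto
      also have "\<psi> x = exp (- ?y)" using True by (simp add: \<psi>_def flat_poly_def)
      also have "exp (- ?y) * (m powr \<sigma> * R powr - \<sigma> * ?y powr (2 * \<sigma>)) = m powr \<sigma> * R powr - \<sigma> * (?y powr (2 * \<sigma>) * exp (- ?y))"
        by (simp only: mult_ac)
      also have "\<dots> \<le> m powr \<sigma> * R powr - \<sigma> * (2 * \<sigma>) powr (2 * \<sigma>)"
        using y \<sigma> by (intro mult_left_mono powr_times_exp_le) auto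
      finally have "exp (- ?y) * (norm (X_classical b \<psi> x) / exp (- ?y)) powr \<sigma> \<le> m powr \<sigma> * R powr - \<sigma> * (2 * \<sigma>) powr (2 * \<sigma>)" .
      then have "\<psi> x * (norm (X_classical b \<psi> x) / \<psi> x) powr \<sigma> \<le> m powr \<sigma> * R powr - \<sigma> * (2 * \<sigma>) powr (2 * \<sigma>)"
        using True by (simp add: \<psi>_def flat_poly_def)
      then have "C1 * (\<psi> x * (norm (X_classical b \<psi> x) / \<psi> x) powr \<sigma>) \<le> C1 * (m powr \<sigma> * R powr - \<sigma> * (2 * \<sigma>) powr (2 * \<sigma>))"
        using C1 by (rule mult_left_mono)
      then have cut: "C1 * (\<psi> x * (norm (X_classical b \<psi> x) / \<psi> x) powr \<sigma>) \<le> C2 * R powr - \<sigma>"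
        by (simp add: C2_def mult_ac)
      have "(\<nu>3 / 2) * u x powr q * damp N (u x) * \<psi> x - C1 * (\<psi> x * (norm (X_classical b \<psi> x) / \<psi> x) powr \<sigma>)
          \<le> A x (u x) (U x) \<bullet> \<Phi> x + f x (u x) * \<phi> x"
        using test_integrand_lower_bound[where a = "A x (u x) (U x)" and \<xi> = "U x" and F = "f x (u x)" and t = "u x"
            and Z = "X_classical b \<psi> x", OF p \<nu>1(1) \<nu>2(1) \<nu>3(1) \<nu>1(2) \<nu>2(2) \<nu>3(2) ux g'(4) \<psi>pos]
        unfolding C1_def C_def \<sigma>_def \<Phi>_def \<phi>_def .
      also have "\<dots> = I x" by (simp add: I_def inner_vec_def)
      finally have "(\<nu>3 / 2) * J x * \<psi> x \<le> I x + C2 * R powr - \<sigma>"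
        using cut by (simp add: J_def mult.assoc)
      moreover have "c0 * J x * indicator ?B x \<le> (\<nu>3 / 2) * J x * \<psi> x"
      proof (cases "x \<in> ?B")
        case inB: True
        have "exp (- 2) \<le> \<psi> x"
          using sB[OF inB] True by (simp add: \<psi>_def flat_poly_def field_simps)
        then have "(\<nu>3 / 2 * J x) * exp (- 2) \<le> (\<nu>3 / 2 * J x) * \<psi> x"
          using \<nu>3(1) J0 by (intro mult_left_mono) auto
        then show ?thesis using inB by (simp add: c0_def mult_ac)
      next
        case False
        then show ?thesis using \<nu>3(1) J0 \<psi>pos by simp
      qed
      ultimately show ?thesis using x4 by simp
    qed
    have fin4: "emeasure lebesgue ?B4 < \<infinity>"
    proof -
      have "?B4 \<in> lmeasurable"
        using open_cc_ball[OF cc] B\<Omega>(2) \<Omega>(2) by (intro bounded_set_imp_lmeasurable) (auto intro: bounded_subset)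
      then show ?thesis unfolding fmeasurable_def by blast
    qed
    have B4m: "?B4 \<in> sets lebesgue" "?B \<in> sets lebesgue" using open_cc_ball[OF cc] by auto
    have Iint: "integrable lebesgue (\<lambda>x. indicator \<Omega> x * I x)" "(LINT x|lebesgue. indicator \<Omega> x * I x) \<le> 0"
      using I by (simp_all add: set_integrable_def set_lebesgue_integral_def)
    have Bint: "integrable lebesgue (\<lambda>x. C2 * R powr - \<sigma> * indicator ?B4 x)"
      using fin4 B4m by (intro integrable_mult_right integrable_real_indicator) auto
    have sumint: "integrable lebesgue (\<lambda>x. indicator \<Omega> x * I x + C2 * R powr - \<sigma> * indicator ?B4 x)"
      using Iint(1) Bint by (rule Bochner_Integration.integrable_add)
    have low: "AE x in lebesgue. c0 * J x * indicator ?B x \<le> indicator \<Omega> x * I x + C2 * R powr - \<sigma> * indicator ?B4 x"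
      using u(2) by eventually_elim (rule lower)
    \<comment> \<open>The comparison is made between non-negative extended integrals, which is
      meaningful before the left-hand side is known to be finite.\<close>
    have "ennreal (1 / c0) * ennreal (indicator \<Omega> x * I x + C2 * R powr - \<sigma> * indicator ?B4 x) \<ge> ennreal (J x) * indicator ?B x"
      if "c0 * J x * indicator ?B x \<le> indicator \<Omega> x * I x + C2 * R powr - \<sigma> * indicator ?B4 x" for x
    proof (cases "x \<in> ?B")
      case True
      have "ennreal (J x) * indicator ?B x = ennreal (1 / c0 * (c0 * J x * indicator ?B x))"
        using True c0 by simp
      also have "\<dots> \<le> ennreal (1 / c0 * (indicator \<Omega> x * I x + C2 * R powr - \<sigma> * indicator ?B4 x))"
        using that c0 by (intro ennreal_leI mult_left_mono) auto
      also have "\<dots> = ennreal (1 / c0) * ennreal (indicator \<Omega> x * I x + C2 * R powr - \<sigma> * indicator ?B4 x)"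
        using c0 by (intro ennreal_mult') auto
      finally show ?thesis .
    qed simp
    then have "(\<integral>\<^sup>+x. ennreal (J x) * indicator ?B x \<partial>lebesgue)
        \<le> (\<integral>\<^sup>+x. ennreal (1 / c0) * ennreal (indicator \<Omega> x * I x + C2 * R powr - \<sigma> * indicator ?B4 x) \<partial>lebesgue)"
      using low by (intro nn_integral_mono_AE) (auto elim: eventually_mono)
    also have "\<dots> = ennreal (1 / c0) * (\<integral>\<^sup>+x. ennreal (indicator \<Omega> x * I x + C2 * R powr - \<sigma> * indicator ?B4 x) \<partial>lebesgue)"
      using sumint by (intro nn_integral_cmult) auto
    also have "(\<integral>\<^sup>+x. ennreal (indicator \<Omega> x * I x + C2 * R powr - \<sigma> * indicator ?B4 x) \<partial>lebesgue)
        = ennreal (LINT x|lebesgue. indicator \<Omega> x * I x + C2 * R powr - \<sigma> * indicator ?B4 x)"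
    proof (rule nn_integral_eq_integral[OF sumint])
      show "AE x in lebesgue. 0 \<le> indicator \<Omega> x * I x + C2 * R powr - \<sigma> * indicator ?B4 x"
        using low
      proof eventually_elim
        case (elim x)
        have "0 \<le> c0 * J x * indicator ?B x" using c0 J0 by simp
        then show ?case using elim by linarith
      qed
    qed
    also have "\<dots> \<le> ennreal (C2 * R powr - \<sigma> * measure lebesgue ?B4)"
      using Iint Bint B4m by (intro ennreal_leI) (simp add: Bochner_Integration.integral_add)
    also have "ennreal (1 / c0) * ennreal (C2 * R powr - \<sigma> * measure lebesgue ?B4)
        = ennreal (C2 / c0 * R powr - \<sigma>) * ennreal (measure lebesgue ?B4)"
      using c0 C2 by (simp add: ennreal_mult[symmetric])
    also have "ennreal (measure lebesgue ?B4) = emeasure lebesgue ?B4"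
      using fin4 by (simp add: emeasure_eq_ennreal_measure)
    finally show ?thesis by (simp add: mult_left_mono)
  qed
  show ?thesis
    by (rule that[of "C2 / c0"]) (use C2 c0 est in \<open>auto simp: J_def\<close>)
qed

theorem theorem1p5:
  fixes b :: "real^'n \<Rightarrow> real^'n^'m"
    and A :: "real^'n \<Rightarrow> real \<Rightarrow> real^'m \<Rightarrow> real^'m"
    and f :: "real^'n \<Rightarrow> real \<Rightarrow> real"
    and u :: "real^'n \<Rightarrow> real"
    and p q Q :: real
  assumes "locally_lipschitz_fields b"
    and "cc_space b Q"
    and "1 \<le> p" and "p < q"
    and "caratheodory (\<lambda>x (s, \<xi>). A x s \<xi>)"
    and "caratheodory f"
    and "S1 p A" and "S2 p A" and "S3 q f"
    and "weak_entire_solution b p A f u"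
    and "AE x in lebesgue. 0 \<le> u x"
  shows "AE x in lebesgue. u x = 0"
proof -
  note b = assms(1) and cc = assms(2) and p = assms(3,4)
  obtain Cd where Cd: "cc_doubling b Cd" using cc by (auto simp: cc_space_def)
  \<comment> \<open>Enlarging the constant preserves doubling and guarantees
    \<open>1 \<le> C\<close>, as wanted for \<open>log 2 C\<close> and for passing between powers of
    \<open>C\<close> and of \<open>ennreal C\<close>.\<close>
  define C where "C = max 1 Cd"
  have C: "1 \<le> C" "cc_doubling b C"
  proof -
    have "ennreal Cd * e \<le> ennreal C * e" for e :: ennreal
      by (intro mult_right_mono ennreal_leI) (simp_all add: C_def)
    then show "1 \<le> C" "cc_doubling b C"
      using Cd unfolding cc_doubling_def by (auto simp: C_def intro: order_trans)
  qed
  \<comment> \<open>Since p \<ge> 1 and q > 0, the exponent \<open>\<sigma>\<close> is at least N /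
    (q - p), and so this choice makes \<open>2 powr \<sigma>\<close> exceed
    \<open>C\<close>.\<close>
  obtain N where N: "log 2 C * (q - p) < real N" using reals_Archimedean2 by blast
  define \<sigma> where "\<sigma> = p * (2 * real N + q) / (q - p)"
  have C\<sigma>: "C < 2 powr \<sigma>"
  proof -
    have "log 2 C < real N / (q - p)" using N p by (simp add: pos_less_divide_eq)
    also have "\<dots> \<le> \<sigma>"
    proof -
      have "1 * real N \<le> p * (2 * real N + q)" using p by (intro mult_mono) auto
      then show ?thesis unfolding \<sigma>_def using p by (intro divide_right_mono) auto
    qed
    finally show ?thesis using C(1) by (simp add: log_less_iff)
  qed
  have \<beta>: "emeasure lebesgue (cc_ball b 0 1) < \<infinity>"
  proof -
    have "bounded (cc_ball b 0 1)"
      using compact_imp_bounded[OF compact_cc_cball[OF b cc, of 0 1]]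
      by (rule bounded_subset) (auto simp: cc_ball_def cc_cball_def)
    then have "cc_ball b 0 1 \<in> lmeasurable"
      using open_cc_ball[OF cc] by (intro bounded_set_imp_lmeasurable) auto
    then show ?thesis unfolding fmeasurable_def by blast
  qed
  define \<beta> where "\<beta> = measure lebesgue (cc_ball b 0 1)"
  have \<beta>_eq: "emeasure lebesgue (cc_ball b 0 1) = ennreal \<beta>" and \<beta>0: "0 \<le> \<beta>"
    using \<beta> by (simp_all add: \<beta>_def emeasure_eq_ennreal_measure)
  obtain D where D: "0 \<le> D" "\<And>R. 0 < R \<Longrightarrow>
      (\<integral>\<^sup>+x. ennreal (u x powr q * damp N (u x)) * indicator (cc_ball b 0 R) x \<partial>lebesgue)
      \<le> ennreal (D * R powr - \<sigma>) * emeasure lebesgue (cc_ball b 0 (4 * R))"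
    using ball_energy_estimate[OF b cc p assms(7-11), of N 0] unfolding \<sigma>_def by blast
  have zero: "(\<integral>\<^sup>+x. ennreal (u x powr q * damp N (u x)) * indicator (cc_ball b 0 (2 ^ l)) x \<partial>lebesgue) = 0"
    (is "?I = 0") for l
  proof -
    \<comment> \<open>The bound at R = 2^k: the ball of radius 4 R has radius 2^(k + 2), which
      accounts for C^2, and each further doubling costs a factor \<open>C\<close> against the gain
      \<open>2 powr \<sigma>\<close>.\<close>
    let ?a = "\<lambda>k. D * C\<^sup>2 * \<beta> * (C / 2 powr \<sigma>) ^ k"
    have "?I \<le> ennreal (?a k)" if k: "l \<le> k" for k
    proof -
      have lk: "(2::real) ^ l \<le> 2 ^ k" using k by (intro power_increasing) auto
      have "cc_ball b 0 (2 ^ l) \<subseteq> cc_ball b 0 (2 ^ k)"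
        unfolding cc_ball_def using less_le_trans[OF _ lk] by blast
      then have "?I \<le> (\<integral>\<^sup>+x. ennreal (u x powr q * damp N (u x)) * indicator (cc_ball b 0 (2 ^ k)) x \<partial>lebesgue)"
        by (intro nn_integral_mono mult_left_mono) (auto simp: indicator_def)
      also have "\<dots> \<le> ennreal (D * (2 ^ k) powr - \<sigma>) * emeasure lebesgue (cc_ball b 0 (4 * 2 ^ k))"
        by (rule D(2)) simp
      also have "emeasure lebesgue (cc_ball b 0 (4 * 2 ^ k)) \<le> ennreal C ^ (k + 2) * ennreal \<beta>"
        using emeasure_cc_ball_le[OF C(2), of 0 "k + 2"] by (simp add: \<beta>_eq power_add mult.commute)
      also have "ennreal (D * (2 ^ k) powr - \<sigma>) * (ennreal C ^ (k + 2) * ennreal \<beta>)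
          = ennreal (D * (2 ^ k) powr - \<sigma> * (C ^ (k + 2) * \<beta>))"
        using C(1) D(1) \<beta>0 by (simp add: ennreal_power ennreal_mult[symmetric])
      also have "D * (2 ^ k) powr - \<sigma> * (C ^ (k + 2) * \<beta>) = ?a k"
      proof -
        have "(2 ^ k) powr - \<sigma> = 1 / (2 powr \<sigma>) ^ k"
          by (simp add: powr_minus_divide powr_realpow[symmetric] powr_powr mult.commute)
        then show ?thesis by (simp add: power_add power_divide power2_eq_square mult_ac)
      qed
      finally show ?thesis by (simp add: mult_left_mono)
    qed
    moreover have "?a \<longlonglongrightarrow> D * C\<^sup>2 * \<beta> * 0"
      using C C\<sigma> by (intro tendsto_mult_left LIMSEQ_power_zero) auto
    then have "(\<lambda>k. ennreal (?a k)) \<longlonglongrightarrow> ennreal 0"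
      by (intro tendsto_ennrealI) simp
    ultimately have "?I \<le> ennreal 0"
      by (intro LIMSEQ_le_const[of "\<lambda>k. ennreal (?a k)"]) auto
    then show ?thesis by simp
  qed
  have "AE x in lebesgue. x \<in> cc_ball b 0 (2 ^ l) \<longrightarrow> u x = 0" for l :: nat
  proof -
    let ?B = "cc_ball b 0 (2 ^ l)"
    have "bounded ?B"
      using compact_imp_bounded[OF compact_cc_cball[OF b cc, of 0 "2 ^ l"]]
      by (rule bounded_subset) (auto simp: cc_ball_def cc_cball_def)
    moreover have B: "open ?B" by (rule open_cc_ball[OF cc])
    ultimately have "u \<in> L1p b p ?B"
      using assms(10) by (simp add: weak_entire_solution_def L1p_loc_def)
    \<comment> \<open>A vanishing non-negative integral forces a measurable integrand to vanish
      almost everywhere. Measurability of \<open>u\<close> is available on bounded open sets, as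
      part of membership in \<open>L1p\<close>, so the argument is carried out ball by ball.\<close>
    then have meas: "(\<lambda>x. indicator ?B x * u x) \<in> borel_measurable lebesgue"
      unfolding L1p_def X_closure_def set_borel_measurable_def by auto
    let ?J = "\<lambda>t::real. ennreal (t powr q * damp N t)"
    have "?J \<in> borel_measurable borel" unfolding damp_def by measurable
    from measurable_compose[OF meas this]
    have "(\<lambda>x. ?J (indicator ?B x * u x)) \<in> borel_measurable lebesgue" .
    moreover have "(\<lambda>x. indicator ?B x :: ennreal) \<in> borel_measurable lebesgue"
      using B by (intro borel_measurable_indicator) auto
    ultimately have "(\<lambda>x. ?J (indicator ?B x * u x) * indicator ?B x) \<in> borel_measurable lebesgue"
      by (rule borel_measurable_times_ennreal)
    moreover have "(\<lambda>x. ?J (indicator ?B x * u x) * indicator ?B x) = (\<lambda>x. ?J (u x) * indicator ?B x)"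
      by (auto simp: indicator_def)
    ultimately have "AE x in lebesgue. ?J (u x) * indicator ?B x = 0"
      using zero[of l] by (simp add: nn_integral_0_iff_AE)
    then show ?thesis
    proof (eventually_elim, intro impI)
      fix x assume *: "?J (u x) * indicator ?B x = 0" and x: "x \<in> ?B"
      show "u x = 0"
      proof (rule ccontr)
        assume "u x \<noteq> 0"
        then have "0 < u x powr q * damp N (u x)" using damp_pos by (intro mult_pos_pos) auto
        then show False using * x by (simp add: ennreal_eq_0_iff)
      qed
    qed
  qed
  then have "AE x in lebesgue. \<forall>l::nat. x \<in> cc_ball b 0 (2 ^ l) \<longrightarrow> u x = 0"
    by (intro AE_all_countable[THEN iffD2] allI)
  then show ?thesis
  proof eventually_elim
    case (elim x)
    obtain l :: nat where "cc_dist b 0 x < 2 ^ l" using real_arch_pow[of 2] by auto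
    then show ?case using elim by (auto simp: cc_ball_def)
  qed
qed

end
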